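(* Let $\epsilon\in\mathbb R$. Assume the following. (1) The support $\mathcal X$ of $X$ is a compact subset of $\mathbb R^d$ and $\mathcal X_0$ is an inner closed subset of $\mathcal X$ (a closed set lying in the interior of $\mathcal X$) with nonempty interior. (2) The p.d.f. $g$ of $X$ is strictly positive over $\mathcal X_0$ and has continuous second order partial derivatives over $\mathcal X$. (3) $m$ has continuous second order partial derivatives over $\mathcal X$. (4) The i.i.d. errors $\varepsilon,\varepsilon_i$ are centered, have finite 6th moments, and are independent of the covariates $X,X_i$. (5) The p.d.f. $f$ of $\varepsilon$ has bounded continuous second order derivatives over $\mathbb R$ and, for $h_p(e)=e^pf(e)$, $\sup_{e\in\mathbb R}|h_p^{(k)}(e)|<\infty$ for integers $p,k\in[0,2]$. (6) $K_0$ is symmetric, continuous over $\mathbb R^d$ with support contained in $[-1/2,1/2]^d$, and $\int K_0(z)\,dz=1$. (7) $K_1$ has compact support, is three times continuously differentiable over $\mathbb R$, $\int K_1(v)\,dv=1$ and $\int vK_1(v)\,dv=0$. (8) $b_0$ decreases to $0$ and, for $d^*=\sup\{d+2,2d\}$, $nb_0^{d^*}/\ln n\to\infty$ and $\ln(1/b_0)/\ln(\ln n)\to\infty$. (9) $b_1$ decreases to $0$ and $n^{d+8}b_1^{7(d+4)}\to\infty$. (10) As $n\to\infty$, $nb_0^{d+4}=O(1)$, $nb_0^4b_1=o(1)$ and $nb_0^db_1^3\to\infty$. Then, as $n\to\infty$, $$\sqrt{nb_1}\left(\widehat f_{1n}(\epsilon)-\overline f_{1n}(\epsilon)\right)\xrightarrow{d}\mathcal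 N\left(0,\ \frac{f(\epsilon)}{\mathbb P(X\in\mathcal X_0)}\int K_1^2(v)\,dv\right),$$ where $$\overline f_{1n}(\epsilon)=f(\epsilon)+\frac{b_1^2}2f^{(2)}(\epsilon)\int v^2K_1(v)\,dv+o(b_1^2).$$
   Context: $(X,Y),(X_1,Y_1),\dots,(X_n,Y_n)$ are i.i.d. with $Y$ real and $X$ in $\mathbb R^d$; $m(x)=\mathbb E[Y|X=x]$, $Y_i=m(X_i)+\varepsilon_i$. Bandwidths $b_0,b_1$ depend on $n$. $\overline f_{1n}(\epsilon)$ is a deterministic centering sequence having the stated expansion. Leave-one-out regression estimator, estimated residuals and density estimator: $$\widehat m_{in}=\frac{\sum_{j\ne i}Y_jK_0\left(\frac{X_j-X_i}{b_0}\right)}{\sum_{j\neq i}K_0\left(\frac{X_j-X_i}{b_0}\right)},\qquad \widehat\varepsilon_i=Y_i-\widehat m_{in},\qquad \widehat f_{1n}(\epsilon)=\frac{\sum_{i=1}^n\mathbf 1(X_i\in\mathcal X_0)K_1\left(\frac{\widehat\varepsilon_i-\epsilon}{b_1}\right)}{b_1\sum_{i=1}^n\mathbf 1(X_i\in\mathcal X_0)}.$$ *)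

theory Defs
  imports "HOL-Probability.Probability"
begin

text \<open>
  Samples are sequences \<^term>\<open>X :: nat \<Rightarrow> 'a \<Rightarrow> real ^ 'd\<close>, \<^term>\<open>Y :: nat \<Rightarrow> 'a \<Rightarrow> real\<close>. Index 0 is the
  generic pair \<open>(X, Y)\<close>; the sample of size \<open>n\<close> consists of the indices \<open>1, \<dots>, n\<close>.
\<close>

definition rv_support :: "'a measure \<Rightarrow> ('a \<Rightarrow> 'b::topological_space) \<Rightarrow> 'b set" where
  "rv_support M X = {x. \<forall>U. open U \<longrightarrow> x \<in> U \<longrightarrow> 0 < \<P>(\<omega> in M. X \<omega> \<in> U)}"

text \<open>
  \<^const>\<open>prob_space.indep_var\<close> forces both variables to take values in the same type; this is the same
  notion without that restriction.
\<close>

definition indep_rv ::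
  "'a measure \<Rightarrow> 'b measure \<Rightarrow> ('a \<Rightarrow> 'b) \<Rightarrow> 'c measure \<Rightarrow> ('a \<Rightarrow> 'c) \<Rightarrow> bool" where
  "indep_rv M S U T V \<longleftrightarrow>
     U \<in> measurable M S \<and> V \<in> measurable M T \<and>
     prob_space.indep_set M {U -` A \<inter> space M | A. A \<in> sets S} {V -` B \<inter> space M | B. B \<in> sets T}"

definition regression_function ::
  "'a measure \<Rightarrow> ('a \<Rightarrow> 'b::topological_space) \<Rightarrow> ('a \<Rightarrow> real) \<Rightarrow> ('b \<Rightarrow> real) \<Rightarrow> bool" where
  "regression_function M X Y m \<longleftrightarrow>
     integrable M Y \<and> m \<in> borel_measurable borel \<and>
     (AE \<omega> in M. real_cond_exp M (vimage_algebra (space M) X borel) Y \<omega> = m (X \<omega>))"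

text \<open>
  Continuous partial derivatives up to order two over a set \<open>S\<close> that need not be open: the partial
  derivatives exist at the interior points of \<open>S\<close> and extend continuously to \<open>S\<close>. No regularity
  across the boundary is asked, since a density vanishes outside the support and may jump there.
  Here \<open>D1 i\<close> is the partial derivative in direction \<open>i\<close>, and \<open>D2 i j\<close> that of \<open>D1 i\<close> in
  direction \<open>j\<close>.
\<close>

definition C2_over :: "(real ^ 'd) set \<Rightarrow> (real ^ 'd \<Rightarrow> real) \<Rightarrow> bool" where
  "C2_over S h \<longleftrightarrow>
     continuous_on S h \<and>
     (\<exists>(D1 :: 'd \<Rightarrow> real ^ 'd \<Rightarrow> real) (D2 :: 'd \<Rightarrow> 'd \<Rightarrow> real ^ 'd \<Rightarrow> real).
        (\<forall>i. continuous_on S (D1 i)) \<and> (\<forall>i j. continuous_on S (D2 i j)) \<and>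
        (\<forall>x\<in>interior S. \<forall>i.
           ((\<lambda>t. h (x + t *\<^sub>R axis i 1)) has_real_derivative D1 i x) (at 0)) \<and>
        (\<forall>x\<in>interior S. \<forall>i j.
           ((\<lambda>t. D1 i (x + t *\<^sub>R axis j 1)) has_real_derivative D2 i j x) (at 0)))"

definition Ck_real :: "nat \<Rightarrow> (real \<Rightarrow> real) \<Rightarrow> bool" where
  "Ck_real k h \<longleftrightarrow>
     (\<forall>j<k. \<forall>x. (deriv ^^ j) h differentiable (at x)) \<and> continuous_on UNIV ((deriv ^^ k) h)"

text \<open>
  The variance is allowed to vanish, in which case the law is the point mass at the mean
  (\<^const>\<open>normal_density\<close> with standard deviation 0 is not a probability density).
\<close>

definition normal_law :: "real \<Rightarrow> real \<Rightarrow> real measure" where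
  "normal_law \<mu> v =
     (if v = 0 then return borel \<mu> else density lborel (normal_density \<mu> (sqrt v)))"

definition loo_regression ::
  "(real ^ 'd \<Rightarrow> real) \<Rightarrow> real \<Rightarrow> (nat \<Rightarrow> 'a \<Rightarrow> real ^ 'd) \<Rightarrow> (nat \<Rightarrow> 'a \<Rightarrow> real) \<Rightarrow>
     nat \<Rightarrow> nat \<Rightarrow> 'a \<Rightarrow> real" where
  "loo_regression K0 b0 X Y n i \<omega> =
     (\<Sum>j\<in>{1..n} - {i}. Y j \<omega> * K0 ((X j \<omega> - X i \<omega>) /\<^sub>R b0)) /
     (\<Sum>j\<in>{1..n} - {i}. K0 ((X j \<omega> - X i \<omega>) /\<^sub>R b0))"

definition est_residual ::
  "(real ^ 'd \<Rightarrow> real) \<Rightarrow> real \<Rightarrow> (nat \<Rightarrow> 'a \<Rightarrow> real ^ 'd) \<Rightarrow> (nat \<Rightarrow> 'a \<Rightarrow> real) \<Rightarrow>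
     nat \<Rightarrow> nat \<Rightarrow> 'a \<Rightarrow> real" where
  "est_residual K0 b0 X Y n i \<omega> = Y i \<omega> - loo_regression K0 b0 X Y n i \<omega>"

definition error_density_estimator ::
  "(real ^ 'd \<Rightarrow> real) \<Rightarrow> (real \<Rightarrow> real) \<Rightarrow> real \<Rightarrow> real \<Rightarrow> (real ^ 'd) set \<Rightarrow>
     (nat \<Rightarrow> 'a \<Rightarrow> real ^ 'd) \<Rightarrow> (nat \<Rightarrow> 'a \<Rightarrow> real) \<Rightarrow> nat \<Rightarrow> real \<Rightarrow> 'a \<Rightarrow> real" where
  "error_density_estimator K0 K1 b0 b1 \<X>\<^sub>0 X Y n \<epsilon> \<omega> =
     (\<Sum>i=1..n. indicator \<X>\<^sub>0 (X i \<omega>) * K1 ((est_residual K0 b0 X Y n i \<omega> - \<epsilon>) / b1)) /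
     (b1 * (\<Sum>i=1..n. indicator \<X>\<^sub>0 (X i \<omega>)))"

end

theory Submission
  imports Defs
begin

text \<open>
  Design and errors are independent, so the argument is conditional on the design. Given the design,
  the residual of observation \<open>i\<close> is \<open>e i + \<Delta> i\<close>, where \<open>\<Delta> i\<close> is affine in the errors other than
  \<open>e i\<close> because the regression estimator leaves observation \<open>i\<close> out. Averaging over \<open>e i\<close> smooths the
  kernel, so the mean of the increment \<open>\<kappa> (e i + \<Delta> i) - \<kappa> (e i)\<close> has a second order expansion in
  \<open>\<Delta> i\<close>; the centred increments \<open>Z i\<close> are almost uncorrelated, because \<open>Z i\<close> depends on \<open>e j\<close> only
  through a weight of order \<open>1 / (n b\<^sub>0\<^sup>d)\<close>. Hence replacing errors by residuals does not affect the limit,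
  and for the true errors the central limit theorem for bounded triangular arrays applies. These
  estimates need lower bounds on the denominators, upper bounds on the number of neighbours and a
  small mean squared bias, uniformly over the sample. By Hoeffding's inequality, and by Markov's
  inequality for the bias, they hold with probability tending to one. Conditional characteristic
  functions are then averaged over the design.
\<close>

section \<open>Resampling one coordinate of a product measure\<close>

text \<open>Expanding the kernel itself in the shift would need shifts small against the density
  bandwidth \<open>h\<close>, uniformly over the sample. Its mean can be expanded instead, since a
  substitution moves the shift into the smooth error density. Three terms result, to be compared
  with \<open>sqrt (n * h)\<close>. Linear: a slope of order \<open>h\<close> times the sum of all
  shifts; interchanging sums gives a form in the errors whose coefficients are column sums of the
  weights, so its noise has order \<open>sqrt n\<close> and contributes only \<open>sqrt h\<close>.
  Quadratic: \<open>h\<close> times the sum of squared shifts. Centred: increments with second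
  moment of order 1/h times the squared shift; with \<open>b\<close> the regression bandwidth, their
  noise is negligible because \<open>n * b ^ d * h ^ 2\<close> diverges. The bias enters only
  through \<open>h\<close> times the sum of its squares, of order
  \<open>h * b ^ 2 / b ^ d + n * b ^ 4 * h\<close>; no supremum over the sample is taken, which is
  why Markov's inequality suffices for it.

  The centering sequence is the exact mean of the kernel estimate from true errors. The array in the
  central limit theorem is therefore exactly centred, and the smoothing bias appears only when that
  mean is expanded.\<close>

context
  fixes N :: "'b measure" and P :: "('i \<Rightarrow> 'b) measure"
  assumes N: "prob_space N" and P_def: "P = PiM UNIV (\<lambda>_. N)"
begin

interpretation N: prob_space N by (rule N)
interpretation P: prob_space P unfolding P_def by (rule prob_space_PiM) (rule N)
interpretation NP: pair_prob_space N P ..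

lemma measurable_fun_upd_PiM[measurable]:
  "(\<lambda>(t, w). w(i := t)) \<in> measurable (N \<Otimes>\<^sub>M P) P"
  unfolding P_def
  by (intro measurable_PiM_single') (auto simp: fun_upd_def space_PiM space_pair_measure split_beta')

lemma space_P_upd: "w \<in> space P \<Longrightarrow> t \<in> space N \<Longrightarrow> w(i := t) \<in> space P"
  by (auto simp: P_def space_PiM)

text \<open>Overwriting one coordinate by an independent copy preserves the product law. The
  iterated integrals are Fubini in both orders: the second claim conditions on all coordinates but
  \<open>i\<close>, the third freezes the value of coordinate \<open>i\<close>.\<close>

lemma integral_PiM_resample:
  fixes h :: "('i \<Rightarrow> 'b) \<Rightarrow> real"
  assumes "integrable P h"
  shows "integrable (N \<Otimes>\<^sub>M P) (\<lambda>(t, w). h (w(i := t)))"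
    and "(\<integral>w. h w \<partial>P) = (\<integral>w. (\<integral>t. h (w(i := t)) \<partial>N) \<partial>P)"
    and "(\<integral>w. h w \<partial>P) = (\<integral>t. (\<integral>w. h (w(i := t)) \<partial>P) \<partial>N)"
proof -
  have D: "distr (N \<Otimes>\<^sub>M P) P (\<lambda>(t, w). w(i := t)) = P"
    using distr_pair_PiM_eq_PiM[of UNIV "\<lambda>_. N" i] N by (simp add: P_def)
  have h[measurable]: "h \<in> borel_measurable P" using assms by simp
  have "integrable (distr (N \<Otimes>\<^sub>M P) P (\<lambda>(t, w). w(i := t))) h" using assms by (simp add: D)
  then show I: "integrable (N \<Otimes>\<^sub>M P) (\<lambda>(t, w). h (w(i := t)))"
    by (subst (asm) integrable_distr_eq) (auto simp: split_beta')
  have "(\<integral>w. h w \<partial>P) = (\<integral>w. h w \<partial>distr (N \<Otimes>\<^sub>M P) P (\<lambda>(t, w). w(i := t)))" by (simp add: D)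
  also have "\<dots> = (\<integral>(t, w). h (w(i := t)) \<partial>(N \<Otimes>\<^sub>M P))"
    by (subst integral_distr) (auto simp: split_beta')
  finally have E: "(\<integral>w. h w \<partial>P) = (\<integral>(t, w). h (w(i := t)) \<partial>(N \<Otimes>\<^sub>M P))" .
  show "(\<integral>w. h w \<partial>P) = (\<integral>w. (\<integral>t. h (w(i := t)) \<partial>N) \<partial>P)"
    using NP.integral_snd[OF I] by (simp add: E)
  show "(\<integral>w. h w \<partial>P) = (\<integral>t. (\<integral>w. h (w(i := t)) \<partial>P) \<partial>N)"
    using NP.integral_fst[of "\<lambda>t w. h (w(i := t))"] I by (simp add: E)
qed

text \<open>Given the other coordinates, \<open>U\<close> is a constant factor and \<open>V\<close>
  averages to zero. The two factors may share every coordinate except \<open>i\<close>; the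
  vanishing covariances below come from this.\<close>

lemma integral_PiM_mult_centred:
  fixes U V :: "('i \<Rightarrow> 'b) \<Rightarrow> real"
  assumes "integrable P (\<lambda>w. U w * V w)"
    and U: "\<And>w t. U (w(i := t)) = U w"
    and V: "\<And>w. w \<in> space P \<Longrightarrow> (\<integral>t. V (w(i := t)) \<partial>N) = 0"
  shows "(\<integral>w. U w * V w \<partial>P) = 0"
proof -
  have "(\<integral>w. U w * V w \<partial>P) = (\<integral>w. (\<integral>t. U w * V (w(i := t)) \<partial>N) \<partial>P)"
    using integral_PiM_resample(2)[OF assms(1), of i] by (simp add: U)
  also have "\<dots> = (\<integral>w. 0 \<partial>P)"
    by (intro Bochner_Integration.integral_cong) (auto simp: V)
  finally show ?thesis by simp
qed

text \<open>Lets a bound obtained by integrating a single error, with its shift frozen, serve as a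
  bound on the full mean.\<close>

lemma integral_PiM_resample_le:
  fixes h :: "('i \<Rightarrow> 'b) \<Rightarrow> real"
  assumes "integrable P h" "integrable P G"
    and "\<And>w. w \<in> space P \<Longrightarrow> (\<integral>t. h (w(i := t)) \<partial>N) \<le> G w"
  shows "(\<integral>w. h w \<partial>P) \<le> (\<integral>w. G w \<partial>P)"
proof -
  have "integrable P (\<lambda>w. \<integral>t. h (w(i := t)) \<partial>N)"
    using NP.integrable_snd[OF integral_PiM_resample(1)[OF assms(1), of i]] by simp
  then show ?thesis
    unfolding integral_PiM_resample(2)[OF assms(1), of i] using assms(2,3)
    by (intro integral_mono) auto
qed

lemma distr_PiM_comp: "distr P N (\<lambda>w. w i) = N"
  unfolding P_def by (rule distr_PiM_component) (auto intro: N)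

lemma integral_PiM_component:
  fixes h :: "'b \<Rightarrow> real"
  assumes [measurable]: "h \<in> borel_measurable N"
  shows "(\<integral>w. h (w i) \<partial>P) = (\<integral>t. h t \<partial>N)"
    and "integrable P (\<lambda>w. h (w i)) \<longleftrightarrow> integrable N h"
proof -
  have [measurable]: "(\<lambda>w. w i) \<in> measurable P N" by (simp add: P_def)
  show "(\<integral>w. h (w i) \<partial>P) = (\<integral>t. h t \<partial>N)"
    using integral_distr[of "\<lambda>w. w i" P N h] by (simp add: distr_PiM_comp)
  show "integrable P (\<lambda>w. h (w i)) \<longleftrightarrow> integrable N h"
    using integrable_distr_eq[of "\<lambda>w. w i" P N h] by (simp add: distr_PiM_comp)
qed

lemma integral_PiM_sum_square:
  fixes q :: "'i \<Rightarrow> 'b \<Rightarrow> real"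
  assumes [measurable]: "\<And>j. j \<in> J \<Longrightarrow> q j \<in> borel_measurable N"
    and J: "finite J"
    and q2: "\<And>j. j \<in> J \<Longrightarrow> integrable N (\<lambda>t. (q j t)\<^sup>2)"
    and q0: "\<And>j. j \<in> J \<Longrightarrow> (\<integral>t. q j t \<partial>N) = 0"
  shows "integrable P (\<lambda>w. (\<Sum>j\<in>J. q j (w j))\<^sup>2)"
    and "(\<integral>w. (\<Sum>j\<in>J. q j (w j))\<^sup>2 \<partial>P) = (\<Sum>j\<in>J. \<integral>t. (q j t)\<^sup>2 \<partial>N)"
proof -
  have [measurable]: "(\<lambda>w. w i) \<in> measurable P N" for i by (simp add: P_def)
  have I2: "integrable P (\<lambda>w. (q j (w j))\<^sup>2)" if "j \<in> J" for j
    using integral_PiM_component(2)[of "\<lambda>t. (q j t)\<^sup>2" j] q2 that by simp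
  have I: "integrable P (\<lambda>w. q j (w j) * q k (w k))" if "j \<in> J" "k \<in> J" for j k
  proof (rule Bochner_Integration.integrable_bound[OF Bochner_Integration.integrable_add[OF I2[OF that(1)] I2[OF that(2)]]])
    show "AE x in P. norm (q j (x j) * q k (x k)) \<le> norm ((q j (x j))\<^sup>2 + (q k (x k))\<^sup>2)"
    proof (intro AE_I2)
      fix x
      have "2 * \<bar>q j (x j)\<bar> * \<bar>q k (x k)\<bar> \<le> (q j (x j))\<^sup>2 + (q k (x k))\<^sup>2"
        using sum_squares_bound[of "\<bar>q j (x j)\<bar>" "\<bar>q k (x k)\<bar>"] by simp
      moreover have "0 \<le> \<bar>q j (x j)\<bar> * \<bar>q k (x k)\<bar>" by simp
      ultimately show "norm (q j (x j) * q k (x k)) \<le> norm ((q j (x j))\<^sup>2 + (q k (x k))\<^sup>2)"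
        by (subst real_norm_def, subst abs_mult, subst real_norm_def) linarith
    qed
  qed (use that in simp)
  have Z: "(\<integral>w. q j (w j) * q k (w k) \<partial>P) = 0" if "j \<in> J" "k \<in> J" "j \<noteq> k" for j k
    by (rule integral_PiM_mult_centred[OF I[OF that(1,2)], of k]) (use that q0 in auto)
  have E: "(\<Sum>j\<in>J. q j (w j))\<^sup>2 = (\<Sum>j\<in>J. \<Sum>k\<in>J. q j (w j) * q k (w k))" for w
    by (simp add: power2_eq_square sum_product)
  show "integrable P (\<lambda>w. (\<Sum>j\<in>J. q j (w j))\<^sup>2)" unfolding E by (intro Bochner_Integration.integrable_sum I)
  have "(\<integral>w. (\<Sum>j\<in>J. q j (w j))\<^sup>2 \<partial>P) = (\<Sum>j\<in>J. \<Sum>k\<in>J. \<integral>w. q j (w j) * q k (w k) \<partial>P)"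
    unfolding E using I by (simp add: Bochner_Integration.integral_sum)
  also have "\<dots> = (\<Sum>j\<in>J. \<Sum>k\<in>J. if k = j then \<integral>t. (q j t)\<^sup>2 \<partial>N else 0)"
  proof (intro sum.cong refl)
    fix j k assume "j \<in> J" "k \<in> J"
    then show "(\<integral>w. q j (w j) * q k (w k) \<partial>P) = (if k = j then \<integral>t. (q j t)\<^sup>2 \<partial>N else 0)"
      using Z[of j k] integral_PiM_component(1)[of "\<lambda>t. (q j t)\<^sup>2" j]
      by (auto simp: power2_eq_square)
  qed
  also have "\<dots> = (\<Sum>j\<in>J. \<integral>t. (q j t)\<^sup>2 \<partial>N)" using J by simp
  finally show "(\<integral>w. (\<Sum>j\<in>J. q j (w j))\<^sup>2 \<partial>P) = (\<Sum>j\<in>J. \<integral>t. (q j t)\<^sup>2 \<partial>N)" .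
qed

end

section \<open>Replacing errors by residuals for a fixed design\<close>

text \<open>Read off from the nonnegativity of the variance of the absolute value.\<close>

lemma (in prob_space) expectation_abs_le_sqrt:
  fixes h :: "'a \<Rightarrow> real"
  assumes [measurable]: "h \<in> borel_measurable M" and h2: "integrable M (\<lambda>x. (h x)\<^sup>2)"
  shows "integrable M h" "expectation (\<lambda>x. \<bar>h x\<bar>) \<le> sqrt (expectation (\<lambda>x. (h x)\<^sup>2))"
proof -
  show h: "integrable M h" by (rule square_integrable_imp_integrable) (use h2 in auto)
  have "0 \<le> variance (\<lambda>x. \<bar>h x\<bar>)" by (rule variance_positive)
  also have "\<dots> = expectation (\<lambda>x. (h x)\<^sup>2) - (expectation (\<lambda>x. \<bar>h x\<bar>))\<^sup>2"
    using h h2 by (subst variance_eq) auto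
  finally show "expectation (\<lambda>x. \<bar>h x\<bar>) \<le> sqrt (expectation (\<lambda>x. (h x)\<^sup>2))"
    by (intro real_le_rsqrt) simp
qed

lemma mult_le_half_squares: "x * y \<le> (x * x + y * y) / 2" for x y :: real
  using sum_squares_bound[of x y] by (simp add: power2_eq_square)

section \<open>Linear forms in independent centred errors\<close>

locale error_law = prob_space N for N :: "real measure" +
  assumes sets_N[measurable_cong]: "sets N = sets borel"
    and int_sq: "integrable N (\<lambda>u. u\<^sup>2)"
    and mean0: "(\<integral>u. u \<partial>N) = 0"
begin

abbreviation "P \<equiv> PiM UNIV (\<lambda>_::nat. N)"
definition "s2 = (\<integral>u. u\<^sup>2 \<partial>N)"

lemma space_N[simp]: "space N = UNIV" using sets_eq_imp_space_eq[OF sets_N] by simp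

lemma prob_N: "prob_space N" by (rule prob_space_axioms)

lemma meas_N[simp]: "measurable N L = measurable borel L"
  by (rule measurable_cong_sets[OF sets_N refl])

sublocale P: prob_space P by (rule prob_space_PiM) (rule prob_N)

lemma meas_coord[measurable]: "(\<lambda>e. e j) \<in> borel_measurable P"
  using measurable_component_singleton[of j UNIV "\<lambda>_. N"] measurable_cong_sets[OF refl sets_N] by simp

lemma meas_upd: "(\<lambda>e. e(j := t)) \<in> measurable P P"
  by (intro measurable_PiM_single') (auto simp: fun_upd_def space_PiM)

lemma s2_nonneg: "0 \<le> s2" by (simp add: s2_def)

lemma int_lin: "integrable N (\<lambda>u. u)"
  by (rule square_integrable_imp_integrable) (use int_sq in auto)

lemma lin_square:
  assumes "finite J"
  shows "integrable P (\<lambda>e. (\<Sum>j\<in>J. a j * e j)\<^sup>2)"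
    and "(\<integral>e. (\<Sum>j\<in>J. a j * e j)\<^sup>2 \<partial>P) = s2 * (\<Sum>j\<in>J. (a j)\<^sup>2)"
proof -
  have 0: "(\<integral>t. a j * t \<partial>N) = 0" for j using mean0 by simp
  have 2: "integrable N (\<lambda>t. (a j * t)\<^sup>2)" "(\<integral>t. (a j * t)\<^sup>2 \<partial>N) = (a j)\<^sup>2 * s2" for j
    unfolding power_mult_distrib s2_def using int_sq by simp_all
  note * = integral_PiM_sum_square[OF prob_N refl _ assms, of "\<lambda>j t. a j * t", OF _ 2(1) 0]
  show "integrable P (\<lambda>e. (\<Sum>j\<in>J. a j * e j)\<^sup>2)" by (rule *(1)) simp
  have "(\<integral>e. (\<Sum>j\<in>J. a j * e j)\<^sup>2 \<partial>P) = (\<Sum>j\<in>J. \<integral>t. (a j * t)\<^sup>2 \<partial>N)" by (rule *(2)) simp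
  also have "\<dots> = s2 * (\<Sum>j\<in>J. (a j)\<^sup>2)" unfolding 2(2) by (simp add: sum_distrib_left mult.commute)
  finally show "(\<integral>e. (\<Sum>j\<in>J. a j * e j)\<^sup>2 \<partial>P) = s2 * (\<Sum>j\<in>J. (a j)\<^sup>2)" .
qed

lemma lin_integrable: "finite J \<Longrightarrow> integrable P (\<lambda>e. \<Sum>j\<in>J. a j * e j)"
  by (rule P.expectation_abs_le_sqrt(1)[OF _ lin_square(1)]) simp_all

lemma lin_mean: "(\<integral>e. (\<Sum>j\<in>J. a j * e j) \<partial>P) = 0"
proof -
  have "(\<integral>e. e i \<partial>P) = 0" "integrable P (\<lambda>e. e i)" for i
    using integral_PiM_component[OF prob_N refl, of "\<lambda>t. t" i, unfolded meas_N, OF measurable_ident_sets[OF refl]]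
      int_lin mean0 by (simp_all only: simp_thms)
  then show ?thesis by (subst Bochner_Integration.integral_sum) (simp_all only: integral_mult_right_zero integrable_mult_right integral_mult_right mult_zero_right sum.neutral_const)
qed

end

text \<open>In the application \<open>\<kappa>\<close> is the rescaled kernel centred at the
  estimation point and \<open>\<phi>\<close> its mean at a shifted error. Smoothness enters in two
  averaged forms: a mean square Lipschitz constant \<open>Q\<close>, of order 1/h for the kernel,
  and an expansion of the mean with slope \<open>c\<close> and remainder constant \<open>q\<close>,
  both of order \<open>h\<close>.\<close>

locale residual_perturbation = error_law N for N :: "real measure" +
  fixes \<kappa> :: "real \<Rightarrow> real" and \<phi> :: "real \<Rightarrow> real" and B Q q c :: real
  assumes \<kappa>_meas[measurable]: "\<kappa> \<in> borel_measurable borel"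
    and \<kappa>_bound: "\<And>u. \<bar>\<kappa> u\<bar> \<le> B"
    and \<phi>_def: "\<And>\<delta>. \<phi> \<delta> = (\<integral>u. \<kappa> (u + \<delta>) \<partial>N)"
    and \<kappa>_L2: "\<And>\<delta> \<delta>'. (\<integral>u. (\<kappa> (u + \<delta>) - \<kappa> (u + \<delta>'))\<^sup>2 \<partial>N) \<le> Q * (\<delta> - \<delta>')\<^sup>2"
    and \<phi>_expand: "\<And>\<delta>. \<bar>\<phi> \<delta> - \<phi> 0 - c * \<delta>\<bar> \<le> q * \<delta>\<^sup>2"
begin

text \<open>The increment minus its mean over \<open>u\<close> for a fixed shift. It stays centred
  given a random shift that does not involve \<open>u\<close>, which is what leaving the observation
  out provides.\<close>

definition "\<psi> u \<delta> = \<kappa> (u + \<delta>) - \<kappa> u - (\<phi> \<delta> - \<phi> 0)"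

lemma \<kappa>_int: "integrable N (\<lambda>u. \<kappa> (u + \<delta>))"
  by (rule integrable_const_bound[of _ B]) (use \<kappa>_bound in auto)

lemma \<phi>_meas[measurable]: "\<phi> \<in> borel_measurable borel"
proof -
  have "\<phi> = (\<lambda>\<delta>. \<integral>u. \<kappa> (u + \<delta>) \<partial>N)" by (simp add: \<phi>_def fun_eq_iff)
  then show ?thesis by simp
qed

lemma \<phi>_bound: "\<bar>\<phi> \<delta>\<bar> \<le> B"
proof -
  have "\<bar>\<phi> \<delta>\<bar> \<le> (\<integral>u. \<bar>\<kappa> (u + \<delta>)\<bar> \<partial>N)" unfolding \<phi>_def by (rule integral_abs_bound)
  also have "\<dots> \<le> (\<integral>u. B \<partial>N)"
    by (intro integral_mono integrable_abs \<kappa>_int) (use \<kappa>_bound in auto)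
  finally show ?thesis by (simp add: prob_space[simplified])
qed

lemma \<psi>_bound: "\<bar>\<psi> u \<delta>\<bar> \<le> 4 * B"
  using \<kappa>_bound[of "u + \<delta>"] \<kappa>_bound[of u] \<phi>_bound[of \<delta>] \<phi>_bound[of 0] by (simp add: \<psi>_def)

lemma \<psi>_meas: "(\<lambda>(u, \<delta>). \<psi> u \<delta>) \<in> borel_measurable (borel \<Otimes>\<^sub>M borel)"
  unfolding \<psi>_def by measurable

lemma \<psi>_meas'[measurable (raw)]:
  "f \<in> borel_measurable L \<Longrightarrow> g \<in> borel_measurable L \<Longrightarrow> (\<lambda>x. \<psi> (f x) (g x)) \<in> borel_measurable L"
  using measurable_compose[OF measurable_Pair \<psi>_meas, of f L g] by simp

lemma \<psi>_mean: "(\<integral>u. \<psi> u \<delta> \<partial>N) = 0"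
  using \<kappa>_int[of \<delta>] \<kappa>_int[of 0] \<phi>_def[of \<delta>] \<phi>_def[of 0] by (simp add: \<psi>_def prob_space[simplified])

lemma \<psi>_0: "\<psi> u 0 = 0" by (simp add: \<psi>_def)

text \<open>The left side is the variance of the uncentred increment, hence at most its second
  moment.\<close>

lemma \<psi>_L2: "(\<integral>u. (\<psi> u \<delta> - \<psi> u \<delta>')\<^sup>2 \<partial>N) \<le> Q * (\<delta> - \<delta>')\<^sup>2"
proof -
  define h where "h u = \<kappa> (u + \<delta>) - \<kappa> (u + \<delta>')" for u
  have h: "integrable N h" unfolding h_def using \<kappa>_int by simp
  have [measurable]: "h \<in> borel_measurable borel" unfolding h_def by measurable
  have hb: "\<bar>h u\<bar> \<le> 2 * B" for u using \<kappa>_bound[of "u + \<delta>"] \<kappa>_bound[of "u + \<delta>'"] by (simp add: h_def)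
  have h2: "integrable N (\<lambda>u. (h u)\<^sup>2)"
    by (rule integrable_const_bound[of _ "(2 * B)\<^sup>2"]) (use power_mono[OF hb abs_ge_zero, of _ 2] in \<open>auto simp: power2_abs\<close>)
  have Eh: "expectation h = \<phi> \<delta> - \<phi> \<delta>'" using \<kappa>_int by (simp add: h_def[abs_def] \<phi>_def)
  have "(\<integral>u. (\<psi> u \<delta> - \<psi> u \<delta>')\<^sup>2 \<partial>N) = variance h"
    unfolding Eh by (simp add: \<psi>_def h_def algebra_simps)
  also have "\<dots> \<le> expectation (\<lambda>u. (h u)\<^sup>2)" using h h2 by (subst variance_eq) auto
  also have "\<dots> \<le> Q * (\<delta> - \<delta>')\<^sup>2" unfolding h_def by (rule \<kappa>_L2)
  finally show ?thesis .
qed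

lemma Q_nonneg: "0 \<le> Q"
proof -
  have "0 \<le> (\<integral>u. (\<kappa> (u + 1) - \<kappa> (u + 0))\<^sup>2 \<partial>N)" by simp
  also have "\<dots> \<le> Q" using \<kappa>_L2[of 1 0] by simp
  finally show ?thesis .
qed

lemma q_nonneg: "0 \<le> q" using \<phi>_expand[of 1] by simp

text \<open>Here \<open>J\<close> is the sample, \<open>A\<close> the observations kept by the
  estimator, \<open>a\<close> the smoothing weights and \<open>\<beta>\<close> the smoothing bias.
  Row sums of squares, bounded by \<open>V\<close>, measure the noise in one regression estimate.
  Column sums, bounded by \<open>C\<close>, measure the influence of one error on all residuals
  together.\<close>

context
  fixes J A :: "nat set" and a :: "nat \<Rightarrow> nat \<Rightarrow> real" and \<beta> :: "nat \<Rightarrow> real" and \<Delta> :: "nat \<Rightarrow> (nat \<Rightarrow> real) \<Rightarrow> real"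
    and V C :: real
  assumes J: "finite J" and A: "A \<subseteq> J" and a0: "\<And>i. a i i = 0"
    and \<Delta>_def: "\<And>i e. \<Delta> i e = - (\<beta> i + (\<Sum>j\<in>J. a i j * e j))"
    and V: "\<And>i. i \<in> A \<Longrightarrow> (\<Sum>j\<in>J. (a i j)\<^sup>2) \<le> V"
    and C: "\<And>j. j \<in> J \<Longrightarrow> \<bar>\<Sum>i\<in>A. a i j\<bar> \<le> C"
begin

lemma fA: "finite A" using A J finite_subset by blast

lemma \<Delta>_meas[measurable]: "\<Delta> i \<in> borel_measurable P"
  unfolding \<Delta>_def[abs_def] by measurable

lemma \<Delta>_upd_self: "\<Delta> i (e(i := t)) = \<Delta> i e"
  unfolding \<Delta>_def by (intro arg_cong[where f=uminus] arg_cong2[where f="(+)"] sum.cong refl) (auto simp: a0)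

lemma \<Delta>_upd: "j \<in> J \<Longrightarrow> \<Delta> i (e(j := t)) = \<Delta> i e - a i j * (t - e j)"
  unfolding \<Delta>_def using J by (simp add: sum.remove[of J j] algebra_simps)

lemma \<Delta>_sq: "integrable P (\<lambda>e. (\<Delta> i e)\<^sup>2)" "(\<integral>e. (\<Delta> i e)\<^sup>2 \<partial>P) = (\<beta> i)\<^sup>2 + s2 * (\<Sum>j\<in>J. (a i j)\<^sup>2)"
proof -
  have E: "(\<Delta> i e)\<^sup>2 = (\<beta> i)\<^sup>2 + 2 * \<beta> i * (\<Sum>j\<in>J. a i j * e j) + (\<Sum>j\<in>J. a i j * e j)\<^sup>2" for e
    unfolding \<Delta>_def power2_minus by (simp add: power2_sum)
  show "integrable P (\<lambda>e. (\<Delta> i e)\<^sup>2)" "(\<integral>e. (\<Delta> i e)\<^sup>2 \<partial>P) = (\<beta> i)\<^sup>2 + s2 * (\<Sum>j\<in>J. (a i j)\<^sup>2)"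
    unfolding E using lin_integrable[OF J, of "a i"] lin_square[OF J, of "a i"] lin_mean[of "a i" J] P.prob_space
    by simp_all
qed

definition "Z i e = \<psi> (e i) (\<Delta> i e)"
text \<open>Deleting \<open>e j\<close> from the shift of observation \<open>i\<close> makes the
  term free of \<open>e j\<close>. The value 0 is chosen so that the shift changes by exactly
  \<open>a i j * e j\<close>.\<close>

definition "Z' i j e = \<psi> (e i) (\<Delta> i (e(j := 0)))"
definition "W i j e = Z i e - Z' i j e"

lemma Z_meas[measurable]: "Z i \<in> borel_measurable P" "Z' i j \<in> borel_measurable P"
proof -
  show "Z i \<in> borel_measurable P" unfolding Z_def by measurable
  have "(\<lambda>e. \<Delta> i (e(j := 0))) \<in> borel_measurable P"
    by (rule measurable_compose[OF meas_upd \<Delta>_meas])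
  then show "Z' i j \<in> borel_measurable P" unfolding Z'_def[abs_def] by (intro \<psi>_meas') simp_all
qed

lemma Z_bound: "\<bar>Z i e\<bar> \<le> 4 * B" "\<bar>Z' i j e\<bar> \<le> 4 * B"
  unfolding Z_def Z'_def by (rule \<psi>_bound)+

lemma bdd_mult_int:
  assumes [measurable]: "f \<in> borel_measurable P" "g \<in> borel_measurable P"
    and "\<And>x. \<bar>f x\<bar> \<le> F" "\<And>x. \<bar>g x\<bar> \<le> G"
  shows "integrable P (\<lambda>x. f x * g x :: real)"
proof (rule P.integrable_const_bound[of _ "F * G"])
  show "AE x in P. norm (f x * g x) \<le> F * G"
    using mult_mono[OF assms(3,4) order_trans[OF abs_ge_zero assms(3)] abs_ge_zero]
    by (auto simp: abs_mult intro!: AE_I2)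
qed simp

lemma Z_centred: "(\<integral>t. Z i (e(i := t)) \<partial>N) = 0"
  "i \<noteq> j \<Longrightarrow> (\<integral>t. Z' i j (e(i := t)) \<partial>N) = 0"
  by (simp_all add: Z_def Z'_def \<Delta>_upd_self fun_upd_twist[of i j] \<psi>_mean)

lemma Z'_indep: "i \<noteq> j \<Longrightarrow> Z' i j (e(j := t)) = Z' i j e"
  by (simp add: Z'_def)

text \<open>Integrating over \<open>e i\<close> first freezes the shift; comparison with shift zero,
  where \<open>\<psi>\<close> vanishes, leaves \<open>Q\<close> times the squared shift.\<close>

lemma Z_sq: "(\<integral>e. Z i e * Z i e \<partial>P) \<le> Q * ((\<beta> i)\<^sup>2 + s2 * (\<Sum>j\<in>J. (a i j)\<^sup>2))"
proof -
  have "(\<integral>e. Z i e * Z i e \<partial>P) \<le> (\<integral>e. Q * (\<Delta> i e)\<^sup>2 \<partial>P)"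
  proof (rule integral_PiM_resample_le[OF prob_N refl, of _ _ i])
    show "integrable P (\<lambda>e. Z i e * Z i e)" by (rule bdd_mult_int) (use Z_bound in auto)
    show "integrable P (\<lambda>e. Q * (\<Delta> i e)\<^sup>2)" using \<Delta>_sq by simp
    show "(\<integral>t. Z i (e(i := t)) * Z i (e(i := t)) \<partial>N) \<le> Q * (\<Delta> i e)\<^sup>2" for e
      using \<psi>_L2[of "\<Delta> i e" 0] by (simp add: Z_def \<Delta>_upd_self \<psi>_0 power2_eq_square)
  qed
  then show ?thesis using \<Delta>_sq by simp
qed

text \<open>Again \<open>e i\<close> is integrated first. The two shifts differ by
  \<open>a i j * e j\<close>, so the bound sees only the single weight and neither the bias nor the
  full shift.\<close>

lemma D_sq:
  assumes "j \<in> J" "i \<noteq> j"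
  shows "(\<integral>e. W i j e * W i j e \<partial>P) \<le> Q * ((a i j)\<^sup>2 * s2)"
    "integrable P (\<lambda>e. W i j e * W i j e)"
proof -
  have ej: "integrable P (\<lambda>e. (e j)\<^sup>2)" "(\<integral>e. (e j)\<^sup>2 \<partial>P) = s2"
    using integral_PiM_component[OF prob_N refl, of "\<lambda>t. t\<^sup>2" j] int_sq by (auto simp: s2_def)
  have "\<bar>W i j e\<bar> \<le> 8 * B" for e
    using Z_bound(1)[of i e] Z_bound(2)[of i j e] unfolding W_def by linarith
  then show I: "integrable P (\<lambda>e. W i j e * W i j e)"
    by (intro bdd_mult_int[where F="8 * B" and G="8 * B"]) (auto simp: W_def[abs_def])
  have "(\<integral>e. W i j e * W i j e \<partial>P) \<le> (\<integral>e. Q * ((a i j)\<^sup>2 * (e j)\<^sup>2) \<partial>P)"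
  proof (rule integral_PiM_resample_le[OF prob_N refl I, of _ i])
    show "integrable P (\<lambda>e. Q * ((a i j)\<^sup>2 * (e j)\<^sup>2))" using ej by simp
    fix e :: "nat \<Rightarrow> real"
    have "(\<integral>t. W i j (e(i := t)) * W i j (e(i := t)) \<partial>N)
        = (\<integral>t. (\<psi> t (\<Delta> i e) - \<psi> t (\<Delta> i (e(j := 0))))\<^sup>2 \<partial>N)"
      using assms by (simp add: W_def Z_def Z'_def \<Delta>_upd_self fun_upd_twist[of i j] power2_eq_square)
    also have "\<dots> \<le> Q * (\<Delta> i e - \<Delta> i (e(j := 0)))\<^sup>2" by (rule \<psi>_L2)
    also have "\<dots> = Q * ((a i j)\<^sup>2 * (e j)\<^sup>2)" using assms by (simp add: \<Delta>_upd power_mult_distrib)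
    finally show "(\<integral>t. W i j (e(i := t)) * W i j (e(i := t)) \<partial>N) \<le> Q * ((a i j)\<^sup>2 * (e j)\<^sup>2)" .
  qed
  then show "(\<integral>e. W i j e * W i j e \<partial>P) \<le> Q * ((a i j)\<^sup>2 * s2)" using ej by simp
qed

text \<open>
  Splitting \<open>Z i = Z' i j + W i j\<close> and \<open>Z j = Z' j i + W j i\<close>, only \<open>W i j * W j i\<close> contributes: in the
  other products one factor is centred in a coordinate on which the other does not depend.
\<close>

lemma Z_cross:
  assumes ij: "i \<in> J" "j \<in> J" "i \<noteq> j"
  shows "(\<integral>e. Z i e * Z j e \<partial>P) \<le> Q * s2 * ((a i j)\<^sup>2 + (a j i)\<^sup>2) / 2"
proof -
  note b = bdd_mult_int[where F="4 * B" and G="4 * B"]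
  have I: "integrable P (\<lambda>e. Z i e * Z j e)" "integrable P (\<lambda>e. Z' i j e * Z j e)"
    "integrable P (\<lambda>e. Z' j i e * Z i e)" "integrable P (\<lambda>e. Z' i j e * Z' j i e)"
    by (rule b; use Z_bound in auto)+
  have 1: "(\<integral>e. Z' i j e * Z j e \<partial>P) = 0"
    by (rule integral_PiM_mult_centred[OF prob_N refl I(2), of j]) (use ij Z'_indep Z_centred in auto)
  have 2: "(\<integral>e. Z' j i e * Z i e \<partial>P) = 0"
    by (rule integral_PiM_mult_centred[OF prob_N refl I(3), of i]) (use ij Z'_indep Z_centred in auto)
  have 3: "(\<integral>e. Z' i j e * Z' j i e \<partial>P) = 0"
    by (rule integral_PiM_mult_centred[OF prob_N refl I(4), of j]) (use ij Z'_indep Z_centred in auto)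
  have E: "Z i e * Z j e = W i j e * W j i e + Z' i j e * Z j e + Z' j i e * Z i e - Z' i j e * Z' j i e" for e
    by (simp add: W_def algebra_simps)
  have Ie: "integrable P (\<lambda>e. W i j e * W j i e)"
    using I by (simp add: W_def left_diff_distrib right_diff_distrib mult.commute)
  have "(\<integral>e. Z i e * Z j e \<partial>P) = (\<integral>e. W i j e * W j i e \<partial>P)"
    unfolding E using I Ie 1 2 3 by simp
  also have "\<dots> \<le> (\<integral>e. (W i j e * W i j e + W j i e * W j i e) / 2 \<partial>P)"
  proof (intro integral_mono Ie)
    show "integrable P (\<lambda>e. (W i j e * W i j e + W j i e * W j i e) / 2)"
      using D_sq(2)[of j i] D_sq(2)[of i j] ij by simp
    fix e show "W i j e * W j i e \<le> (W i j e * W i j e + W j i e * W j i e) / 2"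
      by (rule mult_le_half_squares)
  qed
  also have "\<dots> = ((\<integral>e. W i j e * W i j e \<partial>P) + (\<integral>e. W j i e * W j i e \<partial>P)) / 2"
    using D_sq(2)[of j i] D_sq(2)[of i j] ij by simp
  also have "\<dots> \<le> (Q * ((a i j)\<^sup>2 * s2) + Q * ((a j i)\<^sup>2 * s2)) / 2"
    using D_sq(1)[of j i] D_sq(1)[of i j] ij by (intro divide_right_mono add_mono) auto
  finally show ?thesis by (simp add: algebra_simps)
qed

lemma sum_a_swap: "(\<Sum>i\<in>A. \<Sum>j\<in>A. (a j i)\<^sup>2) = (\<Sum>i\<in>A. \<Sum>j\<in>A. (a i j)\<^sup>2)"
  by (rule sum.swap)

text \<open>The factor 2 counts the noise on the diagonal once and the off-diagonal pairs once. The
  pair bound is quadratic in the weights, so the pairs together cost no more than the sum of all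
  squared weights, at most \<open>card A * V\<close>.\<close>

lemma Z_sum_sq: "(\<integral>e. (\<Sum>i\<in>A. Z i e)\<^sup>2 \<partial>P) \<le> Q * ((\<Sum>i\<in>A. (\<beta> i)\<^sup>2) + 2 * real (card A) * s2 * V)"
    "integrable P (\<lambda>e. (\<Sum>i\<in>A. Z i e)\<^sup>2)"
proof -
  have I: "integrable P (\<lambda>e. Z i e * Z j e)" for i j by (rule bdd_mult_int) (use Z_bound in auto)
  have E: "(\<Sum>i\<in>A. Z i e)\<^sup>2 = (\<Sum>i\<in>A. \<Sum>j\<in>A. Z i e * Z j e)" for e by (simp add: power2_eq_square sum_product)
  show "integrable P (\<lambda>e. (\<Sum>i\<in>A. Z i e)\<^sup>2)" unfolding E using I by simp
  \<comment> \<open>One bound for all pairs: on the diagonal the first summand vanishes because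
    \<open>a i i = 0\<close>.\<close>
  have le: "(\<integral>e. Z i e * Z j e \<partial>P) \<le> Q * s2 * ((a i j)\<^sup>2 + (a j i)\<^sup>2) / 2 + (if i = j then Q * ((\<beta> i)\<^sup>2 + s2 * V) else 0)"
    if "i \<in> A" "j \<in> A" for i j
  proof (cases "i = j")
    case True
    have "Q * ((\<beta> i)\<^sup>2 + s2 * (\<Sum>j\<in>J. (a i j)\<^sup>2)) \<le> Q * ((\<beta> i)\<^sup>2 + s2 * V)"
      using V[OF that(1)] Q_nonneg s2_nonneg by (intro mult_left_mono add_left_mono) auto
    then show ?thesis using Z_sq[of i] True a0 by auto
  next
    case False
    then show ?thesis using Z_cross[of i j] that A by auto
  qed
  have S: "(\<Sum>i\<in>A. \<Sum>j\<in>A. (a i j)\<^sup>2) \<le> real (card A) * V"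
  proof -
    have "(\<Sum>i\<in>A. \<Sum>j\<in>A. (a i j)\<^sup>2) \<le> (\<Sum>i\<in>A. V)"
    proof (rule sum_mono)
      fix i assume "i \<in> A"
      have "(\<Sum>j\<in>A. (a i j)\<^sup>2) \<le> (\<Sum>j\<in>J. (a i j)\<^sup>2)" using A J by (intro sum_mono2) auto
      then show "(\<Sum>j\<in>A. (a i j)\<^sup>2) \<le> V" using V[OF \<open>i \<in> A\<close>] by simp
    qed
    then show ?thesis by simp
  qed
  have "(\<integral>e. (\<Sum>i\<in>A. Z i e)\<^sup>2 \<partial>P) = (\<Sum>i\<in>A. \<Sum>j\<in>A. \<integral>e. Z i e * Z j e \<partial>P)"
    unfolding E using I by (simp add: Bochner_Integration.integral_sum)
  also have "\<dots> \<le> (\<Sum>i\<in>A. \<Sum>j\<in>A. Q * s2 * ((a i j)\<^sup>2 + (a j i)\<^sup>2) / 2 + (if i = j then Q * ((\<beta> i)\<^sup>2 + s2 * V) else 0))"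
    by (intro sum_mono le)
  also have "\<dots> = Q * s2 * ((\<Sum>i\<in>A. \<Sum>j\<in>A. (a i j)\<^sup>2) + (\<Sum>i\<in>A. \<Sum>j\<in>A. (a j i)\<^sup>2)) / 2 + (\<Sum>i\<in>A. Q * ((\<beta> i)\<^sup>2 + s2 * V))"
    using fA by (simp add: sum.distrib sum_distrib_left sum_divide_distrib distrib_left add_divide_distrib)
  also have "\<dots> = Q * s2 * (\<Sum>i\<in>A. \<Sum>j\<in>A. (a i j)\<^sup>2) + (Q * (\<Sum>i\<in>A. (\<beta> i)\<^sup>2) + Q * s2 * (real (card A) * V))"
    by (simp add: sum_a_swap sum.distrib sum_distrib_left distrib_left algebra_simps)
  also have "\<dots> \<le> Q * s2 * (real (card A) * V) + (Q * (\<Sum>i\<in>A. (\<beta> i)\<^sup>2) + Q * s2 * (real (card A) * V))"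
    using S Q_nonneg s2_nonneg by (intro add_right_mono mult_left_mono) auto
  finally show "(\<integral>e. (\<Sum>i\<in>A. Z i e)\<^sup>2 \<partial>P) \<le> Q * ((\<Sum>i\<in>A. (\<beta> i)\<^sup>2) + 2 * real (card A) * s2 * V)"
    by (simp add: algebra_simps)
qed

text \<open>After interchanging the sums the coefficient of \<open>e j\<close> is a column sum.
  Orthogonality of the errors then gives order \<open>sqrt (card J)\<close> for the noise, where
  adding up absolute shifts would give the order of \<open>card A\<close> times a typical
  shift.\<close>

lemma sum_\<Delta>: "integrable P (\<lambda>e. \<Sum>i\<in>A. \<Delta> i e)"
  "(\<integral>e. \<bar>\<Sum>i\<in>A. \<Delta> i e\<bar> \<partial>P) \<le> \<bar>\<Sum>i\<in>A. \<beta> i\<bar> + C * sqrt (s2 * real (card J))"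
proof -
  define W where "W j = (\<Sum>i\<in>A. a i j)" for j
  have E: "(\<Sum>i\<in>A. \<Delta> i e) = - ((\<Sum>i\<in>A. \<beta> i) + (\<Sum>j\<in>J. W j * e j))" for e
    using sum.swap[of "\<lambda>i j. a i j * e j" J A]
    unfolding \<Delta>_def W_def by (simp add: sum_negf sum.distrib sum_distrib_right sum_subtractf)
  note L = lin_integrable[OF J, of W]
  show "integrable P (\<lambda>e. \<Sum>i\<in>A. \<Delta> i e)" unfolding E using L by simp
  have "(\<integral>e. \<bar>\<Sum>i\<in>A. \<Delta> i e\<bar> \<partial>P) \<le> (\<integral>e. \<bar>\<Sum>i\<in>A. \<beta> i\<bar> + \<bar>\<Sum>j\<in>J. W j * e j\<bar> \<partial>P)"
    unfolding E using L by (intro integral_mono) (auto intro!: integrable_abs)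
  also have "\<dots> = \<bar>\<Sum>i\<in>A. \<beta> i\<bar> + (\<integral>e. \<bar>\<Sum>j\<in>J. W j * e j\<bar> \<partial>P)"
    using L P.prob_space by simp
  also have "(\<integral>e. \<bar>\<Sum>j\<in>J. W j * e j\<bar> \<partial>P) \<le> sqrt (\<integral>e. (\<Sum>j\<in>J. W j * e j)\<^sup>2 \<partial>P)"
    by (rule P.expectation_abs_le_sqrt(2)[OF _ lin_square(1)[OF J]]) measurable
  also have "\<dots> = sqrt (s2 * (\<Sum>j\<in>J. (W j)\<^sup>2))" by (simp only: lin_square(2)[OF J])
  also have "\<dots> \<le> sqrt (s2 * (\<Sum>j\<in>J. C\<^sup>2))"
    using s2_nonneg power_mono[OF C, of _ 2]
    by (intro real_sqrt_le_mono mult_left_mono sum_mono) (auto simp: W_def)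
  also have "\<dots> = \<bar>C\<bar> * sqrt (s2 * real (card J))" by (simp add: real_sqrt_mult)
  also have "\<dots> = C * sqrt (s2 * real (card J))"
  proof (cases "J = {}")
    case False
    then obtain j where "j \<in> J" by blast
    from C[OF this] have "0 \<le> C" by simp
    then show ?thesis by simp
  qed simp
  finally show "(\<integral>e. \<bar>\<Sum>i\<in>A. \<Delta> i e\<bar> \<partial>P) \<le> \<bar>\<Sum>i\<in>A. \<beta> i\<bar> + C * sqrt (s2 * real (card J))" by simp
qed

theorem perturbation_bound:
  "integrable P (\<lambda>e. \<Sum>i\<in>A. \<kappa> (e i + \<Delta> i e) - \<kappa> (e i))"
  "(\<integral>e. \<bar>\<Sum>i\<in>A. \<kappa> (e i + \<Delta> i e) - \<kappa> (e i)\<bar> \<partial>P) \<le>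
     \<bar>c\<bar> * (\<bar>\<Sum>i\<in>A. \<beta> i\<bar> + C * sqrt (s2 * real (card J)))
     + q * ((\<Sum>i\<in>A. (\<beta> i)\<^sup>2) + real (card A) * s2 * V)
     + sqrt (Q * ((\<Sum>i\<in>A. (\<beta> i)\<^sup>2) + 2 * real (card A) * s2 * V))"
proof -
  let ?S = "\<lambda>e. \<Sum>i\<in>A. \<kappa> (e i + \<Delta> i e) - \<kappa> (e i)"
  show I: "integrable P ?S"
  proof (intro Bochner_Integration.integrable_sum P.integrable_const_bound[of _ "2 * B"] AE_I2)
    fix i e show "norm (\<kappa> (e i + \<Delta> i e) - \<kappa> (e i)) \<le> 2 * B"
      using \<kappa>_bound[of "e i + \<Delta> i e"] \<kappa>_bound[of "e i"] by simp
  qed simp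
  have Zs: "integrable P (\<lambda>e. \<Sum>i\<in>A. Z i e)" "(\<integral>e. \<bar>\<Sum>i\<in>A. Z i e\<bar> \<partial>P) \<le> sqrt (\<integral>e. (\<Sum>i\<in>A. Z i e)\<^sup>2 \<partial>P)"
    by (rule P.expectation_abs_le_sqrt[OF _ Z_sum_sq(2)], measurable)+
  have D2: "integrable P (\<lambda>e. \<Sum>i\<in>A. q * (\<Delta> i e)\<^sup>2)" using \<Delta>_sq by simp
  have "(\<integral>e. \<bar>?S e\<bar> \<partial>P) \<le> (\<integral>e. \<bar>\<Sum>i\<in>A. Z i e\<bar> + (\<Sum>i\<in>A. q * (\<Delta> i e)\<^sup>2) + \<bar>c\<bar> * \<bar>\<Sum>i\<in>A. \<Delta> i e\<bar> \<partial>P)"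
  proof (intro integral_mono integrable_abs I)
    show "integrable P (\<lambda>e. \<bar>\<Sum>i\<in>A. Z i e\<bar> + (\<Sum>i\<in>A. q * (\<Delta> i e)\<^sup>2) + \<bar>c\<bar> * \<bar>\<Sum>i\<in>A. \<Delta> i e\<bar>)"
      using Zs(1) D2 sum_\<Delta>(1) by (intro Bochner_Integration.integrable_add integrable_abs integrable_mult_right)
    fix e
    \<comment> \<open>An exact identity with three parts: centred increments, controlled in mean
      square; the mean beyond its linear part, controlled pointwise; and the linear part, controlled
      through the sum of the shifts.\<close>
    have "?S e = (\<Sum>i\<in>A. Z i e) + (\<Sum>i\<in>A. \<phi> (\<Delta> i e) - \<phi> 0 - c * \<Delta> i e) + c * (\<Sum>i\<in>A. \<Delta> i e)"
      by (simp add: Z_def \<psi>_def sum_distrib_left sum.distrib[symmetric])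
    moreover have "\<bar>\<Sum>i\<in>A. \<phi> (\<Delta> i e) - \<phi> 0 - c * \<Delta> i e\<bar> \<le> (\<Sum>i\<in>A. q * (\<Delta> i e)\<^sup>2)"
      by (rule order_trans[OF sum_abs]) (intro sum_mono \<phi>_expand)
    moreover have "\<bar>c * (\<Sum>i\<in>A. \<Delta> i e)\<bar> = \<bar>c\<bar> * \<bar>\<Sum>i\<in>A. \<Delta> i e\<bar>" by (rule abs_mult)
    ultimately show "\<bar>?S e\<bar> \<le> \<bar>\<Sum>i\<in>A. Z i e\<bar> + (\<Sum>i\<in>A. q * (\<Delta> i e)\<^sup>2) + \<bar>c\<bar> * \<bar>\<Sum>i\<in>A. \<Delta> i e\<bar>"
      by linarith
  qed
  also have "\<dots> = (\<integral>e. \<bar>\<Sum>i\<in>A. Z i e\<bar> \<partial>P) + (\<Sum>i\<in>A. q * (\<integral>e. (\<Delta> i e)\<^sup>2 \<partial>P)) + \<bar>c\<bar> * (\<integral>e. \<bar>\<Sum>i\<in>A. \<Delta> i e\<bar> \<partial>P)"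
    using Zs(1) D2 sum_\<Delta>(1) \<Delta>_sq(1) by (simp add: Bochner_Integration.integral_sum)
  also have "\<dots> \<le> sqrt (Q * ((\<Sum>i\<in>A. (\<beta> i)\<^sup>2) + 2 * real (card A) * s2 * V))
      + q * ((\<Sum>i\<in>A. (\<beta> i)\<^sup>2) + real (card A) * s2 * V)
      + \<bar>c\<bar> * (\<bar>\<Sum>i\<in>A. \<beta> i\<bar> + C * sqrt (s2 * real (card J)))"
  proof (intro add_mono mult_left_mono sum_\<Delta>(2))
    show "(\<integral>e. \<bar>\<Sum>i\<in>A. Z i e\<bar> \<partial>P) \<le> sqrt (Q * ((\<Sum>i\<in>A. (\<beta> i)\<^sup>2) + 2 * real (card A) * s2 * V))"
      using Zs(2) real_sqrt_le_mono[OF Z_sum_sq(1)] by linarith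
    have "(\<Sum>i\<in>A. q * (\<integral>e. (\<Delta> i e)\<^sup>2 \<partial>P)) \<le> (\<Sum>i\<in>A. q * ((\<beta> i)\<^sup>2 + s2 * V))"
      unfolding \<Delta>_sq(2) using V q_nonneg s2_nonneg by (intro sum_mono mult_left_mono add_left_mono) auto
    also have "\<dots> = q * ((\<Sum>i\<in>A. (\<beta> i)\<^sup>2) + real (card A) * s2 * V)"
      by (simp add: sum_distrib_left[symmetric] sum.distrib)
    finally show "(\<Sum>i\<in>A. q * (\<integral>e. (\<Delta> i e)\<^sup>2 \<partial>P)) \<le> q * ((\<Sum>i\<in>A. (\<beta> i)\<^sup>2) + real (card A) * s2 * V)" .
  qed simp
  finally show "(\<integral>e. \<bar>?S e\<bar> \<partial>P) \<le>
     \<bar>c\<bar> * (\<bar>\<Sum>i\<in>A. \<beta> i\<bar> + C * sqrt (s2 * real (card J)))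
     + q * ((\<Sum>i\<in>A. (\<beta> i)\<^sup>2) + real (card A) * s2 * V)
     + sqrt (Q * ((\<Sum>i\<in>A. (\<beta> i)\<^sup>2) + 2 * real (card A) * s2 * V))" by linarith
qed

end
end

section \<open>Smoothing of the error density by the kernel\<close>

lemma taylor_order2:
  fixes f f1 f2 :: "real \<Rightarrow> real"
  assumes "\<And>x. (f has_real_derivative f1 x) (at x)" "\<And>x. (f1 has_real_derivative f2 x) (at x)"
  obtains t where "\<bar>t - c\<bar> \<le> \<bar>x - c\<bar>" "f x = f c + f1 c * (x - c) + f2 t / 2 * (x - c)\<^sup>2"
proof (cases "x = c")
  case True
  then show ?thesis using that[of c] by simp
next
  case False
  define D where "D m = (if m = 0 then f else if m = 1 then f1 else f2)" for m :: nat
  have "\<exists>t. (if x < c then x < t \<and> t < c else c < t \<and> t < x) \<and>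
      f x = (\<Sum>m<2. (D m c / fact m) * (x - c) ^ m) + (D 2 t / fact 2) * (x - c) ^ 2"
    by (rule Taylor[of 2 D f "min x c" "max x c"]) (use False assms in \<open>auto simp: D_def less_2_cases_iff\<close>)
  then obtain t where t: "if x < c then x < t \<and> t < c else c < t \<and> t < x"
    and E: "f x = (\<Sum>m<2. (D m c / fact m) * (x - c) ^ m) + (D 2 t / fact 2) * (x - c) ^ 2" by blast
  show ?thesis
  proof (rule that[of t])
    show "\<bar>t - c\<bar> \<le> \<bar>x - c\<bar>" using t by (auto split: if_splits)
    show "f x = f c + f1 c * (x - c) + f2 t / 2 * (x - c)\<^sup>2"
      unfolding E by (simp add: D_def numeral_2_eq_2)
  qed
qed

lemma integrable_bounded_support:
  fixes g :: "real \<Rightarrow> real"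
  assumes [measurable]: "g \<in> borel_measurable borel"
    and "\<And>v. \<bar>g v\<bar> \<le> C" "\<And>v. R < \<bar>v\<bar> \<Longrightarrow> g v = 0"
  shows "integrable lborel g"
proof (rule Bochner_Integration.integrable_bound)
  show "integrable lborel (\<lambda>v. C * indicator {-R..R} v)"
    by (intro integrable_mult_right integrable_real_indicator) (auto simp: emeasure_lborel_Icc_eq)
  show "AE v in lborel. norm (g v) \<le> norm (C * indicator {- R..R} v)"
  proof (rule AE_I2)
    fix v show "norm (g v) \<le> norm (C * indicator {- R..R} v)"
      using assms(2)[of v] assms(3)[of v] by (cases "R < \<bar>v\<bar>") (auto simp: indicator_def abs_le_iff)
  qed
qed simp

lemma integral_kernel_rescale:
  fixes G f :: "real \<Rightarrow> real"
  assumes "0 < h"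
  shows "(\<integral>t. G ((t - y) / h) * f t \<partial>lborel) = h * (\<integral>v. G v * f (y + h * v) \<partial>lborel)"
  using assms lborel_integral_real_affine[of h "\<lambda>t. G ((t - y) / h) * f t" y] by simp

locale density_kernel =
  fixes f f1 f2 K :: "real \<Rightarrow> real" and F F1 F2 L R B :: real
  assumes f_nonneg: "\<And>x. 0 \<le> f x" and f_prob: "prob_space (density lborel f)"
    and f_bound: "\<And>x. f x \<le> F" and f1_bound: "\<And>x. \<bar>f1 x\<bar> \<le> F1" and f2_bound: "\<And>x. \<bar>f2 x\<bar> \<le> F2"
    and f_deriv: "\<And>x. (f has_real_derivative f1 x) (at x)" and f1_deriv: "\<And>x. (f1 has_real_derivative f2 x) (at x)"
    and f2_cont: "continuous_on UNIV f2"
    and K_lip: "\<And>u v. \<bar>K u - K v\<bar> \<le> L * \<bar>u - v\<bar>"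
    and K_supp: "\<And>u. R < \<bar>u\<bar> \<Longrightarrow> K u = 0" and K_bound: "\<And>u. \<bar>K u\<bar> \<le> B" and R_pos: "0 < R"
begin

lemma f_cont: "continuous_on UNIV f" and f1_cont: "continuous_on UNIV f1"
  using f_deriv f1_deriv DERIV_continuous_on[of UNIV f f1] DERIV_continuous_on[of UNIV f1 f2] by auto

lemma f_meas[measurable]: "f \<in> borel_measurable borel" "f1 \<in> borel_measurable borel" "f2 \<in> borel_measurable borel"
  using f_cont f1_cont f2_cont by (auto intro: borel_measurable_continuous_onI)

lemma L_nonneg: "0 \<le> L" using order_trans[OF abs_ge_zero K_lip[of 1 0]] by simp
lemma B_nonneg: "0 \<le> B" using K_bound[of 0] by simp
lemma F_nonneg: "0 \<le> F" "0 \<le> F1" "0 \<le> F2" using f_nonneg[of 0] f_bound[of 0] f1_bound[of 0] f2_bound[of 0] by linarith+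

lemma K_meas[measurable]: "K \<in> borel_measurable borel"
proof -
  have "L-lipschitz_on UNIV K"
    using K_lip L_nonneg by (intro lipschitz_onI) (auto simp: dist_real_def)
  then show ?thesis by (intro borel_measurable_continuous_onI lipschitz_on_continuous_on)
qed

lemma integral_N: "g \<in> borel_measurable borel \<Longrightarrow> (\<integral>t. g t \<partial>density lborel f) = (\<integral>t. g t * f t \<partial>lborel)" for g :: "real \<Rightarrow> real"
  using integral_density[of g lborel f] f_nonneg by (simp add: mult.commute)

lemma f_integrable: "integrable lborel f"
proof -
  interpret prob_space "density lborel f" by (rule f_prob)
  have "integrable (density lborel f) (\<lambda>_. 1 :: real)" by (rule integrable_const)
  then show ?thesis using f_nonneg by (subst (asm) integrable_density) auto
qed

text \<open>The bound on \<open>g\<close> is asked only on the support of \<open>K\<close>, so that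
  powers of \<open>v\<close> are covered as well as the bounded density and its derivatives.\<close>

lemma K_integrable:
  assumes [measurable]: "g \<in> borel_measurable borel" and "\<And>v. \<bar>v\<bar> \<le> R \<Longrightarrow> \<bar>g v\<bar> \<le> C"
  shows "integrable lborel (\<lambda>v. K v * g v)" "integrable lborel (\<lambda>v. \<bar>K v\<bar> * g v)" "integrable lborel (\<lambda>v. (K v)\<^sup>2 * g v)"
proof -
  have C: "0 \<le> C" using assms(2)[of 0] R_pos by simp
  have b: "\<bar>K v\<bar> * \<bar>g v\<bar> \<le> B * C" for v
  proof (cases "\<bar>v\<bar> \<le> R")
    case True then show ?thesis using K_bound assms(2) B_nonneg by (intro mult_mono) auto
  next
    case False then show ?thesis using K_supp[of v] B_nonneg C by simp
  qed
  have b2: "\<bar>(K v)\<^sup>2 * g v\<bar> \<le> B * (B * C)" for v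
    using mult_mono[OF K_bound b, of v v] B_nonneg by (simp add: abs_mult power2_eq_square mult.assoc)
  show "integrable lborel (\<lambda>v. K v * g v)" "integrable lborel (\<lambda>v. \<bar>K v\<bar> * g v)" "integrable lborel (\<lambda>v. (K v)\<^sup>2 * g v)"
    using b b2 K_supp by (auto intro!: integrable_bounded_support[where C="B * C" and R=R]
      integrable_bounded_support[where C="B * (B * C)" and R=R and g="\<lambda>v. (K v)\<^sup>2 * g v"] simp: abs_mult)
qed

lemma K_int1: "integrable lborel K" "integrable lborel (\<lambda>v. \<bar>K v\<bar>)" "integrable lborel (\<lambda>v. (K v)\<^sup>2)"
  using K_integrable[of "\<lambda>_. 1" 1] by auto

definition "KL1 = (\<integral>v. \<bar>K v\<bar> \<partial>lborel)"

lemma KL1_nonneg: "0 \<le> KL1" by (simp add: KL1_def)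

lemma K_integral_bound:
  assumes [measurable]: "g \<in> borel_measurable borel" and g: "\<And>v. \<bar>v\<bar> \<le> R \<Longrightarrow> \<bar>g v\<bar> \<le> C"
  shows "\<bar>\<integral>v. K v * g v \<partial>lborel\<bar> \<le> KL1 * C"
proof -
  have "\<bar>\<integral>v. K v * g v \<partial>lborel\<bar> \<le> (\<integral>v. \<bar>K v * g v\<bar> \<partial>lborel)" by (rule integral_abs_bound)
  also have "\<dots> \<le> (\<integral>v. \<bar>K v\<bar> * C \<partial>lborel)"
  proof (rule integral_mono)
    show "integrable lborel (\<lambda>v. \<bar>K v * g v\<bar>)" using K_integrable(1)[of g C] g by (intro integrable_abs) simp
    show "integrable lborel (\<lambda>v. \<bar>K v\<bar> * C)" using K_int1 by simp
    show "\<bar>K v * g v\<bar> \<le> \<bar>K v\<bar> * C" for v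
      using g[of v] K_supp[of v] by (cases "\<bar>v\<bar> \<le> R") (auto simp: abs_mult mult_left_mono)
  qed
  finally show ?thesis by (simp add: KL1_def)
qed

lemma f_shift_bound: "\<bar>f x\<bar> \<le> F" using f_nonneg[of x] f_bound[of x] by simp

text \<open>The mean of the kernel at a shifted error, after the substitution that moves the shift
  from \<open>K\<close> to \<open>f\<close>. As a function of the shift it is as smooth as
  \<open>f\<close>, with derivatives of order \<open>h\<close>; its derivative at shift zero is
  \<open>slope\<close>.\<close>

definition "\<phi> y h \<delta> = h * (\<integral>v. K v * f (y - \<delta> + h * v) \<partial>lborel)"
definition "slope y h = - h * (\<integral>v. K v * f1 (y + h * v) \<partial>lborel)"

lemma kernel_mean:
  assumes "0 < h"
  shows "(\<integral>u. K ((u + \<delta> - y) / h) \<partial>density lborel f) = \<phi> y h \<delta>"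
  using integral_kernel_rescale[OF assms, of K "y - \<delta>" f]
  by (subst integral_N) (auto simp: \<phi>_def algebra_simps)

lemma slope_bound: "0 < h \<Longrightarrow> \<bar>slope y h\<bar> \<le> h * (KL1 * F1)"
  using K_integral_bound[of "\<lambda>v. f1 (y + h * v)" F1] f1_bound by (simp add: slope_def abs_mult)

lemma \<phi>_expansion:
  assumes "0 < h"
  shows "\<bar>\<phi> y h \<delta> - \<phi> y h 0 - slope y h * \<delta>\<bar> \<le> h * (KL1 * (F2 / 2)) * \<delta>\<^sup>2"
proof -
  have I: "integrable lborel (\<lambda>v. K v * f (y - \<delta> + h * v))" "integrable lborel (\<lambda>v. K v * f (y + h * v))"
    "integrable lborel (\<lambda>v. K v * f1 (y + h * v))"
    by (rule K_integrable(1)[where C=F] K_integrable(1)[where C=F1]; use f_shift_bound f1_bound in simp)+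
  have b: "\<bar>f (y - \<delta> + h * v) - f (y + h * v) + \<delta> * f1 (y + h * v)\<bar> \<le> F2 / 2 * \<delta>\<^sup>2" for v
  proof -
    obtain t where t: "f (y - \<delta> + h * v) = f (y + h * v) + f1 (y + h * v) * (y - \<delta> + h * v - (y + h * v)) + f2 t / 2 * (y - \<delta> + h * v - (y + h * v))\<^sup>2"
      by (rule taylor_order2[OF f_deriv f1_deriv])
    then have E: "f (y - \<delta> + h * v) - f (y + h * v) + \<delta> * f1 (y + h * v) = f2 t / 2 * \<delta>\<^sup>2" by simp
    show ?thesis unfolding E using mult_right_mono[OF f2_bound[of t], of "\<delta>\<^sup>2 / 2"] by (simp add: abs_mult)
  qed
  have "\<phi> y h \<delta> - \<phi> y h 0 - slope y h * \<delta> = h * (\<integral>v. K v * (f (y - \<delta> + h * v) - f (y + h * v) + \<delta> * f1 (y + h * v)) \<partial>lborel)"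
    using I by (simp add: \<phi>_def slope_def algebra_simps)
  also have "\<bar>\<dots>\<bar> \<le> h * (KL1 * (F2 / 2 * \<delta>\<^sup>2))"
    using K_integral_bound[OF _ b] assms by (simp add: abs_mult)
  finally show ?thesis by (simp add: algebra_simps)
qed

text \<open>The squared Lipschitz bound is of order 1/h^2 in the bandwidth, but the increment is
  nonzero only for errors in two windows of length \<open>2 * R * h\<close>, whose probability is of
  order \<open>h\<close>. The net order is 1/h.\<close>

lemma kernel_increment_L2:
  assumes h: "0 < h"
  shows "(\<integral>u. (K ((u + \<delta> - y) / h) - K ((u + \<delta>' - y) / h))\<^sup>2 \<partial>density lborel f) \<le> 4 * L\<^sup>2 * R * F / h * (\<delta> - \<delta>')\<^sup>2"
proof -
  interpret prob_space "density lborel f" by (rule f_prob)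
  define I where "I d u = indicator {-R..R} ((u + d - y) / h) * f u" for d u :: real
  have int_I: "integrable lborel (I d)" "(\<integral>u. I d u \<partial>lborel) \<le> 2 * R * F * h" for d
  proof -
    show "integrable lborel (I d)"
      unfolding I_def by (rule Bochner_Integration.integrable_bound[OF f_integrable]) (auto simp: indicator_def)
    have "(\<integral>u. I d u \<partial>lborel) = h * (\<integral>v. indicator {-R..R} v * f (y - d + h * v) \<partial>lborel)"
      using integral_kernel_rescale[OF h, of "indicator {-R..R}" "y - d" f] by (simp add: I_def algebra_simps)
    also have "\<dots> \<le> h * (\<integral>v. indicator {-R..R} v * F \<partial>lborel)"
    proof (intro mult_left_mono integral_mono)
      show "integrable lborel (\<lambda>v. indicator {-R..R} v * f (y - d + h * v))"
        by (rule integrable_bounded_support[where C=F and R=R]) (use f_shift_bound F_nonneg in \<open>auto simp: indicator_def\<close>)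
      show "integrable lborel (\<lambda>v. indicator {-R..R} v * F)"
        by (intro integrable_mult_left integrable_real_indicator) (auto simp: emeasure_lborel_Icc_eq)
    qed (use f_bound h in \<open>auto simp: indicator_def\<close>)
    also have "\<dots> = 2 * R * F * h" using R_pos by simp
    finally show "(\<integral>u. I d u \<partial>lborel) \<le> 2 * R * F * h" .
  qed
  \<comment> \<open>The increment is Lipschitz and vanishes unless one of its two arguments lies in the support.\<close>
  have pw: "(K ((u + \<delta> - y) / h) - K ((u + \<delta>' - y) / h))\<^sup>2 * f u \<le> L\<^sup>2 * (\<delta> - \<delta>')\<^sup>2 / h\<^sup>2 * (I \<delta> u + I \<delta>' u)" for u
  proof -
    let ?a = "(u + \<delta> - y) / h" let ?b = "(u + \<delta>' - y) / h"
    have ab: "?a - ?b = (\<delta> - \<delta>') / h" by (simp add: diff_divide_distrib[symmetric])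
    have "\<bar>K ?a - K ?b\<bar> \<le> L * \<bar>(\<delta> - \<delta>') / h\<bar>" using K_lip[of ?a ?b] unfolding ab .
    from power_mono[OF this abs_ge_zero, of 2]
    have lip: "(K ?a - K ?b)\<^sup>2 \<le> L\<^sup>2 * (\<delta> - \<delta>')\<^sup>2 / h\<^sup>2" by (simp add: power_mult_distrib power_divide)
    have ind: "indicator {-R..R} z = (if \<bar>z\<bar> \<le> R then 1 else 0 :: real)" for z
      by (auto simp: indicator_def abs_le_iff)
    have "(K ?a - K ?b)\<^sup>2 \<le> L\<^sup>2 * (\<delta> - \<delta>')\<^sup>2 / h\<^sup>2 * (indicator {-R..R} ?a + indicator {-R..R} ?b)"
    proof (cases "\<bar>?a\<bar> \<le> R \<or> \<bar>?b\<bar> \<le> R")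
      case True
      then have "1 \<le> (indicator {-R..R} ?a + indicator {-R..R} ?b :: real)" unfolding ind by auto
      from mult_left_mono[OF this, of "L\<^sup>2 * (\<delta> - \<delta>')\<^sup>2 / h\<^sup>2"] lip show ?thesis by simp
    next
      case False
      then show ?thesis using K_supp[of ?a] K_supp[of ?b] by (simp add: ind)
    qed
    from mult_right_mono[OF this f_nonneg[of u]] show ?thesis by (simp add: I_def algebra_simps)
  qed
  have "(\<integral>u. (K ((u + \<delta> - y) / h) - K ((u + \<delta>' - y) / h))\<^sup>2 \<partial>density lborel f)
      = (\<integral>u. (K ((u + \<delta> - y) / h) - K ((u + \<delta>' - y) / h))\<^sup>2 * f u \<partial>lborel)"
    by (rule integral_N) simp
  also have "\<dots> \<le> (\<integral>u. L\<^sup>2 * (\<delta> - \<delta>')\<^sup>2 / h\<^sup>2 * (I \<delta> u + I \<delta>' u) \<partial>lborel)"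
  proof (rule integral_mono_AE')
    have "0 \<le> I d u" for d u using f_nonneg by (simp add: I_def)
    then show "AE u in lborel. 0 \<le> L\<^sup>2 * (\<delta> - \<delta>')\<^sup>2 / h\<^sup>2 * (I \<delta> u + I \<delta>' u)" by simp
  qed (use pw int_I in auto)
  also have "\<dots> = L\<^sup>2 * (\<delta> - \<delta>')\<^sup>2 / h\<^sup>2 * ((\<integral>u. I \<delta> u \<partial>lborel) + (\<integral>u. I \<delta>' u \<partial>lborel))"
    using int_I by simp
  also have "\<dots> \<le> L\<^sup>2 * (\<delta> - \<delta>')\<^sup>2 / h\<^sup>2 * (2 * R * F * h + 2 * R * F * h)"
    by (intro mult_left_mono add_mono int_I) auto
  also have "\<dots> = 4 * L\<^sup>2 * R * F / h * (\<delta> - \<delta>')\<^sup>2" using h by (simp add: field_simps power2_eq_square)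
  finally show ?thesis .
qed

text \<open>The mean of the kernel density estimate built from true errors. This is the centering
  sequence of the final theorem.\<close>

definition "fbar y h = (\<integral>v. K v * f (y + h * v) \<partial>lborel)"

lemma kernel_mean0: "0 < h \<Longrightarrow> (\<integral>u. K ((u - y) / h) \<partial>density lborel f) = h * fbar y h"
  using kernel_mean[of h 0 y] by (simp add: \<phi>_def fbar_def)

lemma fbar_bound: "\<bar>fbar y h\<bar> \<le> KL1 * F"
  unfolding fbar_def by (rule K_integral_bound) (use f_shift_bound in auto)

text \<open>On the support of the kernel the density moves by at most \<open>F1 * h * R\<close>.
  This identifies the limiting variance of the array.\<close>

lemma kernel_second_moment:
  assumes h: "0 < h"
  shows "\<bar>(\<integral>u. (K ((u - y) / h))\<^sup>2 \<partial>density lborel f) / h - f y * (\<integral>v. (K v)\<^sup>2 \<partial>lborel)\<bar>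
    \<le> h * (F1 * R * (\<integral>v. (K v)\<^sup>2 \<partial>lborel))"
proof -
  have I: "integrable lborel (\<lambda>v. (K v)\<^sup>2 * f (y + h * v))"
    by (rule K_integrable(3)[where C=F]) (use f_shift_bound in auto)
  have lip: "\<bar>f (y + s) - f y\<bar> \<le> F1 * \<bar>s\<bar>" for s
  proof -
    have "norm (f (y + s) - f y) \<le> F1 * norm (y + s - y)"
      by (rule field_differentiable_bound[of UNIV f f1]) (use f_deriv f1_bound in auto)
    then show ?thesis by simp
  qed
  have "(\<integral>u. (K ((u - y) / h))\<^sup>2 \<partial>density lborel f) = h * (\<integral>v. (K v)\<^sup>2 * f (y + h * v) \<partial>lborel)"
    using integral_kernel_rescale[OF h, of "\<lambda>v. (K v)\<^sup>2" y f] by (subst integral_N) auto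
  then have "(\<integral>u. (K ((u - y) / h))\<^sup>2 \<partial>density lborel f) / h - f y * (\<integral>v. (K v)\<^sup>2 \<partial>lborel)
      = (\<integral>v. (K v)\<^sup>2 * (f (y + h * v) - f y) \<partial>lborel)"
    using h I K_int1(3) by (simp add: right_diff_distrib mult.commute)
  also have "\<bar>\<dots>\<bar> \<le> (\<integral>v. \<bar>(K v)\<^sup>2 * (f (y + h * v) - f y)\<bar> \<partial>lborel)" by (rule integral_abs_bound)
  also have "\<dots> \<le> (\<integral>v. (K v)\<^sup>2 * (F1 * (h * R)) \<partial>lborel)"
  proof (rule integral_mono)
    show "integrable lborel (\<lambda>v. \<bar>(K v)\<^sup>2 * (f (y + h * v) - f y)\<bar>)"
      using I K_int1(3) by (intro integrable_abs) (simp add: right_diff_distrib)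
    show "integrable lborel (\<lambda>v. (K v)\<^sup>2 * (F1 * (h * R)))" using K_int1 by simp
    fix v
    show "\<bar>(K v)\<^sup>2 * (f (y + h * v) - f y)\<bar> \<le> (K v)\<^sup>2 * (F1 * (h * R))"
    proof (cases "\<bar>v\<bar> \<le> R")
      case True
      have "\<bar>f (y + h * v) - f y\<bar> \<le> F1 * \<bar>h * v\<bar>" by (rule lip)
      also have "\<dots> \<le> F1 * (h * R)"
        using True h F_nonneg by (intro mult_left_mono) (auto simp: abs_mult)
      finally show ?thesis by (simp add: abs_mult mult_left_mono)
    qed (use K_supp[of v] in simp)
  qed
  finally show ?thesis by (simp add: algebra_simps)
qed

text \<open>The first order term is killed by the vanishing first moment of \<open>K\<close>.
  Continuity of \<open>f2\<close> at \<open>y\<close>, rather than its boundedness, is what turns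
  the second order remainder from O(h^2) into o(h^2).\<close>

lemma fbar_expansion:
  assumes K1: "(\<integral>v. K v \<partial>lborel) = 1" and Kv: "(\<integral>v. v * K v \<partial>lborel) = 0" and \<eta>: "0 < \<eta>"
  shows "\<exists>h0>0. \<forall>h. 0 < h \<longrightarrow> h < h0 \<longrightarrow>
    \<bar>fbar y h - (f y + h\<^sup>2 / 2 * f2 y * (\<integral>v. v\<^sup>2 * K v \<partial>lborel))\<bar> \<le> \<eta> * h\<^sup>2"
proof -
  \<comment> \<open>Chosen so that \<open>KL1 * (\<zeta> / 2) * R\<^sup>2\<close> stays below
    \<open>\<eta>\<close>; the added 1 avoids dividing by zero.\<close>
  define \<zeta> where "\<zeta> = 2 * \<eta> / (R\<^sup>2 * (KL1 + 1))"
  have \<zeta>: "0 < \<zeta>" using \<eta> R_pos KL1_nonneg by (simp add: \<zeta>_def)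
  have "isCont f2 y" using f2_cont by (simp add: continuous_on_eq_continuous_at)
  then obtain \<rho> where \<rho>: "0 < \<rho>" "\<And>t. \<bar>t - y\<bar> < \<rho> \<Longrightarrow> \<bar>f2 t - f2 y\<bar> < \<zeta>"
    unfolding continuous_at_eps_delta using \<zeta> by (auto simp: dist_real_def)
  have I: "integrable lborel (\<lambda>v. K v * v)" "integrable lborel (\<lambda>v. K v * v\<^sup>2)"
    by (rule K_integrable(1)[where C=R]; simp) (rule K_integrable(1)[where C="R\<^sup>2"]; use R_pos in \<open>simp add: abs_le_square_iff[symmetric]\<close>)
  \<comment> \<open>For bandwidths below \<open>\<rho> / R\<close> the point
    \<open>y + h * v\<close> stays within \<open>\<rho>\<close> of \<open>y\<close> for all
    \<open>v\<close> in the support.\<close>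
  show ?thesis
  proof (intro exI[of _ "\<rho> / R"] conjI allI impI)
    show "0 < \<rho> / R" using \<rho> R_pos by simp
    fix h assume h: "0 < h" "h < \<rho> / R"
    have hR: "h * R < \<rho>" using h R_pos by (simp add: field_simps)
    define g where "g v = f (y + h * v) - f y - f1 y * (h * v) - f2 y / 2 * (h * v)\<^sup>2" for v
    have [measurable]: "g \<in> borel_measurable borel" unfolding g_def by measurable
    have gb: "\<bar>g v\<bar> \<le> \<zeta> / 2 * (h\<^sup>2 * R\<^sup>2)" if "\<bar>v\<bar> \<le> R" for v
    proof -
      obtain t where t: "\<bar>t - y\<bar> \<le> \<bar>y + h * v - y\<bar>" "f (y + h * v) = f y + f1 y * (y + h * v - y) + f2 t / 2 * (y + h * v - y)\<^sup>2"
        by (rule taylor_order2[OF f_deriv f1_deriv])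
      have "\<bar>h * v\<bar> \<le> h * R" using h that by (simp add: abs_mult)
      then have "\<bar>t - y\<bar> < \<rho>" using t(1) hR by simp
      from \<rho>(2)[OF this] have f2: "\<bar>f2 t - f2 y\<bar> \<le> \<zeta>" by simp
      have "g v = (f2 t - f2 y) / 2 * (h * v)\<^sup>2" unfolding g_def t(2) by (simp add: field_simps)
      then have "\<bar>g v\<bar> = \<bar>f2 t - f2 y\<bar> / 2 * (h * v)\<^sup>2" by (simp only: abs_mult abs_divide) simp
      also have "\<dots> \<le> \<zeta> / 2 * (h * R)\<^sup>2"
        using f2 \<open>\<bar>h * v\<bar> \<le> h * R\<close> \<zeta> power_mono[OF \<open>\<bar>h * v\<bar> \<le> h * R\<close>, of 2]
        by (intro mult_mono divide_right_mono) auto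
      finally show ?thesis by (simp add: power_mult_distrib)
    qed
    have If: "integrable lborel (\<lambda>v. K v * f (y + h * v))" by (rule K_integrable(1)[where C=F]) (use f_shift_bound in auto)
    have "K v * g v = K v * f (y + h * v) - K v * f y - (f1 y * h) * (K v * v) - (f2 y / 2 * h\<^sup>2) * (K v * v\<^sup>2)" for v
      unfolding g_def by (simp add: algebra_simps power_mult_distrib)
    then have "(\<integral>v. K v * g v \<partial>lborel) = fbar y h - f y - f2 y / 2 * h\<^sup>2 * (\<integral>v. K v * v\<^sup>2 \<partial>lborel)"
      using If I K_int1(1) K1 Kv by (simp add: fbar_def mult.commute[of _ "K _"])
    then have "\<bar>fbar y h - (f y + h\<^sup>2 / 2 * f2 y * (\<integral>v. v\<^sup>2 * K v \<partial>lborel))\<bar> = \<bar>\<integral>v. K v * g v \<partial>lborel\<bar>"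
      by (simp add: mult.commute[of _ "K _"] mult.commute[of "h\<^sup>2"] diff_diff_eq)
    also have "\<dots> \<le> KL1 * (\<zeta> / 2 * (h\<^sup>2 * R\<^sup>2))" by (rule K_integral_bound) (use gb in auto)
    also have "\<dots> = KL1 / (KL1 + 1) * (\<eta> * h\<^sup>2)" using R_pos KL1_nonneg by (simp add: \<zeta>_def)
    also have "\<dots> \<le> 1 * (\<eta> * h\<^sup>2)" using KL1_nonneg \<eta> by (intro mult_right_mono) auto
    finally show "\<bar>fbar y h - (f y + h\<^sup>2 / 2 * f2 y * (\<integral>v. v\<^sup>2 * K v \<partial>lborel))\<bar> \<le> \<eta> * h\<^sup>2" by simp
  qed
qed

end

section \<open>Characteristic functions of sums over bounded arrays\<close>

lemma indep_vars_PiM_coordinates: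
  assumes "prob_space N"
  shows "prob_space.indep_vars (PiM UNIV (\<lambda>_::'i. N)) (\<lambda>_. N) (\<lambda>i w. w i) UNIV"
proof -
  interpret P: prob_space "PiM UNIV (\<lambda>_::'i. N)" by (rule prob_space_PiM) (rule assms)
  have "distr (PiM UNIV (\<lambda>_::'i. N)) N (\<lambda>w. w i) = N" for i
    by (rule distr_PiM_component) (auto intro: assms)
  then show ?thesis
    by (subst P.indep_vars_iff_distr_eq_PiM') (auto simp: restrict_def distr_id2)
qed

lemma indep_vars_PiM_functions:
  fixes q :: "'i \<Rightarrow> 'b \<Rightarrow> real"
  assumes "prob_space N" and q: "\<And>i. q i \<in> borel_measurable N"
  shows "prob_space.indep_vars (PiM UNIV (\<lambda>_::'i. N)) (\<lambda>_. borel) (\<lambda>i w. q i (w i)) I"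
proof -
  interpret P: prob_space "PiM UNIV (\<lambda>_::'i. N)" by (rule prob_space_PiM) (rule assms)
  show ?thesis
    using P.indep_vars_compose2[OF P.indep_vars_subset[OF indep_vars_PiM_coordinates[OF assms(1)]], of I q "\<lambda>_. borel"] q
    by simp
qed

lemma exp_minus_approx:
  fixes x :: real
  assumes "0 \<le> x"
  shows "\<bar>(1 - x) - exp (- x)\<bar> \<le> x\<^sup>2"
proof -
  have "exp (- x) = inverse (exp x)" by (simp add: exp_minus)
  also have "\<dots> \<le> inverse (1 + x)" using assms exp_ge_add_one_self[of x] by (intro le_imp_inverse_le) auto
  also have "\<dots> \<le> 1 - x + x\<^sup>2" using assms by (simp add: field_simps power2_eq_square)
  finally show ?thesis using exp_ge_add_one_self[of "- x"] by (simp add: abs_le_iff)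
qed

text \<open>A uniform bound on the summands replaces a Lindeberg condition: the third order
  remainder is the second order term times a multiple of \<open>\<bar>s\<bar> * C\<close>.\<close>

lemma (in prob_space) char_approx_bounded:
  fixes k :: "'a \<Rightarrow> real"
  assumes [measurable]: "k \<in> borel_measurable M" and kb: "\<And>u. \<bar>k u\<bar> \<le> C" and k0: "expectation k = 0"
    and \<sigma>: "\<sigma>2 = expectation (\<lambda>u. (k u)\<^sup>2)"
  shows "cmod ((CLINT u|M. iexp (s * k u)) - (1 - s\<^sup>2 * \<sigma>2 / 2)) \<le> s\<^sup>2 * \<sigma>2 * (\<bar>s\<bar> * C) / 6"
    "cmod (CLINT u|M. iexp (s * k u)) \<le> 1"
proof -
  have k2: "(k u)\<^sup>2 \<le> C\<^sup>2" for u using power_mono[OF kb abs_ge_zero, of u 2] by simp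
  have ki: "integrable M k" by (rule integrable_const_bound[of _ C]) (use kb in auto)
  have ki2: "integrable M (\<lambda>u. (k u)\<^sup>2)" by (rule integrable_const_bound[of _ "C\<^sup>2"]) (use k2 in auto)
  have var: "variance k = \<sigma>2" by (simp add: k0 \<sigma>)
  have ch: "char (distr M borel k) s = (CLINT u|M. iexp (s * k u))"
    unfolding char_def by (subst integral_distr) auto
  show "cmod (CLINT u|M. iexp (s * k u)) \<le> 1"
    unfolding ch[symmetric] by (intro real_distribution.cmod_char_le_1 real_distribution_distr) simp
  have mi: "min (6 * (k u)\<^sup>2) (\<bar>s\<bar> * \<bar>k u\<bar> ^ 3) \<le> \<bar>s\<bar> * C * (k u)\<^sup>2" for u
  proof -
    have "\<bar>s\<bar> * \<bar>k u\<bar> ^ 3 = \<bar>s\<bar> * (\<bar>k u\<bar> * (k u)\<^sup>2)" by (simp add: power3_eq_cube power2_eq_square)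
    also have "\<dots> \<le> \<bar>s\<bar> * (C * (k u)\<^sup>2)" using kb by (intro mult_left_mono mult_right_mono) auto
    finally show ?thesis by simp
  qed
  have "cmod ((CLINT u|M. iexp (s * k u)) - (1 - s\<^sup>2 * \<sigma>2 / 2)) \<le>
      (s\<^sup>2 / 6) * expectation (\<lambda>u. min (6 * (k u)\<^sup>2) (\<bar>s\<bar> * \<bar>k u\<bar> ^ 3))"
    unfolding ch[symmetric] using ki ki2 k0 var by (intro char_approx3') auto
  also have "\<dots> \<le> (s\<^sup>2 / 6) * expectation (\<lambda>u. \<bar>s\<bar> * C * (k u)\<^sup>2)"
    using kb[of undefined] by (intro mult_left_mono integral_mono_AE') (use ki2 mi in auto)
  also have "\<dots> = s\<^sup>2 * \<sigma>2 * (\<bar>s\<bar> * C) / 6" by (simp add: \<sigma> mult_ac)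
  finally show "cmod ((CLINT u|M. iexp (s * k u)) - (1 - s\<^sup>2 * \<sigma>2 / 2)) \<le> s\<^sup>2 * \<sigma>2 * (\<bar>s\<bar> * C) / 6" .
qed

text \<open>With \<open>x = s\<^sup>2 * \<sigma>2 / 2\<close>, the characteristic function,
  \<open>1 - x\<close> and \<open>exp (- x)\<close> all lie in the unit disc, so their powers differ
  by at most \<open>r\<close> times the differences of the bases. The total error is
  \<open>r * x\<close>, which converges, times a factor tending to zero.\<close>

lemma (in prob_space) char_power_limit:
  fixes k :: "nat \<Rightarrow> 'a \<Rightarrow> real" and r :: "nat \<Rightarrow> nat"
  assumes k: "\<And>n. k n \<in> borel_measurable M" and kb: "\<And>n u. \<bar>k n u\<bar> \<le> C" and k0: "\<And>n. expectation (k n) = 0"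
    and \<sigma>: "\<And>n. \<sigma>2 n = expectation (\<lambda>u. (k n u)\<^sup>2)"
    and s: "s \<longlonglongrightarrow> 0" and lim: "(\<lambda>n. real (r n) * ((s n)\<^sup>2 * \<sigma>2 n)) \<longlonglongrightarrow> 2 * a"
  shows "(\<lambda>n. (CLINT u|M. iexp (s n * k n u)) ^ r n) \<longlonglongrightarrow> complex_of_real (exp (- a))"
proof -
  define x where "x n = (s n)\<^sup>2 * \<sigma>2 n / 2" for n
  have \<sigma>b: "0 \<le> \<sigma>2 n" "\<sigma>2 n \<le> C\<^sup>2" for n
  proof -
    have k2: "(k n u)\<^sup>2 \<le> C\<^sup>2" for u using power_mono[OF kb abs_ge_zero, of n u 2] by simp
    have ki2: "integrable M (\<lambda>u. (k n u)\<^sup>2)" by (rule integrable_const_bound[of _ "C\<^sup>2"]) (use k2 k in auto)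
    show "0 \<le> \<sigma>2 n" by (simp add: \<sigma>)
    have "\<sigma>2 n \<le> expectation (\<lambda>u. C\<^sup>2)" unfolding \<sigma> by (intro integral_mono ki2) (use k2 in auto)
    then show "\<sigma>2 n \<le> C\<^sup>2" by (simp add: prob_space)
  qed
  have x0: "0 \<le> x n" for n using \<sigma>b by (simp add: x_def)
  have xlim: "x \<longlonglongrightarrow> 0"
  proof (rule real_tendsto_sandwich[of "\<lambda>_. 0" _ _ "\<lambda>n. (s n)\<^sup>2 * C\<^sup>2 / 2"])
    show "(\<lambda>n. (s n)\<^sup>2 * C\<^sup>2 / 2) \<longlonglongrightarrow> 0" using s by (auto intro!: tendsto_eq_intros)
    show "\<forall>\<^sub>F n in sequentially. x n \<le> (s n)\<^sup>2 * C\<^sup>2 / 2"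
      using \<sigma>b by (auto simp: x_def intro!: always_eventually mult_left_mono)
  qed (use x0 in auto)
  have rx: "(\<lambda>n. real (r n) * x n) \<longlonglongrightarrow> a"
    using tendsto_divide[OF lim tendsto_const[of 2]] by (simp add: x_def)
  have bound: "\<forall>\<^sub>F n in sequentially.
      cmod ((CLINT u|M. iexp (s n * k n u)) ^ r n - complex_of_real (exp (- (real (r n) * x n))))
        \<le> (real (r n) * x n) * (\<bar>s n\<bar> * C / 3 + x n)"
  proof -
    have "\<forall>\<^sub>F n in sequentially. x n < 1" using xlim by (rule order_tendstoD) simp
    then show ?thesis
    proof eventually_elim
      case (elim n)
      let ?c = "CLINT u|M. iexp (s n * k n u)"
      have 1: "cmod (?c - of_real (1 - x n)) \<le> x n * (\<bar>s n\<bar> * C / 3)" "cmod ?c \<le> 1"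
        using char_approx_bounded[OF k[of n] kb k0 \<sigma>, where s = "s n"] by (simp_all add: x_def)
      have 2: "cmod (of_real (1 - x n)) \<le> 1" using x0[of n] elim by (simp del: of_real_diff)
      have 3: "cmod (of_real (exp (- x n))) \<le> 1" using x0[of n] by simp
      have 4: "cmod (of_real (1 - x n) - of_real (exp (- x n))) \<le> (x n)\<^sup>2"
        using exp_minus_approx[OF x0[of n]] by (metis norm_of_real of_real_diff)
      have "cmod (?c ^ r n - of_real (1 - x n) ^ r n) \<le> r n * cmod (?c - of_real (1 - x n))"
        by (rule norm_power_diff) fact+
      moreover have "cmod (of_real (1 - x n) ^ r n - of_real (exp (- x n)) ^ r n) \<le> r n * cmod (of_real (1 - x n) - of_real (exp (- x n)) :: complex)"
        by (rule norm_power_diff) fact+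
      moreover have "cmod (?c ^ r n - of_real (exp (- x n)) ^ r n) \<le>
        cmod (?c ^ r n - of_real (1 - x n) ^ r n) + cmod (of_real (1 - x n) ^ r n - of_real (exp (- x n)) ^ r n)"
        using norm_triangle_ineq[of "?c ^ r n - of_real (1 - x n) ^ r n" "of_real (1 - x n) ^ r n - of_real (exp (- x n)) ^ r n"] by simp
      ultimately have "cmod (?c ^ r n - of_real (exp (- x n)) ^ r n) \<le> r n * (x n * (\<bar>s n\<bar> * C / 3)) + r n * (x n)\<^sup>2"
        using mult_left_mono[OF 1(1), of "real (r n)"] mult_left_mono[OF 4, of "real (r n)"] by linarith
      moreover have "complex_of_real (exp (- x n)) ^ r n = of_real (exp (- (real (r n) * x n)))"
        by (metis exp_of_nat_mult mult_minus_right of_real_power)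
      ultimately show ?case by (simp add: algebra_simps power2_eq_square)
    qed
  qed
  have "(\<lambda>n. (real (r n) * x n) * (\<bar>s n\<bar> * C / 3 + x n)) \<longlonglongrightarrow> 0"
  proof -
    have "(\<lambda>n. \<bar>s n\<bar> * C / 3 + x n) \<longlonglongrightarrow> 0" using s xlim by (auto intro!: tendsto_eq_intros)
    from tendsto_mult[OF rx this] show ?thesis by simp
  qed
  then have "(\<lambda>n. (CLINT u|M. iexp (s n * k n u)) ^ r n - complex_of_real (exp (- (real (r n) * x n)))) \<longlonglongrightarrow> 0"
    by (rule Lim_null_comparison[OF bound])
  moreover have "(\<lambda>n. complex_of_real (exp (- (real (r n) * x n)))) \<longlonglongrightarrow> complex_of_real (exp (- a))"
    using rx by (intro tendsto_intros)
  ultimately show ?thesis by (rule Lim_transform[rotated])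
qed

context error_law
begin

lemma char_sum_coordinates:
  fixes k :: "real \<Rightarrow> real"
  assumes [measurable]: "k \<in> borel_measurable borel"
  shows "(CLINT e|P. iexp (s * (\<Sum>i\<in>A. k (e i)))) = (CLINT u|N. iexp (s * k u)) ^ card A"
proof -
  have km: "k \<in> borel_measurable N" by simp
  have [measurable]: "(\<lambda>e. k (e i)) \<in> borel_measurable P" for i by measurable
  have "(CLINT e|P. iexp (s * (\<Sum>i\<in>A. k (e i)))) = char (distr P borel (\<lambda>e. \<Sum>i\<in>A. k (e i))) s"
    unfolding char_def by (subst integral_distr) auto
  also have "\<dots> = (\<Prod>i\<in>A. char (distr P borel (\<lambda>e. k (e i))) s)"
    by (rule P.char_distr_sum[OF indep_vars_PiM_functions[OF prob_N, of "\<lambda>_. k"]]) (rule km)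
  also have "\<dots> = (\<Prod>i\<in>A. CLINT u|N. iexp (s * k u))"
  proof (rule prod.cong[OF refl])
    fix i
    have "char (distr P borel (\<lambda>e. k (e i))) s = (CLINT e|P. iexp (s * k (e i)))"
      unfolding char_def by (subst integral_distr) auto
    also have "\<dots> = (CLINT u|distr P N (\<lambda>e. e i). iexp (s * k u))"
      by (subst integral_distr) (auto simp: measurable_cong_sets[OF refl sets_N])
    also have "distr P N (\<lambda>e. e i) = N" by (rule distr_PiM_comp[OF prob_N refl])
    finally show "char (distr P borel (\<lambda>e. k (e i))) s = (CLINT u|N. iexp (s * k u))" .
  qed
  finally show ?thesis by simp
qed

end

section \<open>The limit law for a fixed design\<close>

lemma cmod_iexp_diff_le: "cmod (iexp x - iexp y) \<le> \<bar>x - y\<bar>"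
proof -
  have "iexp x - iexp y = iexp y * (iexp (x - y) - 1)"
    by (simp add: algebra_simps exp_add[symmetric])
  then have "cmod (iexp x - iexp y) = cmod (iexp (x - y) - 1)"
    by (simp add: norm_mult)
  also have "\<dots> \<le> \<bar>x - y\<bar>" using iexp_approx1[of "x - y" 0] by simp
  finally show ?thesis .
qed

text \<open>Transfers a first moment bound on a remainder to characteristic functions, whatever the
  dependence between \<open>u\<close> and \<open>v\<close>.\<close>

lemma (in prob_space) cmod_integral_iexp_diff_le:
  assumes [measurable]: "u \<in> borel_measurable M" "v \<in> borel_measurable M"
    and "integrable M (\<lambda>x. u x - v x :: real)"
  shows "cmod ((CLINT x|M. iexp (u x)) - (CLINT x|M. iexp (v x))) \<le> expectation (\<lambda>x. \<bar>u x - v x\<bar>)"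
proof -
  have i: "integrable M (\<lambda>x. iexp (u x))" "integrable M (\<lambda>x. iexp (v x))"
    by (rule integrable_iexp; simp)+
  have "cmod ((CLINT x|M. iexp (u x)) - (CLINT x|M. iexp (v x))) = cmod (CLINT x|M. iexp (u x) - iexp (v x))"
    using i by simp
  also have "\<dots> \<le> (\<integral>x. cmod (iexp (u x) - iexp (v x)) \<partial>M)" by (rule integral_norm_bound)
  also have "\<dots> \<le> expectation (\<lambda>x. \<bar>u x - v x\<bar>)"
    by (intro integral_mono integrable_norm Bochner_Integration.integrable_diff i integrable_abs assms(3) cmod_iexp_diff_le)
  finally show ?thesis .
qed

locale density_kernel_noise = density_kernel f f1 f2 K F F1 F2 L R B
  for f f1 f2 K :: "real \<Rightarrow> real" and F F1 F2 L R B :: real +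
  assumes f_sq: "integrable (density lborel f) (\<lambda>u. u\<^sup>2)" and f_mean: "(\<integral>u. u \<partial>density lborel f) = 0"
begin

abbreviation "N \<equiv> density lborel (\<lambda>x. ennreal (f x))"

sublocale error_law N
  by (intro error_law.intro error_law_axioms.intro f_prob f_sq f_mean) simp

lemma perturbation:
  assumes h: "0 < h"
  shows "residual_perturbation N (\<lambda>u. K ((u - y) / h)) (\<phi> y h) B (4 * L\<^sup>2 * R * F / h) (h * (KL1 * (F2 / 2))) (slope y h)"
proof (intro residual_perturbation.intro residual_perturbation_axioms.intro error_law_axioms)
  show "(\<lambda>u. K ((u - y) / h)) \<in> borel_measurable borel" by simp
  show "\<bar>K ((u - y) / h)\<bar> \<le> B" for u by (rule K_bound)
  show "\<phi> y h \<delta> = (\<integral>u. K ((u + \<delta> - y) / h) \<partial>N)" for \<delta> using kernel_mean[OF h] by simp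
  show "(\<integral>u. (K ((u + \<delta> - y) / h) - K ((u + \<delta>' - y) / h))\<^sup>2 \<partial>N) \<le> 4 * L\<^sup>2 * R * F / h * (\<delta> - \<delta>')\<^sup>2" for \<delta> \<delta>'
    by (rule kernel_increment_L2[OF h])
  show "\<bar>\<phi> y h \<delta> - \<phi> y h 0 - slope y h * \<delta>\<bar> \<le> h * (KL1 * (F2 / 2)) * \<delta>\<^sup>2" for \<delta>
    by (rule \<phi>_expansion[OF h])
qed

text \<open>\<open>perturbation_bound\<close> for the kernel, divided by the scale of the sum and
  rearranged so that the bias enters only through \<open>\<eta>\<close> and the weights only through
  \<open>V\<close> and \<open>C\<close>. Every summand then contains a factor that the bandwidth
  conditions drive to zero.\<close>

lemma standardized_remainder:
  fixes \<beta> :: "nat \<Rightarrow> real" and y :: real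
  assumes h: "0 < h" and n: "0 < n" and A: "A \<subseteq> {1..n}" and a0: "\<And>i. a i i = 0"
    and V: "\<And>i. i \<in> A \<Longrightarrow> (\<Sum>j\<in>{1..n}. (a i j)\<^sup>2) \<le> V" and V0: "0 \<le> V"
    and C: "\<And>j. j \<in> {1..n} \<Longrightarrow> \<bar>\<Sum>i\<in>A. a i j\<bar> \<le> C" and C0: "0 \<le> C"
  defines "\<Delta> i e \<equiv> - (\<beta> i + (\<Sum>j\<in>{1..n}. a i j * e j))"
  defines "S e \<equiv> \<Sum>i\<in>A. K ((e i + \<Delta> i e - y) / h) - K ((e i - y) / h)"
  defines "\<eta> \<equiv> h * (\<Sum>i\<in>A. (\<beta> i)\<^sup>2)"
  shows "integrable P S"
    "(\<integral>e. \<bar>S e\<bar> \<partial>P) / sqrt (real n * h) \<le>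
      KL1 * F1 * (sqrt \<eta> + C * (sqrt s2 * sqrt h)) + KL1 * F2 * (\<eta> / sqrt (real n * h) + s2 * (sqrt (real n * h) * V))
      + sqrt (4 * L\<^sup>2 * R * F * (\<eta> / (real n * h ^ 3) + 2 * s2 * (V / h\<^sup>2)))"
proof -
  interpret residual_perturbation N "\<lambda>u. K ((u - y) / h)" "\<phi> y h" B "4 * L\<^sup>2 * R * F / h" "h * (KL1 * (F2 / 2))" "slope y h"
    by (rule perturbation[OF h])
  note b = perturbation_bound[of "{1..n}" A a \<Delta> \<beta> V C, OF finite_atLeastAtMost A a0 \<Delta>_def[THEN meta_eq_to_obj_eq] V C]
  show "integrable P S" using b(1) by (simp add: S_def[abs_def])
  define b2 where "b2 = (\<Sum>i\<in>A. (\<beta> i)\<^sup>2)"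
  have b2: "0 \<le> b2" by (simp add: b2_def sum_nonneg)
  have card: "real (card A) \<le> real n" using card_mono[OF finite_atLeastAtMost A] by simp
  have nh: "0 < real n * h" using n h by simp
  let ?r = "sqrt (real n * h)"
  have r: "0 < ?r" using nh by simp
  \<comment> \<open>Cauchy-Schwarz bounds the summed bias by its mean square size; after
    standardization this is exactly \<open>sqrt \<eta>\<close>.\<close>
  have beta: "\<bar>\<Sum>i\<in>A. \<beta> i\<bar> \<le> sqrt (real n * b2)"
  proof (rule real_le_rsqrt)
    have "(\<Sum>i\<in>A. \<beta> i)\<^sup>2 \<le> (\<Sum>i\<in>A. (\<beta> i)\<^sup>2) * real (card A)"
      using Cauchy_Schwarz_ineq_sum[of \<beta> "\<lambda>_. 1" A] by simp
    also have "\<dots> \<le> b2 * real n" using card b2 by (simp add: b2_def mult_left_mono)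
    finally show "\<bar>\<Sum>i\<in>A. \<beta> i\<bar>\<^sup>2 \<le> real n * b2" by (simp add: mult.commute)
  qed
  have "(\<integral>e. \<bar>S e\<bar> \<partial>P) \<le> \<bar>slope y h\<bar> * (\<bar>\<Sum>i\<in>A. \<beta> i\<bar> + C * sqrt (s2 * real n))
     + h * (KL1 * (F2 / 2)) * (b2 + real (card A) * s2 * V)
     + sqrt (4 * L\<^sup>2 * R * F / h * (b2 + 2 * real (card A) * s2 * V))"
    using b(2) by (simp add: S_def[abs_def] b2_def)
  also have "\<dots> \<le> h * (KL1 * F1) * (sqrt (real n * b2) + C * sqrt (s2 * real n))
     + h * (KL1 * F2) * (b2 + real n * s2 * V)
     + sqrt (4 * L\<^sup>2 * R * F / h * (b2 + 2 * real n * s2 * V))"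
  proof (intro add_mono mult_mono real_sqrt_le_mono slope_bound h beta card order_refl)
    show "F2 / 2 \<le> F2" using F_nonneg by simp
  qed (use h KL1_nonneg F_nonneg R_pos s2_nonneg V0 C0 b2 in \<open>auto intro!: mult_nonneg_nonneg divide_nonneg_nonneg add_nonneg_nonneg\<close>)
  finally have "(\<integral>e. \<bar>S e\<bar> \<partial>P) / ?r \<le> (h * (KL1 * F1) * (sqrt (real n * b2) + C * sqrt (s2 * real n))
     + h * (KL1 * F2) * (b2 + real n * s2 * V)
     + sqrt (4 * L\<^sup>2 * R * F / h * (b2 + 2 * real n * s2 * V))) / ?r"
    using r by (intro divide_right_mono) auto
  also have "\<dots> = KL1 * F1 * (h * sqrt (real n * b2) / ?r + C * (h * sqrt (s2 * real n) / ?r))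
     + KL1 * F2 * (h * b2 / ?r + s2 * (h * real n / ?r * V))
     + sqrt (4 * L\<^sup>2 * R * F / h * (b2 + 2 * real n * s2 * V)) / ?r"
    by (simp only: add_divide_distrib distrib_left distrib_right mult_ac times_divide_eq_right times_divide_eq_left)
  also have "h * sqrt (real n * b2) / ?r = sqrt \<eta>"
  proof -
    have "h * sqrt (real n * b2) / ?r = sqrt (h * h) * sqrt (real n * b2) / ?r" using h by simp
    also have "\<dots> = sqrt (h * h * (real n * b2) / (real n * h))" by (simp only: real_sqrt_mult real_sqrt_divide)
    also have "h * h * (real n * b2) / (real n * h) = \<eta>" using n h by (simp add: \<eta>_def b2_def)
    finally show ?thesis .
  qed
  also have "h * sqrt (s2 * real n) / ?r = sqrt s2 * sqrt h"
  proof -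
    have "h * sqrt (s2 * real n) / ?r = sqrt (h * h) * sqrt (s2 * real n) / ?r" using h by simp
    also have "\<dots> = sqrt (h * h * (s2 * real n) / (real n * h))" by (simp only: real_sqrt_mult real_sqrt_divide)
    also have "h * h * (s2 * real n) / (real n * h) = s2 * h" using n h by simp
    finally show ?thesis by (simp add: real_sqrt_mult)
  qed
  also have "h * real n / ?r = ?r" using real_div_sqrt[of "real n * h"] nh by (simp add: mult.commute[of h])
  also have "sqrt (4 * L\<^sup>2 * R * F / h * (b2 + 2 * real n * s2 * V)) / ?r
      = sqrt (4 * L\<^sup>2 * R * F * (\<eta> / (real n * h ^ 3) + 2 * s2 * (V / h\<^sup>2)))"
  proof -
    have "4 * L\<^sup>2 * R * F / h * (b2 + 2 * real n * s2 * V) / (real n * h)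
      = 4 * L\<^sup>2 * R * F * ((b2 + 2 * real n * s2 * V) / (real n * h\<^sup>2))"
      using n h by (simp add: power2_eq_square)
    also have "(b2 + 2 * real n * s2 * V) / (real n * h\<^sup>2) = \<eta> / (real n * h ^ 3) + 2 * s2 * (V / h\<^sup>2)"
    proof -
      have "\<eta> / (real n * h ^ 3) = b2 / (real n * h\<^sup>2)"
        using n h unfolding \<eta>_def b2_def[symmetric] by (simp add: power2_eq_square power3_eq_cube)
      moreover have "2 * real n * s2 * V / (real n * h\<^sup>2) = 2 * s2 * (V / h\<^sup>2)" using n h by simp
      ultimately show ?thesis by (simp add: add_divide_distrib)
    qed
    finally show ?thesis by (simp only: real_sqrt_divide[symmetric])
  qed
  also have "h * b2 = \<eta>" by (simp add: \<eta>_def b2_def)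
  finally show "(\<integral>e. \<bar>S e\<bar> \<partial>P) / ?r \<le>
      KL1 * F1 * (sqrt \<eta> + C * (sqrt s2 * sqrt h)) + KL1 * F2 * (\<eta> / ?r + s2 * (?r * V))
      + sqrt (4 * L\<^sup>2 * R * F * (\<eta> / (real n * h ^ 3) + 2 * s2 * (V / h\<^sup>2)))" .
qed

text \<open>The statistic splits into \<open>s n\<close> times a sum of independent, exactly centred
  kernel terms and \<open>s n\<close> times the replacement error, which is small in first mean. The
  division by \<open>p\<close> in the variance arises because about \<open>p * n\<close> errors are
  averaged while the scaling uses \<open>n\<close>. Bounds are only eventual, so that any sequence
  of good designs can be inserted.\<close>

theorem fixed_design_limit:
  fixes h V :: "nat \<Rightarrow> real" and A :: "nat \<Rightarrow> nat set" and a :: "nat \<Rightarrow> nat \<Rightarrow> nat \<Rightarrow> real" and \<beta> :: "nat \<Rightarrow> nat \<Rightarrow> real" and y t :: real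
  assumes h: "\<And>n. 0 < h n" "h \<longlonglongrightarrow> 0" and A: "\<And>n. A n \<subseteq> {1..n}" and a0: "\<And>n i. a n i i = 0"
    and V: "\<forall>\<^sub>F n in sequentially. \<forall>i\<in>A n. (\<Sum>j\<in>{1..n}. (a n i j)\<^sup>2) \<le> V n" and V0: "\<And>n. 0 \<le> V n"
    and C: "\<forall>\<^sub>F n in sequentially. \<forall>j\<in>{1..n}. \<bar>\<Sum>i\<in>A n. a n i j\<bar> \<le> C" and C0: "0 \<le> C"
    and p: "(\<lambda>n. real (card (A n)) / real n) \<longlonglongrightarrow> p" "0 < p"
    and \<eta>: "(\<lambda>n. h n * (\<Sum>i\<in>A n. (\<beta> n i)\<^sup>2)) \<longlonglongrightarrow> 0"
    and nh: "(\<lambda>n. 1 / sqrt (real n * h n)) \<longlonglongrightarrow> 0" and nh3: "(\<lambda>n. 1 / (real n * h n ^ 3)) \<longlonglongrightarrow> 0"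
    and V1: "(\<lambda>n. sqrt (real n * h n) * V n) \<longlonglongrightarrow> 0" and V2: "(\<lambda>n. V n / (h n)\<^sup>2) \<longlonglongrightarrow> 0"
  defines "\<Delta> n i e \<equiv> - (\<beta> n i + (\<Sum>j\<in>{1..n}. a n i j * e j))"
  defines "U n e \<equiv> sqrt (real n * h n) *
      ((\<Sum>i\<in>A n. K ((e i + \<Delta> n i e - y) / h n)) / (h n * real (card (A n))) - fbar y (h n))"
  shows "(\<lambda>n. CLINT e|P. iexp (t * U n e)) \<longlonglongrightarrow> exp (- (t\<^sup>2 * (f y / p * (\<integral>v. (K v)\<^sup>2 \<partial>lborel)) / 2))"
proof -
  define k where "k n u = K ((u - y) / h n) - h n * fbar y (h n)" for n u
  \<comment> \<open>The factor from kernel sums to the standardized statistic; it equals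
    \<open>n / card (A n)\<close> over \<open>sqrt (n * h n)\<close> and hence tends to
    zero.\<close>
  define s where "s n = sqrt (real n * h n) / (h n * real (card (A n)))" for n
  define S where "S n e = (\<Sum>i\<in>A n. K ((e i + \<Delta> n i e - y) / h n) - K ((e i - y) / h n))" for n e
  define \<sigma>2 where "\<sigma>2 n = (\<integral>u. (k n u)\<^sup>2 \<partial>N)" for n
  let ?K2 = "\<integral>v. (K v)\<^sup>2 \<partial>lborel"
  have [measurable]: "\<Delta> n i \<in> borel_measurable P" for n i unfolding \<Delta>_def[abs_def] by measurable
  have [measurable]: "U n \<in> borel_measurable P" for n unfolding U_def[abs_def] by measurable
  have [measurable]: "k n \<in> borel_measurable borel" for n unfolding k_def[abs_def] by measurable
  have cardpos: "\<forall>\<^sub>F n in sequentially. 0 < card (A n) \<and> 0 < n"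
  proof -
    have "\<forall>\<^sub>F n in sequentially. 0 < real (card (A n)) / real n" using p by (intro order_tendstoD(1)) auto
    then show ?thesis by eventually_elim (auto simp: zero_less_divide_iff)
  qed
  have ip: "(\<lambda>n. real n / real (card (A n))) \<longlonglongrightarrow> 1 / p"
    using tendsto_inverse[OF p(1)] p(2) by (simp add: inverse_eq_divide)
  have s_eq: "s n = real n / real (card (A n)) * (1 / sqrt (real n * h n))" if "0 < n" for n
  proof -
    have "sqrt (real n * h n) * sqrt (real n * h n) = real n * h n" using h(1)[of n] by simp
    then have "sqrt (real n * h n) / h n = real n / sqrt (real n * h n)"
      using that h(1)[of n] by (simp add: frac_eq_eq)
    then show ?thesis by (simp add: s_def divide_divide_eq_left[symmetric] del: divide_divide_eq_left)
       (simp add: mult.commute)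
  qed
  have s_ev: "\<forall>\<^sub>F n in sequentially. s n = real n / real (card (A n)) * (1 / sqrt (real n * h n))"
    using cardpos by eventually_elim (use s_eq in auto)
  have s0: "s \<longlonglongrightarrow> 0"
    using tendsto_mult[OF ip nh] by (subst tendsto_cong[OF s_ev]) simp
  have kb: "\<bar>k n u\<bar> \<le> 2 * B" for n u
  proof -
    have "\<bar>\<integral>u. K ((u - y) / h n) \<partial>N\<bar> \<le> (\<integral>u. \<bar>K ((u - y) / h n)\<bar> \<partial>N)" by (rule integral_abs_bound)
    also have "\<dots> \<le> B"
    proof (rule integral_le_const)
      show "integrable N (\<lambda>u. \<bar>K ((u - y) / h n)\<bar>)" by (rule integrable_const_bound[of _ B]) (use K_bound in auto)
    qed (use K_bound in auto)
    finally show ?thesis using K_bound[of "(u - y) / h n"] by (simp add: k_def kernel_mean0[OF h(1)])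
  qed
  have Ki: "integrable N (\<lambda>u. K ((u - y) / h n))" "integrable N (\<lambda>u. (K ((u - y) / h n))\<^sup>2)" for n
    by (rule integrable_const_bound[of _ B]; use K_bound in simp)
       (rule integrable_const_bound[of _ "B\<^sup>2"]; use power_mono[OF K_bound abs_ge_zero, of _ 2] in simp)
  have k0: "(\<integral>u. k n u \<partial>N) = 0" for n
    using Ki(1)[of n] kernel_mean0[OF h(1)[of n], of y] prob_space by (simp add: k_def)
  \<comment> \<open>The squared mean of the kernel is of order \<open>h\<^sup>2\<close>, so after
    division by \<open>h\<close> only the second moment survives in the limit.\<close>
  have \<sigma>2: "\<sigma>2 n / h n = (\<integral>u. (K ((u - y) / h n))\<^sup>2 \<partial>N) / h n - h n * (fbar y (h n))\<^sup>2" for n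
  proof -
    have "\<sigma>2 n = variance (\<lambda>u. K ((u - y) / h n))"
      by (simp add: \<sigma>2_def k_def kernel_mean0[OF h(1)])
    also have "\<dots> = (\<integral>u. (K ((u - y) / h n))\<^sup>2 \<partial>N) - (h n * fbar y (h n))\<^sup>2"
      using Ki[of n] by (subst variance_eq) (auto simp: kernel_mean0[OF h(1)])
    finally show ?thesis using h(1)[of n] by (simp add: diff_divide_distrib power2_eq_square)
  qed
  have \<sigma>lim: "(\<lambda>n. \<sigma>2 n / h n) \<longlonglongrightarrow> f y * ?K2"
  proof -
    have "(\<lambda>n. (\<integral>u. (K ((u - y) / h n))\<^sup>2 \<partial>N) / h n - f y * ?K2) \<longlonglongrightarrow> 0"
    proof (rule Lim_null_comparison)
      show "\<forall>\<^sub>F n in sequentially. norm ((\<integral>u. (K ((u - y) / h n))\<^sup>2 \<partial>N) / h n - f y * ?K2) \<le> h n * (F1 * R * ?K2)"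
        using kernel_second_moment[OF h(1)] by (auto intro!: always_eventually)
      show "(\<lambda>n. h n * (F1 * R * ?K2)) \<longlonglongrightarrow> 0" using tendsto_mult_right[OF h(2), of "F1 * R * ?K2"] by simp
    qed
    then have 1: "(\<lambda>n. (\<integral>u. (K ((u - y) / h n))\<^sup>2 \<partial>N) / h n) \<longlonglongrightarrow> f y * ?K2" by (rule LIM_zero_cancel)
    have 2: "(\<lambda>n. h n * (fbar y (h n))\<^sup>2) \<longlonglongrightarrow> 0"
    proof (rule Lim_null_comparison)
      show "\<forall>\<^sub>F n in sequentially. norm (h n * (fbar y (h n))\<^sup>2) \<le> h n * (KL1 * F)\<^sup>2"
        using h(1) power_mono[OF fbar_bound abs_ge_zero, of y _ 2]
        by (auto intro!: always_eventually mult_left_mono simp: abs_mult less_imp_le)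
      show "(\<lambda>n. h n * (KL1 * F)\<^sup>2) \<longlonglongrightarrow> 0" using tendsto_mult_right[OF h(2), of "(KL1 * F)\<^sup>2"] by simp
    qed
    show ?thesis unfolding \<sigma>2 using tendsto_diff[OF 1 2] by simp
  qed
  have clt: "(\<lambda>n. (CLINT u|N. iexp (t * s n * k n u)) ^ card (A n)) \<longlonglongrightarrow> complex_of_real (exp (- (t\<^sup>2 * (f y / p * ?K2) / 2)))"
  proof (rule char_power_limit[where C="2 * B" and ?\<sigma>2.0=\<sigma>2])
    show "(\<lambda>n. t * s n) \<longlonglongrightarrow> 0" using tendsto_mult_left[OF s0, of t] by simp
    have "\<forall>\<^sub>F n in sequentially. real (card (A n)) * ((t * s n)\<^sup>2 * \<sigma>2 n) = t\<^sup>2 * (real n / real (card (A n)) * (\<sigma>2 n / h n))"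
      using cardpos
    proof eventually_elim
      case (elim n)
      have "(s n)\<^sup>2 = real n * h n / (h n * real (card (A n)))\<^sup>2" using h(1)[of n] by (simp add: s_def power_divide)
      then have "real (card (A n)) * ((t * s n)\<^sup>2 * \<sigma>2 n) =
          real (card (A n)) * (t\<^sup>2 * (real n * h n / (h n * real (card (A n)))\<^sup>2) * \<sigma>2 n)"
        by (simp only: power_mult_distrib)
      also have "\<dots> = t\<^sup>2 * (real n / real (card (A n)) * (\<sigma>2 n / h n))"
        using elim h(1)[of n] by (simp add: power2_eq_square mult_ac)
      finally show ?case .
    qed
    moreover have "(\<lambda>n. t\<^sup>2 * (real n / real (card (A n)) * (\<sigma>2 n / h n))) \<longlonglongrightarrow> t\<^sup>2 * (1 / p * (f y * ?K2))"
      by (intro tendsto_mult tendsto_const ip \<sigma>lim)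
    ultimately show "(\<lambda>n. real (card (A n)) * ((t * s n)\<^sup>2 * \<sigma>2 n)) \<longlonglongrightarrow> 2 * (t\<^sup>2 * (f y / p * ?K2) / 2)"
      by (subst tendsto_cong) auto
  qed (use kb k0 in \<open>auto simp: \<sigma>2_def\<close>)
  have U_eq: "\<forall>\<^sub>F n in sequentially. \<forall>e. U n e = s n * (\<Sum>i\<in>A n. k n (e i)) + s n * S n e"
    using cardpos
  proof eventually_elim
    case (elim n)
    show ?case
    proof
      fix e
      have "(\<Sum>i\<in>A n. k n (e i)) + S n e = (\<Sum>i\<in>A n. K ((e i + \<Delta> n i e - y) / h n)) - real (card (A n)) * (h n * fbar y (h n))"
        by (simp add: k_def S_def sum.distrib[symmetric] sum_subtractf)
      moreover have "s n * (real (card (A n)) * (h n * fbar y (h n))) = sqrt (real n * h n) * fbar y (h n)"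
        using elim h(1)[of n] by (simp add: s_def)
      ultimately show "U n e = s n * (\<Sum>i\<in>A n. k n (e i)) + s n * S n e"
        unfolding distrib_left[symmetric] by (simp add: right_diff_distrib U_def s_def)
    qed
  qed
  define \<eta>n where "\<eta>n n = h n * (\<Sum>i\<in>A n. (\<beta> n i)\<^sup>2)" for n
  define r where "r n = KL1 * F1 * (sqrt (\<eta>n n) + C * (sqrt s2 * sqrt (h n)))
      + KL1 * F2 * (\<eta>n n * (1 / sqrt (real n * h n)) + s2 * (sqrt (real n * h n) * V n))
      + sqrt (4 * L\<^sup>2 * R * F * (\<eta>n n * (1 / (real n * h n ^ 3)) + 2 * s2 * (V n / (h n)\<^sup>2)))" for n
  have r0: "r \<longlonglongrightarrow> 0"
  proof -
    note \<eta>' = \<eta>[folded \<eta>n_def]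
    have "r \<longlonglongrightarrow> KL1 * F1 * (sqrt 0 + C * (sqrt s2 * sqrt 0)) + KL1 * F2 * (0 * 0 + s2 * 0)
      + sqrt (4 * L\<^sup>2 * R * F * (0 * 0 + 2 * s2 * 0))"
      unfolding r_def by (intro tendsto_add tendsto_mult tendsto_const tendsto_real_sqrt \<eta>' h(2) nh nh3 V1 V2)
    then show ?thesis by simp
  qed
  have bound: "\<forall>\<^sub>F n in sequentially.
      cmod ((CLINT e|P. iexp (t * U n e)) - (CLINT u|N. iexp (t * s n * k n u)) ^ card (A n)) \<le> \<bar>t\<bar> * (real n / real (card (A n)) * r n)"
    using cardpos V C U_eq
  proof eventually_elim
    case (elim n)
    then have n: "0 < n" by simp
    note SR = standardized_remainder[where h="h n" and n=n and A="A n" and a="a n" and V="V n" and C=C and \<beta>="\<beta> n" and y=y,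
        OF h(1) n A a0 bspec[OF elim(2)] V0 bspec[OF elim(3)] C0]
    have SI: "integrable P (S n)" using SR(1) by (simp add: S_def[abs_def] \<Delta>_def)
    have Sb: "(\<integral>e. \<bar>S n e\<bar> \<partial>P) / sqrt (real n * h n) \<le> r n"
      using SR(2) by (simp add: S_def[abs_def] \<Delta>_def r_def \<eta>n_def)
    have eq: "t * U n e - t * s n * (\<Sum>i\<in>A n. k n (e i)) = t * s n * S n e" for e
      using elim(4) by (simp add: algebra_simps)
    have "(CLINT u|N. iexp (t * s n * k n u)) ^ card (A n) = (CLINT e|P. iexp (t * s n * (\<Sum>i\<in>A n. k n (e i))))"
      by (rule char_sum_coordinates[symmetric]) simp
    moreover have "cmod ((CLINT e|P. iexp (t * U n e)) - (CLINT e|P. iexp (t * s n * (\<Sum>i\<in>A n. k n (e i)))))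
      \<le> (\<integral>e. \<bar>t * U n e - t * s n * (\<Sum>i\<in>A n. k n (e i))\<bar> \<partial>P)"
    proof (rule P.cmod_integral_iexp_diff_le)
      show "integrable P (\<lambda>e. t * U n e - t * s n * (\<Sum>i\<in>A n. k n (e i)))" unfolding eq using SI by simp
    qed measurable
    ultimately have "cmod ((CLINT e|P. iexp (t * U n e)) - (CLINT u|N. iexp (t * s n * k n u)) ^ card (A n))
      \<le> (\<integral>e. \<bar>t * U n e - t * s n * (\<Sum>i\<in>A n. k n (e i))\<bar> \<partial>P)" by simp
    also have "\<dots> = \<bar>t\<bar> * (\<bar>s n\<bar> * (\<integral>e. \<bar>S n e\<bar> \<partial>P))"
      unfolding eq by (simp add: abs_mult mult.assoc)
    also have "\<bar>s n\<bar> * (\<integral>e. \<bar>S n e\<bar> \<partial>P) = real n / real (card (A n)) * ((\<integral>e. \<bar>S n e\<bar> \<partial>P) / sqrt (real n * h n))"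
      using s_eq[OF n] h(1)[of n] by (simp add: abs_mult)
    also have "\<bar>t\<bar> * \<dots> \<le> \<bar>t\<bar> * (real n / real (card (A n)) * r n)"
      by (intro mult_left_mono Sb) auto
    finally show ?case .
  qed
  have "(\<lambda>n. \<bar>t\<bar> * (real n / real (card (A n)) * r n)) \<longlonglongrightarrow> \<bar>t\<bar> * (1 / p * 0)"
    by (intro tendsto_mult tendsto_const ip r0)
  then have "(\<lambda>n. (CLINT e|P. iexp (t * U n e)) - (CLINT u|N. iexp (t * s n * k n u)) ^ card (A n)) \<longlonglongrightarrow> 0"
    by (intro Lim_null_comparison[OF bound]) simp
  then show ?thesis by (rule Lim_transform[OF clt])
qed

end

section \<open>Local bounds for twice differentiable functions\<close>

text \<open>The increment is telescoped over coordinates, moving along one axis at a time, so that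
  partial derivatives alone are enough. Truncating \<open>v\<close> to some coordinates does not
  increase its norm, hence the whole path stays in the ball.\<close>

lemma partial_derivatives_bound:
  fixes h :: "real ^ 'd \<Rightarrow> real" and v x :: "real ^ 'd"
  assumes D: "\<And>y i. y \<in> cball x (norm v) \<Longrightarrow> ((\<lambda>t. h (y + t *\<^sub>R axis i 1)) has_real_derivative D i y) (at 0)"
    and L: "\<And>y i. y \<in> cball x (norm v) \<Longrightarrow> \<bar>D i y\<bar> \<le> L"
  shows "\<bar>h (x + v) - h x\<bar> \<le> L * (real CARD('d) * norm v)"
proof -
  \<comment> \<open>\<open>w T\<close> is \<open>v\<close> with the coordinates outside
    \<open>T\<close> set to zero: the corner reached once the coordinates in \<open>T\<close> have
    been moved.\<close>
  define w :: "'d set \<Rightarrow> real ^ 'd" where "w T = (\<chi> i. if i \<in> T then v $ i else 0)" for T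
  have L0: "0 \<le> L" using L[of x] by (meson abs_ge_zero centre_in_cball norm_ge_zero order_trans)
  have *: "\<bar>h (x + w T) - h x\<bar> \<le> L * (\<Sum>i\<in>T. \<bar>v $ i\<bar>)" if "finite T" for T
    using that
  proof (induction T)
    case empty
    have "w {} = 0" by (simp add: w_def vec_eq_iff)
    then show ?case by simp
  next
    case (insert k T)
    define \<phi> where "\<phi> t = h (x + w T + t *\<^sub>R axis k 1)" for t
    have ins: "w (insert k T) = w T + (v $ k) *\<^sub>R axis k 1"
      using insert by (auto simp: w_def vec_eq_iff axis_def)
    have ball: "x + w T + t *\<^sub>R axis k 1 \<in> cball x (norm v)" if "t \<in> closed_segment 0 (v $ k)" for t
    proof -
      have t: "\<bar>t\<bar> \<le> \<bar>v $ k\<bar>" using that by (auto simp: closed_segment_eq_real_ivl split: if_splits)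
      have "norm (w T + t *\<^sub>R axis k 1) \<le> norm v"
        by (rule norm_le_componentwise_cart) (use t insert in \<open>auto simp: w_def axis_def\<close>)
      then show ?thesis by (subst mem_cball, subst dist_commute) (simp add: dist_norm add.assoc)
    qed
    have der: "(\<phi> has_field_derivative D k (x + w T + t *\<^sub>R axis k 1)) (at t within closed_segment 0 (v $ k))"
      if "t \<in> closed_segment 0 (v $ k)" for t
    proof -
      have "((\<lambda>s. h (x + w T + t *\<^sub>R axis k 1 + s *\<^sub>R axis k 1)) has_real_derivative D k (x + w T + t *\<^sub>R axis k 1)) (at 0)"
        by (rule D[OF ball[OF that]])
      also have "(\<lambda>s. h (x + w T + t *\<^sub>R axis k 1 + s *\<^sub>R axis k 1)) = (\<lambda>s. \<phi> (s + t))"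
        by (simp add: \<phi>_def scaleR_left_distrib algebra_simps)
      finally have "(\<phi> has_real_derivative D k (x + w T + t *\<^sub>R axis k 1)) (at (0 + t))"
        by (subst DERIV_shift)
      then show ?thesis by (simp add: has_field_derivative_at_within)
    qed
    have "norm (\<phi> (v $ k) - \<phi> 0) \<le> L * norm (v $ k - 0)"
      by (rule field_differentiable_bound[OF _ der]) (use L ball in auto)
    then have "\<bar>h (x + w (insert k T)) - h (x + w T)\<bar> \<le> L * \<bar>v $ k\<bar>"
      by (simp add: \<phi>_def ins add.assoc)
    then show ?case using insert by (simp add: distrib_left)
  qed
  have "w UNIV = v" by (simp add: w_def vec_eq_iff)
  then have "\<bar>h (x + v) - h x\<bar> \<le> L * (\<Sum>i\<in>UNIV. \<bar>v $ i\<bar>)" using *[of UNIV] by simp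
  also have "\<dots> \<le> L * (\<Sum>i\<in>(UNIV :: 'd set). norm v)"
    using L0 by (intro mult_left_mono sum_mono) (auto intro: component_le_norm_cart)
  finally show ?thesis by simp
qed

text \<open>Continuity on the compact set bounds both orders of partial derivatives. The second
  order estimate is stated as a symmetric difference because its linear parts cancel; this is the
  form that an even kernel picks up.\<close>

lemma C2_over_local_bounds:
  fixes h :: "real ^ 'd \<Rightarrow> real"
  assumes "compact S" and C2: "C2_over S h"
  obtains L where "0 \<le> L"
    "\<And>x v. cball x (norm v) \<subseteq> interior S \<Longrightarrow> \<bar>h (x + v) - h x\<bar> \<le> L * norm v"
    "\<And>x v. cball x (norm v) \<subseteq> interior S \<Longrightarrow> \<bar>h (x + v) + h (x - v) - 2 * h x\<bar> \<le> L * (norm v)\<^sup>2"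
proof -
  obtain D1 :: "'d \<Rightarrow> real ^ 'd \<Rightarrow> real" and D2 :: "'d \<Rightarrow> 'd \<Rightarrow> real ^ 'd \<Rightarrow> real" where
    c1: "\<And>i. continuous_on S (D1 i)" and c2: "\<And>i j. continuous_on S (D2 i j)"
    and d1: "\<And>x i. x \<in> interior S \<Longrightarrow> ((\<lambda>t. h (x + t *\<^sub>R axis i 1)) has_real_derivative D1 i x) (at 0)"
    and d2: "\<And>x i j. x \<in> interior S \<Longrightarrow> ((\<lambda>t. D1 i (x + t *\<^sub>R axis j 1)) has_real_derivative D2 i j x) (at 0)"
    using C2 unfolding C2_over_def by blast
  have bdd: "\<exists>B. \<forall>x\<in>S. \<bar>G x\<bar> \<le> B" if "continuous_on S G" for G :: "real ^ 'd \<Rightarrow> real"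
    using compact_imp_bounded[OF compact_continuous_image[OF that assms(1)]] by (auto simp: bounded_iff)
  obtain B1 where B1: "\<And>i x. x \<in> S \<Longrightarrow> \<bar>D1 i x\<bar> \<le> B1 i" using bdd[OF c1] by metis
  obtain B2 where B2: "\<And>i j x. x \<in> S \<Longrightarrow> \<bar>D2 i j x\<bar> \<le> B2 i j" using bdd[OF c2] by metis
  define M1 where "M1 = (\<Sum>i\<in>UNIV. \<bar>B1 i\<bar>)"
  define M2 where "M2 = (\<Sum>i\<in>UNIV. \<Sum>j\<in>UNIV. \<bar>B2 i j\<bar>)"
  have M1: "\<bar>D1 i x\<bar> \<le> M1" if "x \<in> S" for i x
  proof -
    have "\<bar>B1 i\<bar> \<le> M1" unfolding M1_def by (rule member_le_sum) auto
    then show ?thesis using B1[OF that, of i] by linarith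
  qed
  have M2: "\<bar>D2 i j x\<bar> \<le> M2" if "x \<in> S" for i j x
  proof -
    have "\<bar>B2 i j\<bar> \<le> (\<Sum>j\<in>UNIV. \<bar>B2 i j\<bar>)" by (rule member_le_sum) auto
    also have "\<dots> \<le> M2" unfolding M2_def by (rule member_le_sum[of _ _ "\<lambda>i. \<Sum>j\<in>UNIV. \<bar>B2 i j\<bar>"]) (auto intro: sum_nonneg)
    finally show ?thesis using B2[OF that, of i j] by linarith
  qed
  have M0: "0 \<le> M1" "0 \<le> M2" by (auto simp: M1_def M2_def intro!: sum_nonneg)
  let ?d = "real CARD('d)"
  have lip: "\<bar>h (x + v) - h x\<bar> \<le> M1 * (?d * norm v)" if "cball x (norm v) \<subseteq> interior S" for x v
    by (rule partial_derivatives_bound[where D=D1]) (use that d1 M1 interior_subset in blast)+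
  have lip1: "\<bar>D1 i (x + v) - D1 i x\<bar> \<le> M2 * (?d * norm v)" if "cball x (norm v) \<subseteq> interior S" for i x v
    by (rule partial_derivatives_bound[where D="D2 i"]) (use that d2 M2 interior_subset in blast)+
  have taylor: "\<bar>h (x + v) - h x - (\<Sum>i\<in>UNIV. D1 i x * v $ i)\<bar> \<le> M2 * ?d\<^sup>2 * (norm v)\<^sup>2"
    if sub: "cball x (norm v) \<subseteq> interior S" for x v
  proof -
    \<comment> \<open>Subtracting the linear part at \<open>x\<close> leaves partial derivatives
      \<open>D1 i y - D1 i x\<close>, which are already small in \<open>norm v\<close>. The first
      order bound for \<open>G\<close> is therefore a second order bound for
      \<open>h\<close>.\<close>
    define G where "G y = h y - (\<Sum>i\<in>UNIV. D1 i x * (y - x) $ i)" for y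
    have "\<bar>G (x + v) - G x\<bar> \<le> (M2 * (?d * norm v)) * (?d * norm v)"
    proof (rule partial_derivatives_bound[where D="\<lambda>i y. D1 i y - D1 i x"])
      fix y i assume y: "y \<in> cball x (norm v)"
      have E: "G (y + t *\<^sub>R axis i 1) = h (y + t *\<^sub>R axis i 1) - ((\<Sum>j\<in>UNIV. D1 j x * (y - x) $ j) + D1 i x * t)" for t
      proof -
        have "(\<Sum>j\<in>UNIV. D1 j x * (y + t *\<^sub>R axis i 1 - x) $ j) = (\<Sum>j\<in>UNIV. D1 j x * (y - x) $ j + (if j = i then D1 i x * t else 0))"
          by (intro sum.cong) (auto simp: axis_def algebra_simps)
        then show ?thesis by (simp add: G_def sum.distrib)
      qed
      show "((\<lambda>t. G (y + t *\<^sub>R axis i 1)) has_real_derivative D1 i y - D1 i x) (at 0)"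
        unfolding E using y sub by (auto intro!: derivative_eq_intros d1)
      have "\<bar>D1 i (x + (y - x)) - D1 i x\<bar> \<le> M2 * (?d * norm (y - x))"
        by (rule lip1) (use y sub in \<open>auto simp: dist_norm norm_minus_commute\<close>)
      also have "\<dots> \<le> M2 * (?d * norm v)"
        using y M0 by (intro mult_left_mono) (auto simp: dist_norm norm_minus_commute)
      finally show "\<bar>D1 i y - D1 i x\<bar> \<le> M2 * (?d * norm v)" by simp
    qed
    then show ?thesis by (simp add: G_def power2_eq_square mult_ac)
  qed
  define L where "L = M1 * ?d + 2 * (M2 * ?d\<^sup>2)"
  show ?thesis
  proof (rule that[of L])
    show "0 \<le> L" using M0 by (simp add: L_def)
    fix x v :: "real ^ 'd" assume sub: "cball x (norm v) \<subseteq> interior S"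
    have "M1 * (?d * norm v) \<le> L * norm v" using M0 by (simp add: L_def distrib_right)
    then show "\<bar>h (x + v) - h x\<bar> \<le> L * norm v" using lip[OF sub] by linarith
    have neg: "(\<Sum>i\<in>UNIV. D1 i x * (- v) $ i) = - (\<Sum>i\<in>UNIV. D1 i x * v $ i)" by (simp add: sum_negf)
    have "\<bar>h (x + v) + h (x - v) - 2 * h x\<bar> \<le> 2 * (M2 * ?d\<^sup>2 * (norm v)\<^sup>2)"
      using taylor[OF sub] taylor[of x "- v"] sub unfolding neg by simp
    also have "\<dots> \<le> L * (norm v)\<^sup>2" using M0 by (simp add: L_def distrib_right)
    finally show "\<bar>h (x + v) + h (x - v) - 2 * h x\<bar> \<le> L * (norm v)\<^sup>2" .
  qed
qed

lemma lborel_integral_affine: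
  fixes H :: "'a::euclidean_space \<Rightarrow> real"
  assumes "c \<noteq> 0" and [measurable]: "H \<in> borel_measurable borel"
  shows "(\<integral>y. H y \<partial>lborel) = \<bar>c\<bar> ^ DIM('a) * (\<integral>z. H (x + c *\<^sub>R z) \<partial>lborel)"
  by (subst lborel_affine[OF assms(1), of x]) (simp add: integral_density integral_distr)

section \<open>Kernel moments of the covariates\<close>

locale regression_design =
  fixes g m K0 :: "real ^ 'd \<Rightarrow> real" and S S0 :: "(real ^ 'd) set" and d :: nat
  assumes d: "d = CARD('d)" and g_nonneg: "\<And>x. 0 \<le> g x" and g_meas[measurable]: "g \<in> borel_measurable borel"
    and g_prob: "prob_space (density lborel g)"
    and S: "compact S" and S0: "closed S0" "S0 \<subseteq> interior S" "S0 \<noteq> {}"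
    and g_C2: "C2_over S g" and g_pos: "\<And>x. x \<in> S0 \<Longrightarrow> 0 < g x"
    and m_C2: "C2_over S m" and m_meas[measurable]: "m \<in> borel_measurable borel"
    and K0_sym: "\<And>z. K0 (- z) = K0 z" and K0_cont: "continuous_on UNIV K0"
    and K0_supp: "closure {z. K0 z \<noteq> 0} \<subseteq> cbox (\<chi> i. - 1/2) (\<chi> i. 1/2)"
    and K0_int: "(\<integral>z. K0 z \<partial>lborel) = 1"
begin

lemma K0_meas[measurable]: "K0 \<in> borel_measurable borel"
  using K0_cont by (rule borel_measurable_continuous_onI)

lemma K0_norm_ex: "\<exists>r\<ge>1. \<forall>z. r < norm z \<longrightarrow> K0 z = 0"
\<comment> \<open>On the support all coordinates are at most 1 in absolute value, so the sum norm,
  and with it the Euclidean norm, is at most the dimension.\<close>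
proof (intro exI[of _ "real CARD('d)"] conjI allI impI)
  show "1 \<le> real CARD('d)" by (simp add: Suc_leI)
  fix z :: "real ^ 'd" assume z: "real CARD('d) < norm z"
  show "K0 z = 0"
  proof (rule ccontr)
    assume "K0 z \<noteq> 0"
    then have "z \<in> closure {z. K0 z \<noteq> 0}" using closure_subset[THEN subsetD, of z "{z. K0 z \<noteq> 0}"] by simp
    from subsetD[OF K0_supp this] have "z \<in> cbox (\<chi> i. - 1/2) (\<chi> i. 1/2)" .
    then have "- 1/2 \<le> z $ i \<and> z $ i \<le> 1/2" for i by (simp add: mem_box_cart)
    then have c: "- 1/2 \<le> z $ i" "z $ i \<le> 1/2" for i by auto
    have "\<bar>z $ i\<bar> \<le> 1" for i using c[of i] by linarith
    then have "(\<Sum>i\<in>UNIV. \<bar>z $ i\<bar>) \<le> (\<Sum>i\<in>(UNIV :: 'd set). 1)" by (intro sum_mono)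
    then have "norm z \<le> real CARD('d)" using norm_le_l1_cart[of z] by simp
    then show False using z by simp
  qed
qed

definition "\<rho> = (SOME r. 1 \<le> r \<and> (\<forall>z. r < norm z \<longrightarrow> K0 z = 0))"

lemma \<rho>: "1 \<le> \<rho>" and K0_norm: "\<rho> < norm z \<Longrightarrow> K0 z = 0"
  using someI_ex[OF K0_norm_ex] unfolding \<rho>_def by auto

lemma K0_bounded: "\<exists>B>0. \<forall>z. \<bar>K0 z\<bar> \<le> B"
proof -
  have "bounded (K0 ` cball 0 \<rho>)"
    using K0_cont by (intro compact_imp_bounded compact_continuous_image) (auto intro: continuous_on_subset)
  then obtain B where "\<forall>z\<in>cball 0 \<rho>. \<bar>K0 z\<bar> \<le> B" by (auto simp: bounded_iff)
  then have B: "\<And>z. norm z \<le> \<rho> \<Longrightarrow> \<bar>K0 z\<bar> \<le> B" by simp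
  have "\<bar>K0 z\<bar> \<le> \<bar>B\<bar> + 1" for z
    using B[of z] K0_norm[of z] by (cases "norm z \<le> \<rho>") auto
  then show ?thesis by (intro exI[of _ "\<bar>B\<bar> + 1"]) auto
qed

definition "B0 = (SOME B. 0 < B \<and> (\<forall>z. \<bar>K0 z\<bar> \<le> B))"

lemma B0: "0 < B0" "\<bar>K0 z\<bar> \<le> B0"
  using someI_ex[OF K0_bounded[unfolded Bex_def]] unfolding B0_def by auto

lemma bounded_cball_integrable:
  fixes F :: "real ^ 'd \<Rightarrow> real"
  assumes [measurable]: "F \<in> borel_measurable borel"
    and "\<And>z. norm z \<le> \<rho> \<Longrightarrow> \<bar>F z\<bar> \<le> C" "\<And>z. \<rho> < norm z \<Longrightarrow> F z = 0"
  shows "integrable lborel F"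
proof (rule Bochner_Integration.integrable_bound)
  show "integrable lborel (\<lambda>z. C * indicator (cball (0 :: real ^ 'd) \<rho>) z)"
    using emeasure_compact_finite[OF compact_cball[of "0 :: real ^ 'd" \<rho>]]
    by (intro integrable_mult_right integrable_real_indicator) auto
  show "AE z in lborel. norm (F z) \<le> norm (C * indicator (cball (0 :: real ^ 'd) \<rho>) z)"
  proof (rule AE_I2)
    fix z show "norm (F z) \<le> norm (C * indicator (cball (0 :: real ^ 'd) \<rho>) z)"
      using assms(2)[of z] assms(3)[of z] by (cases "norm z \<le> \<rho>") (auto simp: indicator_def)
  qed
qed simp

definition "KK = (\<integral>z. \<bar>K0 z\<bar> \<partial>lborel)"

lemma KK: "0 \<le> KK" by (simp add: KK_def)

lemma K0_integral:
  fixes F :: "real ^ 'd \<Rightarrow> real"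
  assumes [measurable]: "F \<in> borel_measurable borel" and F: "\<And>z. norm z \<le> \<rho> \<Longrightarrow> \<bar>F z\<bar> \<le> C"
  shows "integrable lborel (\<lambda>z. K0 z * F z)" "integrable lborel (\<lambda>z. \<bar>K0 z\<bar> * F z)"
    "\<bar>\<integral>z. K0 z * F z \<partial>lborel\<bar> \<le> KK * C" "\<bar>\<integral>z. \<bar>K0 z\<bar> * F z \<partial>lborel\<bar> \<le> KK * C"
proof -
  have b: "\<bar>K0 z\<bar> * \<bar>F z\<bar> \<le> B0 * C" if "norm z \<le> \<rho>" for z
    using F[OF that] B0 less_imp_le[OF B0(1)] by (intro mult_mono) auto
  show I: "integrable lborel (\<lambda>z. K0 z * F z)" "integrable lborel (\<lambda>z. \<bar>K0 z\<bar> * F z)"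
    by (rule bounded_cball_integrable[where C="B0 * C"]; use b K0_norm in \<open>simp add: abs_mult\<close>)+
  have IK: "integrable lborel (\<lambda>z. \<bar>K0 z\<bar>)"
    by (rule bounded_cball_integrable[where C=B0]) (use B0 K0_norm in auto)
  have pw: "\<bar>K0 z\<bar> * \<bar>F z\<bar> \<le> \<bar>K0 z\<bar> * C" for z
    using F[of z] K0_norm[of z] by (cases "norm z \<le> \<rho>") (auto intro: mult_left_mono)
  have int: "(\<integral>z. \<bar>K0 z\<bar> * \<bar>F z\<bar> \<partial>lborel) \<le> KK * C"
  proof -
    have "(\<integral>z. \<bar>K0 z\<bar> * \<bar>F z\<bar> \<partial>lborel) \<le> (\<integral>z. \<bar>K0 z\<bar> * C \<partial>lborel)"
      using integrable_abs[OF I(1)] IK by (intro integral_mono pw) (auto simp: abs_mult)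
    then show ?thesis by (simp add: KK_def)
  qed
  show "\<bar>\<integral>z. K0 z * F z \<partial>lborel\<bar> \<le> KK * C" "\<bar>\<integral>z. \<bar>K0 z\<bar> * F z \<partial>lborel\<bar> \<le> KK * C"
    using int integral_abs_bound[of lborel "\<lambda>z. K0 z * F z"] integral_abs_bound[of lborel "\<lambda>z. \<bar>K0 z\<bar> * F z"]
    by (simp_all add: abs_mult)
qed

lemma K0_integrable: "integrable lborel K0"
  using K0_integral(1)[of "\<lambda>_. 1" 1] by simp

text \<open>Reflection preserves both Lebesgue measure and \<open>K0\<close>, so only the even part
  of \<open>F\<close> contributes. This yields the second order bias.\<close>

lemma K0_integral_even:
  fixes F :: "real ^ 'd \<Rightarrow> real"
  assumes [measurable]: "F \<in> borel_measurable borel" and F: "\<And>z. norm z \<le> \<rho> \<Longrightarrow> \<bar>F z\<bar> \<le> C"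
    and F2: "\<And>z. norm z \<le> \<rho> \<Longrightarrow> \<bar>F z + F (- z)\<bar> \<le> E"
  shows "\<bar>\<integral>z. K0 z * F z \<partial>lborel\<bar> \<le> KK * E"
proof -
  have refl: "(\<integral>z. K0 z * F z \<partial>lborel) = (\<integral>z. K0 z * F (- z) \<partial>lborel)"
    using lborel_integral_affine[of "-1" "\<lambda>z. K0 z * F z" 0] by (simp add: K0_sym)
  have I: "integrable lborel (\<lambda>z. K0 z * F z)" "integrable lborel (\<lambda>z. K0 z * F (- z))"
    by (rule K0_integral(1)[where C=C]; use F in simp)+
  have "2 * (\<integral>z. K0 z * F z \<partial>lborel) = (\<integral>z. K0 z * (F z + F (- z)) \<partial>lborel)"
    using refl I by (simp add: distrib_left)
  moreover have "\<bar>\<integral>z. K0 z * (F z + F (- z)) \<partial>lborel\<bar> \<le> KK * E"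
    by (rule K0_integral(3)) (use F2 in auto)
  ultimately show ?thesis by linarith
qed

section \<open>Local averages over a kernel window\<close>

definition PX :: "(real ^ 'd) measure" where "PX = density lborel (\<lambda>x. ennreal (g x))"

lemma prob_PX: "prob_space PX" using g_prob by (simp add: PX_def)

lemma sets_PX[simp, measurable_cong]: "sets PX = sets borel" by (simp add: PX_def)

lemma PX_integral:
  fixes H :: "real ^ 'd \<Rightarrow> real"
  assumes b: "0 < b" and [measurable]: "H \<in> borel_measurable borel"
  shows "(\<integral>y. H y \<partial>PX) = b ^ d * (\<integral>z. H (x + b *\<^sub>R z) * g (x + b *\<^sub>R z) \<partial>lborel)"
proof -
  have "(\<integral>y. H y \<partial>PX) = (\<integral>y. H y * g y \<partial>lborel)"
    unfolding PX_def using integral_density[of H lborel g] g_nonneg by (simp add: mult.commute)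
  also have "\<dots> = b ^ d * (\<integral>z. H (x + b *\<^sub>R z) * g (x + b *\<^sub>R z) \<partial>lborel)"
    using lborel_integral_affine[of b "\<lambda>y. H y * g y" x] b by (simp add: d)
  finally show ?thesis .
qed

text \<open>\<open>T\<close> is a neighbourhood of \<open>S0\<close> containing every point within
  kernel reach of it. Column sums of the weights are indexed by such points, which may lie outside
  \<open>S0\<close>, so the upper bound is asked on \<open>T\<close>; the lower bound is asked on
  \<open>S0\<close>, where \<open>g\<close> is bounded away from zero.\<close>

definition "moment_bounds c C T b \<longleftrightarrow>
  (\<forall>x\<in>S0. c * b ^ d \<le> (\<integral>y. K0 ((y - x) /\<^sub>R b) \<partial>PX)) \<and>
  (\<forall>x\<in>T. (\<integral>y. \<bar>K0 ((y - x) /\<^sub>R b)\<bar> \<partial>PX) \<le> C * b ^ d) \<and>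
  (\<forall>x\<in>S0. \<bar>\<integral>y. (m y - m x) * K0 ((y - x) /\<^sub>R b) \<partial>PX\<bar> \<le> C * (b ^ d * b\<^sup>2)) \<and>
  (\<forall>x\<in>S0. (\<integral>y. ((m y - m x) * K0 ((y - x) /\<^sub>R b))\<^sup>2 \<partial>PX) \<le> C * (b ^ d * b\<^sup>2)) \<and>
  (\<forall>x\<in>S0. \<forall>y. \<bar>(m y - m x) * K0 ((y - x) /\<^sub>R b)\<bar> \<le> C) \<and>
  (\<forall>x\<in>S0. \<forall>y. K0 ((y - x) /\<^sub>R b) \<noteq> 0 \<longrightarrow> y \<in> T)"

text \<open>Compactness puts a tube around \<open>S0\<close> inside the interior of the support,
  where \<open>g\<close> and \<open>m\<close> have uniform first and second order bounds. After
  rescaling the window, the bias numerator gains \<open>b\<^sup>2\<close> because its first order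
  part is odd.\<close>

theorem kernel_moments:
  obtains bs c C T where "0 < bs" "0 < c" "0 < C" "S0 \<subseteq> T" "closed T"
    "\<And>b. 0 < b \<Longrightarrow> b < bs \<Longrightarrow> moment_bounds c C T b"
proof -
  have cS0: "compact S0"
    using S0 S compact_Int_closed[of S S0] interior_subset[of S] by (simp add: Int_absorb1 subset_trans)
  obtain e where e: "0 < e" "(\<Union>x\<in>S0. cball x e) \<subseteq> interior S"
    by (rule compact_subset_open_imp_cball_epsilon_subset[OF cS0 open_interior S0(2)])
  \<comment> \<open>Half of the tube radius is used for \<open>T\<close>, and the other half is kept
    for windows around points of \<open>T\<close>.\<close>
  define T where "T = {y. infdist y S0 \<le> e / 2}"
  have T_near: "\<exists>x\<in>S0. dist y x \<le> e / 2" if "y \<in> T" for y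
  proof -
    obtain x where "x \<in> S0" "infdist y S0 = dist y x" by (rule infdist_attains_inf[OF S0(1,3)])
    then show ?thesis using that by (intro bexI[of _ x]) (simp_all add: T_def)
  qed
  have T_S0: "S0 \<subseteq> T" using e by (auto simp: T_def)
  have T_closed: "closed T"
    unfolding T_def by (intro closed_Collect_le continuous_intros)
  have near: "cball y (norm v) \<subseteq> interior S" if y: "y \<in> T" and v: "norm v \<le> e / 2" for y v :: "real ^ 'd"
  proof
    fix z assume "z \<in> cball y (norm v)"
    then have "dist y z \<le> e / 2" using v by simp
    moreover obtain x where x: "x \<in> S0" "dist y x \<le> e / 2" using T_near[OF y] by blast
    ultimately have "dist x z \<le> e" using dist_triangle[of x z y] by (simp add: dist_commute)
    then show "z \<in> interior S" 
      by (intro subsetD[OF e(2)] UN_I[OF x(1)]) simp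
  qed
  obtain Lm where Lm: "0 \<le> Lm" "\<And>x v. cball x (norm v) \<subseteq> interior S \<Longrightarrow> \<bar>m (x + v) - m x\<bar> \<le> Lm * norm v"
    "\<And>x v. cball x (norm v) \<subseteq> interior S \<Longrightarrow> \<bar>m (x + v) + m (x - v) - 2 * m x\<bar> \<le> Lm * (norm v)\<^sup>2"
    by (rule C2_over_local_bounds[OF S m_C2]) (rule that; assumption)
  obtain Lg where Lg: "0 \<le> Lg" "\<And>x v. cball x (norm v) \<subseteq> interior S \<Longrightarrow> \<bar>g (x + v) - g x\<bar> \<le> Lg * norm v"
    by (rule C2_over_local_bounds[OF S g_C2]) (rule that; assumption)
  have gc: "continuous_on S g" using g_C2 by (simp add: C2_over_def)
  obtain G where G: "0 < G" "\<And>x. x \<in> S \<Longrightarrow> g x \<le> G"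
  proof -
    have "bounded (g ` S)" using S gc by (intro compact_imp_bounded compact_continuous_image)
    then obtain G where "\<And>x. x \<in> S \<Longrightarrow> \<bar>g x\<bar> \<le> G" by (auto simp: bounded_iff)
    then have "g x \<le> \<bar>G\<bar> + 1" if "x \<in> S" for x using that by fastforce
    then show ?thesis using that[of "\<bar>G\<bar> + 1"] by auto
  qed
  obtain c0 where c0: "0 < c0" "\<And>x. x \<in> S0 \<Longrightarrow> c0 \<le> g x"
  proof -
    have "continuous_on S0 g" using gc S0(2) interior_subset by (meson continuous_on_subset subset_trans)
    then obtain x0 where "x0 \<in> S0" "\<And>x. x \<in> S0 \<Longrightarrow> g x0 \<le> g x"
      using continuous_attains_inf[OF cS0 S0(3)] by blast
    then show ?thesis using that[of "g x0"] g_pos by blast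
  qed
  \<comment> \<open>The three entries ensure \<open>b \<le> 1\<close>, windows of radius at most
    \<open>e / 2\<close>, and a kernel average of \<open>g\<close> within \<open>c0 / 2\<close> of
    its value at the centre. The added 1 keeps the last denominator positive.\<close>
  define bs where "bs = Min {1, e / (2 * \<rho>), c0 / (2 * (KK * (Lg * \<rho>) + 1))}"
  have \<rho>0: "0 < \<rho>" using \<rho> by simp
  have den: "0 < KK * (Lg * \<rho>) + 1" using KK Lg \<rho>0 by (simp add: add_nonneg_pos)
  have bs0: "0 < bs" using e(1) c0(1) \<rho>0 den by (simp add: bs_def)
  have bs: "b \<le> 1" "b * \<rho> \<le> e / 2" "b * (KK * (Lg * \<rho>)) \<le> c0 / 2" if "0 < b" "b < bs" for b
  proof -
    have "b < 1" "b < e / (2 * \<rho>)" "b < c0 / (2 * (KK * (Lg * \<rho>) + 1))" using that by (auto simp: bs_def)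
    then have "b * (2 * \<rho>) < e" "b * (2 * (KK * (Lg * \<rho>) + 1)) < c0"
      using \<rho>0 den by (simp_all add: pos_less_divide_eq)
    then show "b \<le> 1" "b * \<rho> \<le> e / 2" "b * (KK * (Lg * \<rho>)) \<le> c0 / 2" using that \<open>b < 1\<close> by (simp_all add: algebra_simps)
  qed
  have nb: "norm (b *\<^sub>R z) \<le> b * \<rho>" if "0 < b" "norm z \<le> \<rho>" for b and z :: "real ^ 'd"
    using that by simp
  have nbe: "norm (b *\<^sub>R z) \<le> e / 2" if "0 < b" "b < bs" "norm z \<le> \<rho>" for b and z :: "real ^ 'd"
    using nb[OF that(1,3)] bs(2)[OF that(1,2)] by linarith
  have inS: "x + b *\<^sub>R z \<in> S" if "0 < b" "b < bs" "x \<in> T" "norm z \<le> \<rho>" for b x z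
  proof -
    have "x + b *\<^sub>R z \<in> cball x (norm (b *\<^sub>R z))" by (simp add: dist_norm)
    then show ?thesis using near[OF that(3) nbe[OF that(1,2,4)]] interior_subset by blast
  qed
  have g_le: "\<bar>g (x + b *\<^sub>R z)\<bar> \<le> G" if "0 < b" "b < bs" "x \<in> T" "norm z \<le> \<rho>" for b x z
    using G(2)[OF inS[OF that]] g_nonneg by simp
  have m_lip: "\<bar>m (x + b *\<^sub>R z) - m x\<bar> \<le> Lm * (b * \<rho>)" "\<bar>g (x + b *\<^sub>R z) - g x\<bar> \<le> Lg * (b * \<rho>)"
    "\<bar>m (x + b *\<^sub>R z) + m (x - b *\<^sub>R z) - 2 * m x\<bar> \<le> Lm * (b * \<rho>)\<^sup>2"
    if "0 < b" "b < bs" "x \<in> T" "norm z \<le> \<rho>" for b x z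
  proof -
    note sub = near[OF that(3) nbe[OF that(1,2,4)]]
    have n: "norm (b *\<^sub>R z) \<le> b * \<rho>" using nb that by blast
    show "\<bar>m (x + b *\<^sub>R z) - m x\<bar> \<le> Lm * (b * \<rho>)"
      using Lm(2)[OF sub] mult_left_mono[OF n Lm(1)] by linarith
    show "\<bar>g (x + b *\<^sub>R z) - g x\<bar> \<le> Lg * (b * \<rho>)"
      using Lg(2)[OF sub] mult_left_mono[OF n Lg(1)] by linarith
    show "\<bar>m (x + b *\<^sub>R z) + m (x - b *\<^sub>R z) - 2 * m x\<bar> \<le> Lm * (b * \<rho>)\<^sup>2"
      using Lm(3)[OF sub] mult_left_mono[OF power_mono[OF n norm_ge_zero, of 2] Lm(1)] by linarith
  qed
  \<comment> \<open>The first term of \<open>E\<close> bounds a second difference of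
    \<open>m\<close> times \<open>g\<close>; the second bounds two products of an increment of
    \<open>m\<close> with an increment of \<open>g\<close>. The constant \<open>C\<close> below adds
    up the bounds of all clauses, plus 1 for positivity.\<close>
  define E where "E = Lm * \<rho>\<^sup>2 * G + 2 * (Lm * \<rho> * (Lg * \<rho>))"
  define C where "C = KK * G + KK * E + KK * (B0 * (Lm * \<rho>)\<^sup>2 * G) + Lm * \<rho> * B0 + 1"
  have E0: "0 \<le> E" using Lm Lg G(1) \<rho>0 by (simp add: E_def)
  have parts: "0 \<le> KK * G" "0 \<le> KK * E" "0 \<le> KK * (B0 * (Lm * \<rho>)\<^sup>2 * G)" "0 \<le> Lm * \<rho> * B0"
    using KK G(1) E0 B0(1) Lm(1) \<rho>0 by (auto intro!: mult_nonneg_nonneg)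
  show ?thesis
  proof (rule that[of bs "c0 / 2" C T])
    show "0 < bs" by (rule bs0)
    show "0 < c0 / 2" using c0 by simp
    show "0 < C" using parts by (simp add: C_def)
    show "S0 \<subseteq> T" "closed T" by (rule T_S0 T_closed)+
  next
    fix b :: real assume b: "0 < b" "b < bs"
    show "moment_bounds (c0 / 2) C T b" unfolding moment_bounds_def
    proof (intro conjI ballI allI impI)
      fix x assume x: "x \<in> S0"
      then have xT: "x \<in> T" using T_S0 by blast
      have I: "integrable lborel (\<lambda>z. K0 z * g (x + b *\<^sub>R z))"
        by (rule K0_integral(1)[where C=G]) (use g_le b xT in auto)
      have "(\<integral>z. K0 z * g (x + b *\<^sub>R z) \<partial>lborel) = g x + (\<integral>z. K0 z * (g (x + b *\<^sub>R z) - g x) \<partial>lborel)"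
        using I K0_integrable K0_int by (simp add: right_diff_distrib)
      moreover have "\<bar>\<integral>z. K0 z * (g (x + b *\<^sub>R z) - g x) \<partial>lborel\<bar> \<le> KK * (Lg * (b * \<rho>))"
        by (rule K0_integral(3)) (use m_lip(2) b xT in auto)
      moreover have "KK * (Lg * (b * \<rho>)) \<le> c0 / 2" using bs(3)[OF b] by (simp add: mult_ac)
      ultimately have "c0 / 2 \<le> (\<integral>z. K0 z * g (x + b *\<^sub>R z) \<partial>lborel)" using c0(2)[OF x] by linarith
      then have "b ^ d * (c0 / 2) \<le> b ^ d * (\<integral>z. K0 z * g (x + b *\<^sub>R z) \<partial>lborel)"
        using b by (intro mult_left_mono) auto
      also have "\<dots> = (\<integral>y. K0 ((y - x) /\<^sub>R b) \<partial>PX)"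
        using PX_integral[OF b(1), of "\<lambda>y. K0 ((y - x) /\<^sub>R b)" x] b by simp
      finally show "c0 / 2 * b ^ d \<le> (\<integral>y. K0 ((y - x) /\<^sub>R b) \<partial>PX)" by (simp add: mult.commute)
    next
      fix x assume x: "x \<in> T"
      have "(\<integral>y. \<bar>K0 ((y - x) /\<^sub>R b)\<bar> \<partial>PX) = b ^ d * (\<integral>z. \<bar>K0 z\<bar> * g (x + b *\<^sub>R z) \<partial>lborel)"
        using PX_integral[OF b(1), of "\<lambda>y. \<bar>K0 ((y - x) /\<^sub>R b)\<bar>" x] b by simp
      also have "\<dots> \<le> b ^ d * (KK * G)"
        using K0_integral(4)[of "\<lambda>z. g (x + b *\<^sub>R z)" G] g_le b x by (intro mult_left_mono) auto
      also have "\<dots> \<le> b ^ d * C" using parts b by (intro mult_left_mono) (auto simp: C_def)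
      finally show "(\<integral>y. \<bar>K0 ((y - x) /\<^sub>R b)\<bar> \<partial>PX) \<le> C * b ^ d" by (simp add: mult.commute)
    next
      fix x assume x: "x \<in> S0"
      then have xT: "x \<in> T" using T_S0 by blast
      define \<psi> where "\<psi> z = (m (x + b *\<^sub>R z) - m x) * g (x + b *\<^sub>R z)" for z
      have [measurable]: "\<psi> \<in> borel_measurable borel" unfolding \<psi>_def by measurable
      have "\<bar>\<integral>z. K0 z * \<psi> z \<partial>lborel\<bar> \<le> KK * (E * b\<^sup>2)"
      proof (rule K0_integral_even[where C="Lm * (b * \<rho>) * G"])
        fix z :: "real ^ 'd" assume z: "norm z \<le> \<rho>"
        note l = m_lip[OF b xT z] g_le[OF b xT z]
        have z': "norm (- z) \<le> \<rho>" using z by simp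
        note l' = m_lip[OF b xT z', simplified] g_le[OF b xT z', simplified]
        have p: "0 \<le> Lm * (b * \<rho>)" "0 \<le> Lg * (b * \<rho>)" using Lm Lg b \<rho>0 by auto
        have p2: "0 \<le> Lm * (b * \<rho>)\<^sup>2" using Lm by simp
        have gx: "\<bar>g x\<bar> \<le> G" using g_le[OF b xT, of 0] \<rho>0 by simp
        show "\<bar>\<psi> z\<bar> \<le> Lm * (b * \<rho>) * G"
          unfolding \<psi>_def abs_mult by (intro mult_mono l p abs_ge_zero)
        \<comment> \<open>Replacing \<open>g\<close> by its value at \<open>x\<close> isolates the
          second difference of \<open>m\<close>. What remains are products of two first order
          increments, so every term is of order \<open>b\<^sup>2\<close>.\<close>
        have eq: "\<psi> z + \<psi> (- z) = (m (x + b *\<^sub>R z) + m (x - b *\<^sub>R z) - 2 * m x) * g x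
            + (m (x + b *\<^sub>R z) - m x) * (g (x + b *\<^sub>R z) - g x) + (m (x - b *\<^sub>R z) - m x) * (g (x - b *\<^sub>R z) - g x)"
          by (simp add: \<psi>_def algebra_simps)
        have "\<bar>\<psi> z + \<psi> (- z)\<bar> \<le> \<bar>(m (x + b *\<^sub>R z) + m (x - b *\<^sub>R z) - 2 * m x) * g x\<bar>
            + \<bar>(m (x + b *\<^sub>R z) - m x) * (g (x + b *\<^sub>R z) - g x)\<bar> + \<bar>(m (x - b *\<^sub>R z) - m x) * (g (x - b *\<^sub>R z) - g x)\<bar>"
          unfolding eq by linarith
        also have "\<dots> \<le> Lm * (b * \<rho>)\<^sup>2 * G + Lm * (b * \<rho>) * (Lg * (b * \<rho>)) + Lm * (b * \<rho>) * (Lg * (b * \<rho>))"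
          unfolding abs_mult by (intro add_mono mult_mono l l' gx p p2 abs_ge_zero)
        also have "\<dots> = E * b\<^sup>2" by (simp add: E_def power2_eq_square algebra_simps)
        finally show "\<bar>\<psi> z + \<psi> (- z)\<bar> \<le> E * b\<^sup>2" .
      qed simp
      then have "\<bar>b ^ d * (\<integral>z. K0 z * \<psi> z \<partial>lborel)\<bar> \<le> b ^ d * (KK * (E * b\<^sup>2))"
        using b by (simp add: abs_mult)
      also have "\<dots> = KK * E * (b ^ d * b\<^sup>2)" by simp
      also have "\<dots> \<le> C * (b ^ d * b\<^sup>2)" using parts b by (intro mult_right_mono) (auto simp: C_def)
      also have "b ^ d * (\<integral>z. K0 z * \<psi> z \<partial>lborel) = (\<integral>y. (m y - m x) * K0 ((y - x) /\<^sub>R b) \<partial>PX)"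
        using PX_integral[OF b(1), of "\<lambda>y. (m y - m x) * K0 ((y - x) /\<^sub>R b)" x] b
        by (simp add: \<psi>_def mult_ac)
      finally show "\<bar>\<integral>y. (m y - m x) * K0 ((y - x) /\<^sub>R b) \<partial>PX\<bar> \<le> C * (b ^ d * b\<^sup>2)" .
    next
      fix x assume x: "x \<in> S0"
      then have xT: "x \<in> T" using T_S0 by blast
      \<comment> \<open>One of the two kernel factors is kept as integration weight, the other is
        absorbed here and bounded by \<open>B0\<close>.\<close>
      define \<psi> where "\<psi> z = K0 z * (m (x + b *\<^sub>R z) - m x)\<^sup>2 * g (x + b *\<^sub>R z)" for z
      have [measurable]: "\<psi> \<in> borel_measurable borel" unfolding \<psi>_def by measurable
      have "\<bar>\<integral>z. K0 z * \<psi> z \<partial>lborel\<bar> \<le> KK * (B0 * (Lm * (b * \<rho>))\<^sup>2 * G)"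
      proof (rule K0_integral(3))
        fix z :: "real ^ 'd" assume z: "norm z \<le> \<rho>"
        note l = m_lip[OF b xT z] g_le[OF b xT z]
        show "\<bar>\<psi> z\<bar> \<le> B0 * (Lm * (b * \<rho>))\<^sup>2 * G"
          unfolding \<psi>_def abs_mult using l B0 power_mono[OF l(1) abs_ge_zero, of 2] less_imp_le[OF B0(1)]
          by (intro mult_mono) auto
      qed simp
      then have "b ^ d * (\<integral>z. K0 z * \<psi> z \<partial>lborel) \<le> b ^ d * (KK * (B0 * (Lm * (b * \<rho>))\<^sup>2 * G))"
        using b by (intro mult_left_mono) auto
      also have "\<dots> = KK * (B0 * (Lm * \<rho>)\<^sup>2 * G) * (b ^ d * b\<^sup>2)" by (simp add: power_mult_distrib)
      also have "\<dots> \<le> C * (b ^ d * b\<^sup>2)" using parts b by (intro mult_right_mono) (auto simp: C_def)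
      also have "b ^ d * (\<integral>z. K0 z * \<psi> z \<partial>lborel) = (\<integral>y. ((m y - m x) * K0 ((y - x) /\<^sub>R b))\<^sup>2 \<partial>PX)"
        using PX_integral[OF b(1), of "\<lambda>y. ((m y - m x) * K0 ((y - x) /\<^sub>R b))\<^sup>2" x] b
        by (simp add: \<psi>_def power2_eq_square mult_ac)
      finally show "(\<integral>y. ((m y - m x) * K0 ((y - x) /\<^sub>R b))\<^sup>2 \<partial>PX) \<le> C * (b ^ d * b\<^sup>2)" .
    next
      fix x y assume x: "x \<in> S0"
      then have xT: "x \<in> T" using T_S0 by blast
      define z where "z = (y - x) /\<^sub>R b"
      have y: "y = x + b *\<^sub>R z" using b by (simp add: z_def)
      have "\<bar>(m y - m x) * K0 z\<bar> \<le> Lm * \<rho> * B0"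
      proof (cases "norm z \<le> \<rho>")
        case True
        have "Lm * (b * \<rho>) \<le> Lm * (1 * \<rho>)" using bs(1)[OF b] Lm(1) \<rho>0 by (intro mult_left_mono mult_right_mono) auto
        then have "\<bar>m y - m x\<bar> \<le> Lm * \<rho>" unfolding y using m_lip(1)[OF b xT True] by linarith
        then show ?thesis unfolding abs_mult using B0 Lm(1) \<rho>0 by (intro mult_mono) auto
      next
        case False
        then show ?thesis using K0_norm[of z] parts by simp
      qed
      then show "\<bar>(m y - m x) * K0 ((y - x) /\<^sub>R b)\<bar> \<le> C" using parts unfolding z_def C_def by linarith
    next
      fix x y assume x: "x \<in> S0" and K: "K0 ((y - x) /\<^sub>R b) \<noteq> 0"
      define z where "z = (y - x) /\<^sub>R b"
      have y: "y = x + b *\<^sub>R z" using b by (simp add: z_def)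
      have "norm z \<le> \<rho>" using K K0_norm[of z] by (fastforce simp: z_def)
      then have "dist y x \<le> e / 2" using nbe[OF b] by (simp add: y dist_norm)
      then show "y \<in> T" using infdist_le[OF x, of y] by (simp add: T_def)
    qed
  qed
qed

end

section \<open>Concentration for sums over a sample\<close>

text \<open>\<open>\<mu>\<close> may be any upper bound for the mean of the sum, so the lemma serves
  under one-sided moment bounds. Lower tails follow by applying it to \<open>- q\<close>.\<close>

lemma hoeffding_PiM:
  fixes q :: "'b \<Rightarrow> real"
  assumes N: "prob_space N" and [measurable]: "q \<in> borel_measurable N" and qb: "\<And>x. \<bar>q x\<bar> \<le> B" and B: "0 < B"
    and J: "finite J" "J \<noteq> {}" and \<epsilon>: "0 \<le> \<epsilon>" and \<mu>: "real (card J) * (\<integral>x. q x \<partial>N) \<le> \<mu>"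
  shows "measure (PiM UNIV (\<lambda>_::nat. N)) {w \<in> space (PiM UNIV (\<lambda>_. N)). \<mu> + \<epsilon> \<le> (\<Sum>j\<in>J. q (w j))}
    \<le> exp (- 2 * \<epsilon>\<^sup>2 / (real (card J) * (2 * B)\<^sup>2))"
proof -
  let ?P = "PiM UNIV (\<lambda>_::nat. N)"
  interpret P: prob_space ?P by (rule prob_space_PiM) (rule N)
  have ex: "(\<integral>w. q (w j) \<partial>?P) = (\<integral>x. q x \<partial>N)" for j
    using integral_PiM_component(1)[OF N refl, of q j] by simp
  interpret H: Hoeffding_ineq ?P J "\<lambda>j w. q (w j)" "\<lambda>_. - B" "\<lambda>_. B" "\<Sum>j\<in>J. \<integral>w. q (w j) \<partial>?P"
  proof unfold_locales
    show "P.indep_vars (\<lambda>_. borel) (\<lambda>j w. q (w j)) J"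
      using indep_vars_PiM_functions[OF N, of "\<lambda>_. q" J] by simp
    show "AE w in ?P. q (w i) \<in> {- B..B}" for i using qb by (auto simp: abs_le_iff minus_le_iff)
  qed (use J in auto)
  have sub: "{w \<in> space ?P. \<mu> + \<epsilon> \<le> (\<Sum>j\<in>J. q (w j))} \<subseteq>
      {w \<in> space ?P. (\<Sum>j\<in>J. \<integral>w. q (w j) \<partial>?P) + \<epsilon> \<le> (\<Sum>j\<in>J. q (w j))}"
    using \<mu> by (auto simp: ex)
  have "measure ?P {w \<in> space ?P. \<mu> + \<epsilon> \<le> (\<Sum>j\<in>J. q (w j))} \<le>
      measure ?P {w \<in> space ?P. (\<Sum>j\<in>J. \<integral>w. q (w j) \<partial>?P) + \<epsilon> \<le> (\<Sum>j\<in>J. q (w j))}"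
    by (rule P.finite_measure_mono[OF sub]) measurable
  also have "\<dots> \<le> exp (- 2 * \<epsilon>\<^sup>2 / (\<Sum>i\<in>J. (B - - B)\<^sup>2))"
    by (rule H.Hoeffding_ineq_ge) (use \<epsilon> B J in \<open>auto simp: card_gt_0_iff\<close>)
  finally show ?thesis by simp
qed

text \<open>With \<open>w i\<close> frozen the other coordinates remain independent, so each inner
  sum obeys the previous inequality; a union bound over \<open>i\<close> costs the factor
  \<open>n\<close>. The set \<open>S\<close> confines the event to centres at which the moment bound
  holds.\<close>

lemma hoeffding_pairs_PiM:
  fixes k :: "'b \<Rightarrow> 'b \<Rightarrow> real"
  assumes N: "prob_space N" and k[measurable]: "(\<lambda>(x, y). k x y) \<in> borel_measurable (N \<Otimes>\<^sub>M N)"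
    and [measurable]: "S \<in> sets N" and kb: "\<And>x y. \<bar>k x y\<bar> \<le> B" and B: "0 < B"
    and n: "2 \<le> n" and \<epsilon>: "0 \<le> \<epsilon>" and \<mu>: "\<And>x. x \<in> S \<Longrightarrow> real (n - 1) * (\<integral>y. k x y \<partial>N) \<le> \<mu>"
  defines "P \<equiv> PiM UNIV (\<lambda>_::nat. N)"
  shows "{w \<in> space P. \<exists>i\<in>{1..n}. w i \<in> S \<and> \<mu> + \<epsilon> \<le> (\<Sum>j\<in>{1..n} - {i}. k (w i) (w j))} \<in> sets P"
    and "measure P {w \<in> space P. \<exists>i\<in>{1..n}. w i \<in> S \<and> \<mu> + \<epsilon> \<le> (\<Sum>j\<in>{1..n} - {i}. k (w i) (w j))}
      \<le> real n * exp (- 2 * \<epsilon>\<^sup>2 / (real (n - 1) * (2 * B)\<^sup>2))"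
proof -
  interpret N: prob_space N by (rule N)
  interpret P: prob_space P unfolding P_def by (rule prob_space_PiM) (rule N)
  let ?e = "exp (- 2 * \<epsilon>\<^sup>2 / (real (n - 1) * (2 * B)\<^sup>2))"
  define E where "E i = {w \<in> space P. w i \<in> S \<and> \<mu> + \<epsilon> \<le> (\<Sum>j\<in>{1..n} - {i}. k (w i) (w j))}" for i
  have co[measurable]: "(\<lambda>w. w i) \<in> measurable P N" for i by (simp add: P_def)
  have [measurable]: "(\<lambda>w. k (w i) (w j)) \<in> borel_measurable P" for i j
    using measurable_compose[OF measurable_Pair[OF co[of i] co[of j]] k] by simp
  have E[measurable]: "E i \<in> sets P" for i unfolding E_def by measurable
  have un: "{w \<in> space P. \<exists>i\<in>{1..n}. w i \<in> S \<and> \<mu> + \<epsilon> \<le> (\<Sum>j\<in>{1..n} - {i}. k (w i) (w j))} = (\<Union>i\<in>{1..n}. E i)"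
    by (auto simp: E_def)
  show "{w \<in> space P. \<exists>i\<in>{1..n}. w i \<in> S \<and> \<mu> + \<epsilon> \<le> (\<Sum>j\<in>{1..n} - {i}. k (w i) (w j))} \<in> sets P"
    unfolding un by auto
  have mE: "measure P (E i) \<le> ?e" if i: "i \<in> {1..n}" for i
  proof -
    have card: "card ({1..n} - {i}) = n - 1" using i by simp
    have ne: "{1..n} - {i} \<noteq> {}" using card n by (metis card.empty diff_is_0_eq numeral_2_eq_2 not_less_eq_eq One_nat_def)
    have I: "integrable P (indicator (E i) :: _ \<Rightarrow> real)" by (rule P.integrable_const_bound[of _ 1]) (auto simp: indicator_def)
    have "measure P (E i) = (\<integral>w. indicator (E i) w \<partial>P)" by simp
    also have "\<dots> = (\<integral>t. (\<integral>w. indicator (E i) (w(i := t)) \<partial>P) \<partial>N)"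
      by (rule integral_PiM_resample(3)[OF N P_def[THEN meta_eq_to_obj_eq] I])
    also have "\<dots> \<le> (\<integral>t. ?e \<partial>N)"
    proof (rule integral_mono_AE')
      show "AE t in N. (\<integral>w. indicator (E i) (w(i := t)) \<partial>P) \<le> ?e"
      proof (rule AE_I2)
        fix t assume t: "t \<in> space N"
        show "(\<integral>w. indicator (E i) (w(i := t)) \<partial>P) \<le> ?e"
        proof (cases "t \<in> S")
          case True
          have [measurable]: "k t \<in> borel_measurable N" using measurable_compose[OF measurable_Pair1'[OF t] k] by simp
          have "(\<integral>w. (indicator (E i) (w(i := t)) :: real) \<partial>P) = (\<integral>w. indicator {w \<in> space P. \<mu> + \<epsilon> \<le> (\<Sum>j\<in>{1..n} - {i}. k t (w j))} w \<partial>P)"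
          proof (rule Bochner_Integration.integral_cong[OF refl])
            fix w assume w: "w \<in> space P"
            have "(\<Sum>j\<in>{1..n} - {i}. k ((w(i := t)) i) ((w(i := t)) j)) = (\<Sum>j\<in>{1..n} - {i}. k t (w j))"
              by (intro sum.cong) auto
            then show "indicator (E i) (w(i := t)) = (indicator {w \<in> space P. \<mu> + \<epsilon> \<le> (\<Sum>j\<in>{1..n} - {i}. k t (w j))} w :: real)"
              using w t True space_P_upd[OF N P_def[THEN meta_eq_to_obj_eq] w t, of i] by (simp add: E_def indicator_def)
          qed
          also have "\<dots> = measure P {w \<in> space P. \<mu> + \<epsilon> \<le> (\<Sum>j\<in>{1..n} - {i}. k t (w j))}"
            by (simp add: Int_absorb1 Int_def conj_commute)
          also have "\<dots> \<le> ?e"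
            using hoeffding_PiM[where q="k t" and \<mu>=\<mu>, OF N _ kb B _ ne \<epsilon>] \<mu>[OF True] card by (simp add: P_def mult.commute)
          finally show ?thesis .
        next
          case False
          then have "indicator (E i) (w(i := t)) = (0 :: real)" for w by (simp add: E_def)
          then show ?thesis by simp
        qed
      qed
    qed auto
    finally show ?thesis by (simp add: N.prob_space)
  qed
  have "measure P (\<Union>i\<in>{1..n}. E i) \<le> (\<Sum>i\<in>{1..n}. measure P (E i))"
    by (rule P.finite_measure_subadditive_finite) auto
  also have "\<dots> \<le> (\<Sum>i\<in>{1..n}. ?e)" by (intro sum_mono mE)
  also have "\<dots> = real n * ?e" by (subst sum_constant) simp
  finally show "measure P {w \<in> space P. \<exists>i\<in>{1..n}. w i \<in> S \<and> \<mu> + \<epsilon> \<le> (\<Sum>j\<in>{1..n} - {i}. k (w i) (w j))} \<le> real n * ?e"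
    unfolding un .
qed

text \<open>Variance plus squared mean: centring the summands makes the cross terms vanish, and the
  variance of one summand is at most its second moment.\<close>

lemma iid_sum_square_bound:
  fixes q :: "'b \<Rightarrow> real"
  assumes N: "prob_space N" and [measurable]: "q \<in> borel_measurable N" and qb: "\<And>x. \<bar>q x\<bar> \<le> B"
    and J: "finite J" and P: "P = PiM UNIV (\<lambda>_::nat. N)"
    and q2: "(\<integral>x. (q x)\<^sup>2 \<partial>N) \<le> c2" and q1: "\<bar>\<integral>x. q x \<partial>N\<bar> \<le> c1"
  shows "(\<integral>w. (\<Sum>j\<in>J. q (w j))\<^sup>2 \<partial>P) \<le> real (card J) * c2 + (real (card J) * c1)\<^sup>2"
proof -
  interpret N: prob_space N by (rule N)
  interpret P: prob_space P unfolding P by (rule prob_space_PiM) (rule N)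
  define \<mu> where "\<mu> = (\<integral>x. q x \<partial>N)"
  define r where "r x = q x - \<mu>" for x
  have [measurable]: "r \<in> borel_measurable N" unfolding r_def by measurable
  have q2b: "(q x)\<^sup>2 \<le> B\<^sup>2" for x using power_mono[OF qb abs_ge_zero, of x 2] by simp
  have Iq: "integrable N q" by (rule N.integrable_const_bound[of _ B]) (use qb in auto)
  have Iq2: "integrable N (\<lambda>x. (q x)\<^sup>2)" by (rule N.integrable_const_bound[of _ "B\<^sup>2"]) (use q2b in auto)
  have Ir: "(\<integral>x. r x \<partial>N) = 0" using Iq N.prob_space by (simp add: r_def \<mu>_def)
  have r2: "(r x)\<^sup>2 = (q x)\<^sup>2 - 2 * \<mu> * q x + \<mu>\<^sup>2" for x by (simp add: r_def power2_diff)
  have Ir2: "integrable N (\<lambda>x. (r x)\<^sup>2)" unfolding r2 using Iq Iq2 by simp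
  have var: "(\<integral>x. (r x)\<^sup>2 \<partial>N) \<le> c2"
  proof -
    have "(\<integral>x. (r x)\<^sup>2 \<partial>N) = (\<integral>x. (q x)\<^sup>2 \<partial>N) - \<mu>\<^sup>2"
      unfolding r2 using Iq Iq2 N.prob_space by (simp add: \<mu>_def[symmetric] power2_eq_square)
    then show ?thesis using q2 by (smt (verit) zero_le_power2)
  qed
  note SS = integral_PiM_sum_square[OF N P, of J "\<lambda>_. r", OF _ J Ir2 Ir]
  have SI: "integrable P (\<lambda>w. (\<Sum>j\<in>J. r (w j))\<^sup>2)" by (rule SS(1)) simp
  have SE: "(\<integral>w. (\<Sum>j\<in>J. r (w j))\<^sup>2 \<partial>P) = real (card J) * (\<integral>x. (r x)\<^sup>2 \<partial>N)" by (subst SS(2)) simp_all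
  have co[measurable]: "(\<lambda>w. w i) \<in> measurable P N" for i by (simp add: P)
  have SL: "integrable P (\<lambda>w. \<Sum>j\<in>J. r (w j))" by (rule P.expectation_abs_le_sqrt(1)[OF _ SI]) measurable
  have rI: "integrable P (\<lambda>w. r (w j))" "(\<integral>w. r (w j) \<partial>P) = 0" for j
  proof -
    have "integrable N r" unfolding r_def[abs_def] using Iq by simp
    then show "integrable P (\<lambda>w. r (w j))" "(\<integral>w. r (w j) \<partial>P) = 0"
      using integral_PiM_component[OF N P, of r j] Ir by simp_all
  qed
  have S0: "(\<integral>w. (\<Sum>j\<in>J. r (w j)) \<partial>P) = 0" using rI by (subst Bochner_Integration.integral_sum) auto
  have eq: "(\<Sum>j\<in>J. q (w j))\<^sup>2 = (\<Sum>j\<in>J. r (w j))\<^sup>2 + 2 * (real (card J) * \<mu>) * (\<Sum>j\<in>J. r (w j)) + (real (card J) * \<mu>)\<^sup>2" for w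
  proof -
    have "(\<Sum>j\<in>J. q (w j)) = (\<Sum>j\<in>J. r (w j)) + real (card J) * \<mu>" by (simp add: r_def sum_subtractf)
    then show ?thesis by (simp add: power2_sum)
  qed
  have "(\<integral>w. (\<Sum>j\<in>J. q (w j))\<^sup>2 \<partial>P) = real (card J) * (\<integral>x. (r x)\<^sup>2 \<partial>N) + (real (card J) * \<mu>)\<^sup>2"
    unfolding eq using SI SL SE S0 P.prob_space by simp
  also have "\<dots> \<le> real (card J) * c2 + (real (card J) * c1)\<^sup>2"
  proof (intro add_mono mult_left_mono var)
    have "\<bar>real (card J) * \<mu>\<bar> \<le> real (card J) * c1" using q1 by (simp add: abs_mult \<mu>_def mult_left_mono)
    from power_mono[OF this abs_ge_zero, of 2] show "(real (card J) * \<mu>)\<^sup>2 \<le> (real (card J) * c1)\<^sup>2" by simp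
  qed simp
  finally show ?thesis .
qed

text \<open>Freezing \<open>w i\<close> reduces each inner sum to the independent case. Only the sum
  over \<open>i\<close> is controlled, which is all that the bias condition asks for.\<close>

lemma pair_sum_square_bound:
  fixes k :: "'b \<Rightarrow> 'b \<Rightarrow> real"
  assumes N: "prob_space N" and k[measurable]: "(\<lambda>(x, y). k x y) \<in> borel_measurable (N \<Otimes>\<^sub>M N)"
    and kb: "\<And>x y. \<bar>k x y\<bar> \<le> B" and P: "P = PiM UNIV (\<lambda>_::nat. N)"
    and k2: "\<And>x. (\<integral>y. (k x y)\<^sup>2 \<partial>N) \<le> c2" and k1: "\<And>x. \<bar>\<integral>y. k x y \<partial>N\<bar> \<le> c1"
  shows "integrable P (\<lambda>w. \<Sum>i\<in>{1..n}. (\<Sum>j\<in>{1..n} - {i}. k (w i) (w j))\<^sup>2)"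
    and "(\<integral>w. (\<Sum>i\<in>{1..n}. (\<Sum>j\<in>{1..n} - {i}. k (w i) (w j))\<^sup>2) \<partial>P) \<le> real n * (real n * c2 + (real n * c1)\<^sup>2)"
proof -
  interpret N: prob_space N by (rule N)
  interpret P: prob_space P unfolding P by (rule prob_space_PiM) (rule N)
  have co[measurable]: "(\<lambda>w. w i) \<in> measurable P N" for i by (simp add: P)
  have [measurable]: "(\<lambda>w. k (w i) (w j)) \<in> borel_measurable P" for i j
    using measurable_compose[OF measurable_Pair[OF co[of i] co[of j]] k] by simp
  define F where "F i w = (\<Sum>j\<in>{1..n} - {i}. k (w i) (w j))\<^sup>2" for i w
  have c: "0 \<le> c2" "0 \<le> c1"
    using order_trans[OF integral_nonneg_AE k2[of undefined]] order_trans[OF abs_ge_zero k1[of undefined]] by auto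
  have FI: "integrable P (F i)" for i
  proof (rule P.integrable_const_bound[of _ "(real (card ({1..n} - {i})) * B)\<^sup>2"])
    show "AE w in P. norm (F i w) \<le> (real (card ({1..n} - {i})) * B)\<^sup>2"
    proof (rule AE_I2)
      fix w
      have "\<bar>\<Sum>j\<in>{1..n} - {i}. k (w i) (w j)\<bar> \<le> (\<Sum>j\<in>{1..n} - {i}. B)"
        by (rule order_trans[OF sum_abs]) (intro sum_mono kb)
      then have "\<bar>\<Sum>j\<in>{1..n} - {i}. k (w i) (w j)\<bar> \<le> real (card ({1..n} - {i})) * B" by (simp only: sum_constant)
      from power_mono[OF this abs_ge_zero, of 2] show "norm (F i w) \<le> (real (card ({1..n} - {i})) * B)\<^sup>2"
        by (simp only: F_def power2_abs real_norm_def abs_power2)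
    qed
    show "F i \<in> borel_measurable P" unfolding F_def by measurable
  qed
  show "integrable P (\<lambda>w. \<Sum>i\<in>{1..n}. (\<Sum>j\<in>{1..n} - {i}. k (w i) (w j))\<^sup>2)"
    unfolding F_def[symmetric] by (intro Bochner_Integration.integrable_sum FI)
  have FE: "(\<integral>w. F i w \<partial>P) \<le> real n * c2 + (real n * c1)\<^sup>2" if i: "i \<in> {1..n}" for i
  proof -
    have card: "card ({1..n} - {i}) \<le> n" using i by simp
    have "(\<integral>w. F i w \<partial>P) = (\<integral>t. (\<integral>w. F i (w(i := t)) \<partial>P) \<partial>N)"
      by (rule integral_PiM_resample(3)[OF N P FI])
    also have "\<dots> \<le> (\<integral>t. real n * c2 + (real n * c1)\<^sup>2 \<partial>N)"
    proof (rule integral_mono_AE')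
      show "AE t in N. (\<integral>w. F i (w(i := t)) \<partial>P) \<le> real n * c2 + (real n * c1)\<^sup>2"
      proof (rule AE_I2)
        fix t assume t: "t \<in> space N"
        have km: "k t \<in> borel_measurable N" using measurable_compose[OF measurable_Pair1'[OF t] k] by simp
        have "F i (w(i := t)) = (\<Sum>j\<in>{1..n} - {i}. k t (w j))\<^sup>2" for w
          unfolding F_def by (intro arg_cong[where f="\<lambda>x. x\<^sup>2"] sum.cong) auto
        then have "(\<integral>w. F i (w(i := t)) \<partial>P) = (\<integral>w. (\<Sum>j\<in>{1..n} - {i}. k t (w j))\<^sup>2 \<partial>P)" by simp
        also have "\<dots> \<le> real (card ({1..n} - {i})) * c2 + (real (card ({1..n} - {i})) * c1)\<^sup>2"
          by (rule iid_sum_square_bound[OF N km kb _ P k2 k1]) simp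
        also have "\<dots> \<le> real n * c2 + (real n * c1)\<^sup>2"
          using card c by (intro add_mono mult_right_mono power_mono) auto
        finally show "(\<integral>w. F i (w(i := t)) \<partial>P) \<le> real n * c2 + (real n * c1)\<^sup>2" .
      qed
    qed (use c in auto)
    finally show ?thesis by (simp add: N.prob_space)
  qed
  have "(\<integral>w. (\<Sum>i\<in>{1..n}. F i w) \<partial>P) = (\<Sum>i\<in>{1..n}. \<integral>w. F i w \<partial>P)"
    using FI by (intro Bochner_Integration.integral_sum)
  also have "\<dots> \<le> (\<Sum>i\<in>{1..n}. real n * c2 + (real n * c1)\<^sup>2)" by (intro sum_mono FE)
  finally show "(\<integral>w. (\<Sum>i\<in>{1..n}. (\<Sum>j\<in>{1..n} - {i}. k (w i) (w j))\<^sup>2) \<partial>P) \<le> real n * (real n * c2 + (real n * c1)\<^sup>2)"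
    unfolding F_def by simp
qed

section \<open>Designs that are good with high probability\<close>

text \<open>\<open>b\<close> and \<open>h\<close> are the bandwidths of the regression and of the
  density estimator.\<close>

locale regression_asymptotics = regression_design g m K0 S S0 d
  for g m K0 :: "real ^ 'd \<Rightarrow> real" and S S0 :: "(real ^ 'd) set" and d :: nat +
  fixes b h :: "nat \<Rightarrow> real"
  assumes b: "\<And>n. 0 < b n" "b \<longlonglongrightarrow> 0" and h: "\<And>n. 0 < h n" "h \<longlonglongrightarrow> 0"
    and b_log: "filterlim (\<lambda>n. real n * b n ^ max (d + 2) (2 * d) / ln (real n)) at_top sequentially"
    and nb4h: "(\<lambda>n. real n * b n ^ 4 * h n) \<longlonglongrightarrow> 0"
    and nbh3: "filterlim (\<lambda>n. real n * b n ^ d * h n ^ 3) at_top sequentially"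
begin

section \<open>Consequences of the bandwidth conditions\<close>

lemma ev_small: "\<forall>\<^sub>F n in sequentially. b n < 1 \<and> h n < 1 \<and> 3 \<le> n"
proof -
  have "\<forall>\<^sub>F n in sequentially. b n < 1" "\<forall>\<^sub>F n in sequentially. h n < 1"
    by (rule order_tendstoD(2)[OF b(2)] order_tendstoD(2)[OF h(2)]; simp)+
  then show ?thesis using eventually_ge_at_top[of 3] by eventually_elim auto
qed

lemma ln_ge_1: "3 \<le> n \<Longrightarrow> 1 \<le> ln (real n)"
  using exp_le by (subst ln_ge_iff) auto

lemma nb_log: "filterlim (\<lambda>n. real n * b n ^ (2 * d) / ln (real n)) at_top sequentially"
proof (rule filterlim_at_top_mono[OF b_log])
  show "\<forall>\<^sub>F n in sequentially. real n * b n ^ max (d + 2) (2 * d) / ln (real n)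
      \<le> real n * b n ^ (2 * d) / ln (real n)"
    using ev_small
  proof eventually_elim
    case (elim n)
    then have "b n ^ max (d + 2) (2 * d) \<le> b n ^ (2 * d)"
      using b(1)[of n] by (intro power_decreasing) auto
    then show ?case using ln_ge_1[of n] elim by (intro divide_right_mono mult_left_mono) auto
  qed
qed

lemma nb_at_top:
  assumes "k \<le> max (d + 2) (2 * d)"
  shows "filterlim (\<lambda>n. real n * b n ^ k) at_top sequentially"
proof (rule filterlim_at_top_mono[OF b_log])
  show "\<forall>\<^sub>F n in sequentially. real n * b n ^ max (d + 2) (2 * d) / ln (real n) \<le> real n * b n ^ k"
    using ev_small
  proof eventually_elim
    case (elim n)
    have "real n * b n ^ max (d + 2) (2 * d) / ln (real n) \<le> real n * b n ^ max (d + 2) (2 * d) / 1"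
      using ln_ge_1[of n] elim b(1)[of n] by (intro divide_left_mono) auto
    also have "\<dots> \<le> real n * b n ^ k"
      using b(1)[of n] elim assms by (auto intro!: mult_left_mono power_decreasing)
    finally show ?case .
  qed
qed

lemma inverse_tendsto_0: "filterlim F at_top sequentially \<Longrightarrow> (\<lambda>n. 1 / F n) \<longlonglongrightarrow> (0 :: real)"
  using tendsto_inverse_0_at_top[of F sequentially] by (simp add: inverse_eq_divide)

text \<open>The variance part of the mean squared bias. This is where the exponent
  \<open>d + 2\<close> in the first bandwidth condition is used.\<close>

lemma rate_bias: "(\<lambda>n. h n * (b n)\<^sup>2 / b n ^ d) \<longlonglongrightarrow> 0"
proof -
  have "(\<lambda>n. (real n * b n ^ 4 * h n) * (1 / (real n * b n ^ (d + 2)))) \<longlonglongrightarrow> 0 * 0"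
    by (intro tendsto_mult nb4h inverse_tendsto_0 nb_at_top) auto
  moreover have "\<forall>\<^sub>F n in sequentially. (real n * b n ^ 4 * h n) * (1 / (real n * b n ^ (d + 2))) = h n * (b n)\<^sup>2 / b n ^ d"
    using ev_small
  proof eventually_elim
    case (elim n)
    then show ?case using b(1)[of n] by (simp add: power_add power2_eq_square power4_eq_xxxx)
  qed
  ultimately show ?thesis by (subst (asm) tendsto_cong) auto
qed

lemma rate_h3: "filterlim (\<lambda>n. real n * h n ^ 3) at_top sequentially"
proof (rule filterlim_at_top_mono[OF nbh3])
  show "\<forall>\<^sub>F n in sequentially. real n * b n ^ d * h n ^ 3 \<le> real n * h n ^ 3"
    using ev_small
  proof eventually_elim
    case (elim n)
    then have "b n ^ d \<le> 1" using b(1)[of n] by (intro power_le_one) auto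
    then have "real n * b n ^ d \<le> real n * 1" by (intro mult_left_mono) auto
    then show ?case using h(1)[of n] by (intro mult_right_mono) auto
  qed
qed

lemma rate_h: "(\<lambda>n. 1 / sqrt (real n * h n)) \<longlonglongrightarrow> 0"
proof (rule inverse_tendsto_0)
  have "filterlim (\<lambda>n. real n * h n) at_top sequentially"
  proof (rule filterlim_at_top_mono[OF rate_h3])
    show "\<forall>\<^sub>F n in sequentially. real n * h n ^ 3 \<le> real n * h n"
      using ev_small
    proof eventually_elim
      case (elim n)
      have "h n ^ 3 \<le> h n ^ 1" using h(1)[of n] elim by (intro power_decreasing) auto
      then show ?case by (intro mult_left_mono) auto
    qed
  qed
  then show "filterlim (\<lambda>n. sqrt (real n * h n)) at_top sequentially" by (rule filterlim_compose[OF sqrt_at_top])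
qed

lemma rate_h2: "(\<lambda>n. 1 / (real n * b n ^ d * (h n)\<^sup>2)) \<longlonglongrightarrow> 0"
proof (rule inverse_tendsto_0, rule filterlim_at_top_mono[OF nbh3])
  show "\<forall>\<^sub>F n in sequentially. real n * b n ^ d * h n ^ 3 \<le> real n * b n ^ d * (h n)\<^sup>2"
    using ev_small
  proof eventually_elim
    case (elim n)
    have "h n ^ 3 \<le> (h n)\<^sup>2" using h(1)[of n] elim by (intro power_decreasing) auto
    then show ?case using b(1)[of n] by (intro mult_left_mono) auto
  qed
qed

text \<open>The noise part of the quadratic remainder. Its square is
  \<open>h / (n * b ^ (2 * d))\<close>, so the exponent \<open>2 * d\<close> is the relevant
  one.\<close>

lemma rate_sqrt: "(\<lambda>n. sqrt (real n * h n) * (1 / (real n * b n ^ d))) \<longlonglongrightarrow> 0"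
proof -
  have "(\<lambda>n. sqrt (h n * (1 / (real n * b n ^ (2 * d))))) \<longlonglongrightarrow> sqrt (0 * 0)"
    by (intro tendsto_real_sqrt tendsto_mult h inverse_tendsto_0 nb_at_top) auto
  moreover have "\<forall>\<^sub>F n in sequentially. sqrt (h n * (1 / (real n * b n ^ (2 * d)))) = sqrt (real n * h n) * (1 / (real n * b n ^ d))"
    using ev_small
  proof eventually_elim
    case (elim n)
    have p: "0 < real n * b n ^ d" using elim b(1)[of n] by simp
    have "h n * (1 / (real n * b n ^ (2 * d))) = real n * h n / (real n * b n ^ d)\<^sup>2"
      using elim b(1)[of n] by (simp add: power_mult_distrib power_mult[symmetric] power2_eq_square[of "real n"] mult.commute)
    then show ?case using p by (simp add: real_sqrt_divide)
  qed
  ultimately show ?thesis by (subst (asm) tendsto_cong) auto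
qed

text \<open>Hoeffding's exponent for a deviation of order \<open>n * b ^ d\<close> in a sum of
  \<open>n\<close> bounded terms is \<open>n * b ^ (2 * d)\<close>. The logarithm in the bandwidth
  condition makes it exceed \<open>2 * ln n\<close>, which pays for the union bound over the
  sample.\<close>

lemma rate_exp:
  assumes "0 < \<kappa>"
  shows "(\<lambda>n. real n * exp (- (\<kappa> * (real n * b n ^ (2 * d))))) \<longlonglongrightarrow> 0"
proof (rule tendsto_sandwich[of "\<lambda>_. 0" _ _ "\<lambda>n. 1 / real n"])
  have "\<forall>\<^sub>F n in sequentially. 2 / \<kappa> \<le> real n * b n ^ (2 * d) / ln (real n)"
    using nb_log by (auto simp: filterlim_at_top)
  then show "\<forall>\<^sub>F n in sequentially. real n * exp (- (\<kappa> * (real n * b n ^ (2 * d)))) \<le> 1 / real n"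
    using ev_small
  proof eventually_elim
    case (elim n)
    have l: "0 < ln (real n)" using ln_ge_1[of n] elim by simp
    have "2 * ln (real n) \<le> \<kappa> * (real n * b n ^ (2 * d))"
      using elim(1) l assms by (simp add: field_simps)
    then have "exp (- (\<kappa> * (real n * b n ^ (2 * d)))) \<le> exp (- (2 * ln (real n)))" by simp
    also have "\<dots> = 1 / (real n)\<^sup>2" using elim by (simp add: exp_minus exp_double inverse_eq_divide)
    finally have "real n * exp (- (\<kappa> * (real n * b n ^ (2 * d)))) \<le> real n * (1 / (real n)\<^sup>2)" by (intro mult_left_mono) auto
    also have "\<dots> = 1 / real n" by (simp add: power2_eq_square)
    finally show ?case .
  qed
  show "(\<lambda>n. 1 / real n) \<longlonglongrightarrow> 0" by (rule lim_1_over_n)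
qed auto

section \<open>The random design and its kernel sums\<close>

abbreviation "PXs \<equiv> PiM UNIV (\<lambda>_::nat. PX)"
definition "p0 = measure PX S0"

sublocale PXs: prob_space PXs by (rule prob_space_PiM) (rule prob_PX)

lemma PXs_coord[measurable]: "(\<lambda>w. w i) \<in> measurable PXs borel"
  using measurable_component_singleton[of i UNIV "\<lambda>_. PX"] measurable_cong_sets[OF refl sets_PX] by simp

lemma S0_sets[measurable]: "S0 \<in> sets borel" using S0(1) by simp

definition "kern n x y = K0 ((y - x) /\<^sub>R b n)"
text \<open>Cut off outside \<open>S0\<close> so that the moment bounds hold for every centre, as
  \<open>pair_sum_square_bound\<close> requires. For centres in \<open>S0\<close> it is the
  numerator of the smoothing bias.\<close>

definition "bias_num n x y = (if x \<in> S0 then (m y - m x) * kern n x y else 0)"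

lemma kern_meas: "(\<lambda>(x, y). kern n x y) \<in> borel_measurable (borel \<Otimes>\<^sub>M borel)"
  unfolding kern_def by measurable

lemma bias_num_meas: "(\<lambda>(x, y). bias_num n x y) \<in> borel_measurable (borel \<Otimes>\<^sub>M borel)"
  unfolding bias_num_def kern_def by measurable

lemma PX_pair_sets: "sets (PX \<Otimes>\<^sub>M PX) = sets (borel \<Otimes>\<^sub>M borel)" by (intro sets_pair_measure_cong) auto

lemma meas_PX_pair: "measurable (PX \<Otimes>\<^sub>M PX) L = measurable (borel \<Otimes>\<^sub>M borel) L"
  by (rule measurable_cong_sets[OF PX_pair_sets refl])

lemma meas_PX: "measurable PX L = measurable borel L" by (rule measurable_cong_sets) auto

text \<open>
  \<open>eff n\<close> is the order of the number of sample points in a kernel window.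
\<close>

definition "eff n = real n * b n ^ d"
definition "inner_ix n w = {i\<in>{1..n}. w i \<in> S0}"
definition "denom n w i = (\<Sum>j\<in>{1..n} - {i}. kern n (w i) (w j))"
definition "abs_denom n w i = (\<Sum>j\<in>{1..n} - {i}. \<bar>kern n (w i) (w j)\<bar>)"
definition "bias_sum n w i = (\<Sum>j\<in>{1..n} - {i}. bias_num n (w i) (w j))"

text \<open>These are the design conditions of \<open>fixed_design_limit\<close> before division by
  the denominators: once those are at least \<open>c * eff n\<close>, the third clause bounds
  \<open>h\<close> times the summed squared bias by a multiple of \<open>\<zeta>\<close>.\<close>

definition "good_design c C \<zeta> n w \<longleftrightarrow>
  (\<forall>i\<in>inner_ix n w. c * eff n \<le> denom n w i \<and> abs_denom n w i \<le> C * eff n) \<and>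
  (\<forall>j\<in>{1..n}. (\<Sum>i\<in>inner_ix n w - {j}. \<bar>kern n (w i) (w j)\<bar>) \<le> C * eff n) \<and>
  h n * (\<Sum>i\<in>{1..n}. (bias_sum n w i)\<^sup>2) \<le> \<zeta> * (eff n)\<^sup>2 \<and>
  \<bar>real (card (inner_ix n w)) / real n - p0\<bar> \<le> \<zeta>"

text \<open>\<open>G n\<close> is the complement of five exceptional events, one for each estimate
  in the definition and two for the fraction of inner points. It is built explicitly so that it is
  measurable; goodness is then only claimed on it.\<close>

theorem good_designs:
  obtains c C \<zeta> G where "0 < c" "0 < C" "\<zeta> \<longlonglongrightarrow> 0"
    "\<And>n. G n \<in> sets PXs" "(\<lambda>n. measure PXs (space PXs - G n)) \<longlonglongrightarrow> 0"
    "\<forall>\<^sub>F n in sequentially. \<forall>w\<in>G n. good_design c C (\<zeta> n) n w"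
proof -
  obtain bs c C T where bs: "0 < bs" and c: "0 < c" and C: "0 < C" and T: "S0 \<subseteq> T" "closed T"
    and mom: "\<And>b. 0 < b \<Longrightarrow> b < bs \<Longrightarrow> moment_bounds c C T b"
    by (rule kernel_moments) (rule that; assumption)
  have ev: "\<forall>\<^sub>F n in sequentially. b n < bs \<and> 3 \<le> n"
    using order_tendstoD(2)[OF b(2) bs] eventually_ge_at_top[of 3] by eventually_elim auto
  have low: "c * b n ^ d \<le> (\<integral>y. kern n x y \<partial>PX)"
    and b1: "\<bar>\<integral>y. (m y - m x) * kern n x y \<partial>PX\<bar> \<le> C * (b n ^ d * (b n)\<^sup>2)"
    and b2: "(\<integral>y. ((m y - m x) * kern n x y)\<^sup>2 \<partial>PX) \<le> C * (b n ^ d * (b n)\<^sup>2)"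
    and bb: "\<And>y. \<bar>(m y - m x) * kern n x y\<bar> \<le> C" and nearT: "\<And>y. kern n x y \<noteq> 0 \<Longrightarrow> y \<in> T"
    if "b n < bs" "x \<in> S0" for n x
    using mom[OF b(1)[of n] that(1)] that(2) by (auto simp: moment_bounds_def kern_def)
  have up: "(\<integral>y. \<bar>kern n x y\<bar> \<partial>PX) \<le> C * b n ^ d" if "b n < bs" "x \<in> T" for n x
    using mom[OF b(1)[of n] that(1)] that(2) by (auto simp: moment_bounds_def kern_def)
  have [measurable]: "T \<in> sets borel" using T by simp
  let ?\<beta> = "\<lambda>n. b n ^ d"
  have \<beta>: "0 < ?\<beta> n" for n using b(1)[of n] by simp
  have [measurable]: "(\<lambda>w. kern n (w i) (w j)) \<in> borel_measurable PXs" "(\<lambda>w. bias_num n (w i) (w j)) \<in> borel_measurable PXs" for n i j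
    using measurable_compose[OF measurable_Pair[OF PXs_coord[of i] PXs_coord[of j]] kern_meas[of n]]
      measurable_compose[OF measurable_Pair[OF PXs_coord[of i] PXs_coord[of j]] bias_num_meas[of n]] by simp_all
  \<comment> \<open>The rate n^(-1/4) tends to zero while
    \<open>n * (\<tau> n)\<^sup>2 = sqrt n\<close> still drives Hoeffding's bound to zero.\<close>
  define \<tau> where "\<tau> n = 1 / sqrt (sqrt (real n))" for n :: nat
  \<comment> \<open>A bound for the mean of \<open>h n * Q n\<close> relative to
    \<open>(eff n)\<^sup>2\<close>. Markov's inequality at level \<open>sqrt (\<xi> n)\<close>
    leaves probability at most \<open>sqrt (\<xi> n)\<close>, so level and probability vanish
    together.\<close>
  define \<xi> where "\<xi> n = C * (h n * (b n)\<^sup>2 / ?\<beta> n) + C\<^sup>2 * (real n * b n ^ 4 * h n)" for n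
  define \<zeta> where "\<zeta> n = sqrt (\<xi> n) + \<tau> n" for n
  define Q where "Q n w = (\<Sum>i\<in>{1..n}. (bias_sum n w i)\<^sup>2)" for n w
  \<comment> \<open>The denominator has mean at least \<open>(n - 1) * c * b ^ d\<close>; the event
    is a drop to half of this. Since \<open>K0\<close> may change sign, even positivity of the
    denominator has to come from concentration.\<close>
  define Ba where "Ba n = {w \<in> space PXs. \<exists>i\<in>{1..n}. w i \<in> S0 \<and>
      - (real (n - 1) * (c * ?\<beta> n)) + real (n - 1) * (c / 2 * ?\<beta> n) \<le> (\<Sum>j\<in>{1..n} - {i}. - kern n (w i) (w j))}" for n
  define Bb where "Bb n = {w \<in> space PXs. \<exists>i\<in>{1..n}. w i \<in> T \<and>
      real (n - 1) * (C * ?\<beta> n) + real (n - 1) * (C * ?\<beta> n) \<le> (\<Sum>j\<in>{1..n} - {i}. \<bar>kern n (w i) (w j)\<bar>)}" for n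
  define Bc where "Bc n = {w \<in> space PXs. sqrt (\<xi> n) * (real n * ?\<beta> n)\<^sup>2 \<le> h n * Q n w}" for n
  define Bd where "Bd n = {w \<in> space PXs. real n * p0 + real n * \<tau> n \<le> (\<Sum>i\<in>{1..n}. indicator S0 (w i))}" for n
  define Be where "Be n = {w \<in> space PXs. - (real n * p0) + real n * \<tau> n \<le> (\<Sum>i\<in>{1..n}. - indicator S0 (w i))}" for n
  have [measurable]: "Ba n \<in> sets PXs" "Bb n \<in> sets PXs" "Bc n \<in> sets PXs" "Bd n \<in> sets PXs" "Be n \<in> sets PXs" for n
    unfolding Ba_def Bb_def Bc_def Bd_def Be_def Q_def bias_sum_def by measurable
  define G where "G n = space PXs - (Ba n \<union> Bb n \<union> Bc n \<union> Bd n \<union> Be n)" for n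
  have Gsets: "G n \<in> sets PXs" for n unfolding G_def by measurable
  have \<xi>lim: "\<xi> \<longlonglongrightarrow> 0"
    unfolding \<xi>_def using tendsto_add[OF tendsto_mult_left[OF rate_bias, of C] tendsto_mult_left[OF nb4h, of "C\<^sup>2"]] by simp
  have \<xi>0: "0 < \<xi> n" if "3 \<le> n" for n
    using C h(1)[of n] b(1)[of n] that by (simp add: \<xi>_def add_pos_nonneg)
  have \<tau>lim: "\<tau> \<longlonglongrightarrow> 0"
    unfolding \<tau>_def by (intro inverse_tendsto_0 filterlim_compose[OF sqrt_at_top] filterlim_real_sequentially)
  have \<zeta>lim: "\<zeta> \<longlonglongrightarrow> 0"
    unfolding \<zeta>_def using tendsto_add[OF tendsto_real_sqrt[OF \<xi>lim] \<tau>lim] by simp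
  have hoeff: "(\<lambda>n. real n * exp (- 2 * (real (n - 1) * (a * ?\<beta> n))\<^sup>2 / (real (n - 1) * (2 * B0)\<^sup>2))) \<longlonglongrightarrow> 0" if a: "0 < a" for a
  proof (rule tendsto_sandwich[of "\<lambda>_. 0" _ _ "\<lambda>n. real n * exp (- (a\<^sup>2 / (4 * B0\<^sup>2) * (real n * b n ^ (2 * d))))"])
    show "(\<lambda>n. real n * exp (- (a\<^sup>2 / (4 * B0\<^sup>2) * (real n * b n ^ (2 * d))))) \<longlonglongrightarrow> 0"
      using a B0(1) by (intro rate_exp) auto
    show "\<forall>\<^sub>F n in sequentially. real n * exp (- 2 * (real (n - 1) * (a * ?\<beta> n))\<^sup>2 / (real (n - 1) * (2 * B0)\<^sup>2))
        \<le> real n * exp (- (a\<^sup>2 / (4 * B0\<^sup>2) * (real n * b n ^ (2 * d))))"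
      using ev
    proof eventually_elim
      case (elim n)
      \<comment> \<open>The number of summands after leaving one out; \<open>n \<le> 2 * N1\<close>
        absorbs the difference.\<close>
      define N1 where "N1 = real (n - 1)"
      have N1: "0 < N1" "real n \<le> 2 * N1" using elim by (auto simp: N1_def)
      have p: "b n ^ (2 * d) = (?\<beta> n)\<^sup>2" by (simp add: power_mult[symmetric] mult.commute)
      have "2 * (N1 * (a * ?\<beta> n))\<^sup>2 / (N1 * (2 * B0)\<^sup>2) = a\<^sup>2 / (4 * B0\<^sup>2) * ((2 * N1) * (?\<beta> n)\<^sup>2)"
        using N1 B0(1) by (simp add: power2_eq_square)
      moreover have "a\<^sup>2 / (4 * B0\<^sup>2) * (real n * (?\<beta> n)\<^sup>2) \<le> a\<^sup>2 / (4 * B0\<^sup>2) * ((2 * N1) * (?\<beta> n)\<^sup>2)"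
        using N1 by (intro mult_left_mono mult_right_mono) auto
      ultimately show ?case unfolding N1_def[symmetric] p by (intro mult_left_mono) auto
    qed
  qed auto
  have nS: "S0 \<in> sets PX" "T \<in> sets PX" by auto
  have kb: "\<bar>kern n x y\<bar> \<le> B0" for n x y using B0 by (simp add: kern_def)
  have pa: "(\<lambda>n. measure PXs (Ba n)) \<longlonglongrightarrow> 0"
  proof (rule tendsto_sandwich[OF _ _ tendsto_const hoeff])
    show "\<forall>\<^sub>F n in sequentially. measure PXs (Ba n) \<le> real n * exp (- 2 * (real (n - 1) * (c / 2 * ?\<beta> n))\<^sup>2 / (real (n - 1) * (2 * B0)\<^sup>2))"
      using ev
    proof eventually_elim
      case (elim n)
      show ?case unfolding Ba_def
      proof (rule hoeffding_pairs_PiM(2)[OF prob_PX])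
        show "(\<lambda>(x, y). - kern n x y) \<in> borel_measurable (PX \<Otimes>\<^sub>M PX)"
          unfolding meas_PX_pair using borel_measurable_uminus[OF kern_meas[of n]] by (simp add: split_beta')
        fix x assume x: "x \<in> S0"
        have "c * ?\<beta> n \<le> (\<integral>y. kern n x y \<partial>PX)" using low x elim by blast
        then have "real (n - 1) * (c * ?\<beta> n) \<le> real (n - 1) * (\<integral>y. kern n x y \<partial>PX)" by (rule mult_left_mono) simp
        then show "real (n - 1) * (\<integral>y. - kern n x y \<partial>PX) \<le> - (real (n - 1) * (c * ?\<beta> n))" by simp
      qed (use elim c \<beta>[of n] kb B0(1) nS in auto)
    qed
  qed (use c in auto)
  have pb: "(\<lambda>n. measure PXs (Bb n)) \<longlonglongrightarrow> 0"
  proof (rule tendsto_sandwich[OF _ _ tendsto_const hoeff])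
    show "\<forall>\<^sub>F n in sequentially. measure PXs (Bb n) \<le> real n * exp (- 2 * (real (n - 1) * (C * ?\<beta> n))\<^sup>2 / (real (n - 1) * (2 * B0)\<^sup>2))"
      using ev
    proof eventually_elim
      case (elim n)
      show ?case unfolding Bb_def
      proof (rule hoeffding_pairs_PiM(2)[OF prob_PX])
        show "(\<lambda>(x, y). \<bar>kern n x y\<bar>) \<in> borel_measurable (PX \<Otimes>\<^sub>M PX)"
          unfolding meas_PX_pair using borel_measurable_abs[OF kern_meas[of n]] by (simp add: split_beta')
        fix x assume x: "x \<in> T"
        show "real (n - 1) * (\<integral>y. \<bar>kern n x y\<bar> \<partial>PX) \<le> real (n - 1) * (C * ?\<beta> n)"
          using up x elim by (intro mult_left_mono) auto
      qed (use elim C \<beta>[of n] kb B0(1) nS in auto)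
    qed
  qed (use C in auto)
  have pc: "(\<lambda>n. measure PXs (Bc n)) \<longlonglongrightarrow> 0"
  proof (rule tendsto_sandwich[OF _ _ tendsto_const])
    show "(\<lambda>n. sqrt (\<xi> n)) \<longlonglongrightarrow> 0" using tendsto_real_sqrt[OF \<xi>lim] by simp
    show "\<forall>\<^sub>F n in sequentially. measure PXs (Bc n) \<le> sqrt (\<xi> n)"
      using ev
    proof eventually_elim
      case (elim n)
      have bm: "(\<lambda>(x, y). bias_num n x y) \<in> borel_measurable (PX \<Otimes>\<^sub>M PX)" unfolding meas_PX_pair by (rule bias_num_meas)
      let ?c2 = "C * (?\<beta> n * (b n)\<^sup>2)"
      have c20: "0 \<le> ?c2" using C \<beta>[of n] by simp
      have "\<bar>bias_num n x y\<bar> \<le> C" for x y using bb[of n x y] elim C by (auto simp: bias_num_def)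
      moreover have "(\<integral>y. (bias_num n x y)\<^sup>2 \<partial>PX) \<le> ?c2" for x
        using b2[of n x] elim c20 by (cases "x \<in> S0") (auto simp: bias_num_def)
      moreover have "\<bar>\<integral>y. bias_num n x y \<partial>PX\<bar> \<le> ?c2" for x
        using b1[of n x] elim c20 by (cases "x \<in> S0") (auto simp: bias_num_def)
      ultimately have QI: "integrable PXs (Q n)" and QE: "(\<integral>w. Q n w \<partial>PXs) \<le> real n * (real n * ?c2 + (real n * ?c2)\<^sup>2)"
        unfolding Q_def[abs_def] bias_sum_def by (rule pair_sum_square_bound[OF prob_PX bm _ refl]; assumption)+
      have \<xi>p: "0 < \<xi> n" using \<xi>0 elim by simp
      have np: "0 < real n * ?\<beta> n" using elim \<beta>[of n] by simp
      have pos: "0 < sqrt (\<xi> n) * (real n * ?\<beta> n)\<^sup>2" using \<xi>p by (intro mult_pos_pos zero_less_power np) simp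
      have Q0: "0 \<le> Q n w" for w unfolding Q_def by (intro sum_nonneg) auto
      have "measure PXs (Bc n) \<le> (\<integral>w. h n * Q n w \<partial>PXs) / (sqrt (\<xi> n) * (real n * ?\<beta> n)\<^sup>2)"
        unfolding Bc_def
        by (rule integral_Markov_inequality_measure[OF _ sets.empty_sets]) (use QI Q0 h(1)[of n] pos in \<open>auto intro!: mult_nonneg_nonneg simp: less_imp_le\<close>)
      also have "\<dots> \<le> h n * (real n * (real n * ?c2 + (real n * ?c2)\<^sup>2)) / (sqrt (\<xi> n) * (real n * ?\<beta> n)\<^sup>2)"
        using QE h(1)[of n] \<xi>p by (intro divide_right_mono) (auto simp: mult_left_mono)
      also have "\<dots> = (h n * (real n * (real n * ?c2 + (real n * ?c2)\<^sup>2)) / (real n * ?\<beta> n)\<^sup>2) / sqrt (\<xi> n)"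
        by (simp add: mult.commute)
      also have "h n * (real n * (real n * ?c2 + (real n * ?c2)\<^sup>2)) / (real n * ?\<beta> n)\<^sup>2 = \<xi> n"
      proof -
        have e1: "h n * (real n * (real n * ?c2)) / (real n * ?\<beta> n)\<^sup>2 = C * (h n * (b n)\<^sup>2 / ?\<beta> n)"
          using elim b(1)[of n] by (simp add: power2_eq_square)
        have b4: "b n ^ 4 = (b n)\<^sup>2 * (b n)\<^sup>2" by (simp add: power_add[symmetric])
        have e2: "h n * (real n * (real n * ?c2)\<^sup>2) / (real n * ?\<beta> n)\<^sup>2 = C\<^sup>2 * (real n * b n ^ 4 * h n)"
          unfolding b4 using elim b(1)[of n] by (simp add: power2_eq_square mult_ac)
        show ?thesis unfolding \<xi>_def e1[symmetric] e2[symmetric] by (simp add: distrib_left add_divide_distrib)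
      qed
      also have "\<xi> n / sqrt (\<xi> n) = sqrt (\<xi> n)" using \<xi>p by (simp add: real_div_sqrt)
      finally show ?case .
    qed
  qed auto
  have \<tau>exp: "(\<lambda>n. exp (- 2 * (real n * \<tau> n)\<^sup>2 / (real n * (2 * 1)\<^sup>2))) \<longlonglongrightarrow> 0"
  proof -
    have "\<forall>\<^sub>F n in sequentially. exp (- 2 * (real n * \<tau> n)\<^sup>2 / (real n * (2 * 1)\<^sup>2)) = exp (- (1 / 2 * sqrt (real n)))"
      using ev
    proof eventually_elim
      case (elim n)
      have t2: "(\<tau> n)\<^sup>2 = 1 / sqrt (real n)" by (simp add: \<tau>_def power_divide)
      have "2 * (real n * \<tau> n)\<^sup>2 / (real n * (2 * 1)\<^sup>2) = 1 / 2 * (real n / sqrt (real n))"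
        using elim unfolding power_mult_distrib t2 by (simp add: power2_eq_square)
      also have "real n / sqrt (real n) = sqrt (real n)" by (simp add: real_div_sqrt)
      finally show ?case by simp
    qed
    moreover have "(\<lambda>n. exp (- (1 / 2 * sqrt (real n)))) \<longlonglongrightarrow> 0"
    proof (rule filterlim_compose[OF exp_at_bot])
      have "filterlim (\<lambda>n. 1 / 2 * sqrt (real n)) at_top sequentially"
        by (rule filterlim_tendsto_pos_mult_at_top[OF tendsto_const])
           (auto intro: filterlim_compose[OF sqrt_at_top] filterlim_real_sequentially)
      then show "filterlim (\<lambda>n. - (1 / 2 * sqrt (real n))) at_bot sequentially" by (simp add: filterlim_uminus_at_bot)
    qed
    ultimately show ?thesis by (subst tendsto_cong) auto
  qed
  have indI: "(\<integral>x. indicator S0 x \<partial>PX) = p0" by (simp add: p0_def)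
  have pd: "(\<lambda>n. measure PXs (Bd n)) \<longlonglongrightarrow> 0"
  proof (rule tendsto_sandwich[OF _ _ tendsto_const \<tau>exp])
    show "\<forall>\<^sub>F n in sequentially. measure PXs (Bd n) \<le> exp (- 2 * (real n * \<tau> n)\<^sup>2 / (real n * (2 * 1)\<^sup>2))"
      using ev
    proof eventually_elim
      case (elim n)
      have "measure PXs (Bd n) \<le> exp (- 2 * (real n * \<tau> n)\<^sup>2 / (real (card {1..n}) * (2 * 1)\<^sup>2))"
        unfolding Bd_def
        by (rule hoeffding_PiM[OF prob_PX]) (use elim indI in \<open>auto simp: \<tau>_def meas_PX indicator_def\<close>)
      then show ?case by simp
    qed
  qed auto
  have pe: "(\<lambda>n. measure PXs (Be n)) \<longlonglongrightarrow> 0"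
  proof (rule tendsto_sandwich[OF _ _ tendsto_const \<tau>exp])
    show "\<forall>\<^sub>F n in sequentially. measure PXs (Be n) \<le> exp (- 2 * (real n * \<tau> n)\<^sup>2 / (real n * (2 * 1)\<^sup>2))"
      using ev
    proof eventually_elim
      case (elim n)
      have "measure PXs (Be n) \<le> exp (- 2 * (real n * \<tau> n)\<^sup>2 / (real (card {1..n}) * (2 * 1)\<^sup>2))"
        unfolding Be_def
        by (rule hoeffding_PiM[OF prob_PX]) (use elim indI in \<open>auto simp: \<tau>_def meas_PX indicator_def\<close>)
      then show ?case by simp
    qed
  qed auto
  have prob: "(\<lambda>n. measure PXs (space PXs - G n)) \<longlonglongrightarrow> 0"
  proof (rule tendsto_sandwich[OF _ _ tendsto_const])
    show "(\<lambda>n. measure PXs (Ba n) + measure PXs (Bb n) + measure PXs (Bc n) + measure PXs (Bd n) + measure PXs (Be n)) \<longlonglongrightarrow> 0"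
      using tendsto_add[OF tendsto_add[OF tendsto_add[OF tendsto_add[OF pa pb] pc] pd] pe] by simp
    have "measure PXs (space PXs - G n) \<le> measure PXs (Ba n) + measure PXs (Bb n) + measure PXs (Bc n) + measure PXs (Bd n) + measure PXs (Be n)" for n
    proof -
      have "space PXs - G n = Ba n \<union> Bb n \<union> Bc n \<union> Bd n \<union> Be n"
        by (auto simp: G_def Ba_def Bb_def Bc_def Bd_def Be_def)
      also have "measure PXs \<dots> \<le> measure PXs (Ba n \<union> Bb n \<union> Bc n \<union> Bd n) + measure PXs (Be n)" by (rule measure_Un_le) auto
      also have "measure PXs (Ba n \<union> Bb n \<union> Bc n \<union> Bd n) \<le> measure PXs (Ba n \<union> Bb n \<union> Bc n) + measure PXs (Bd n)" by (rule measure_Un_le) auto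
      also have "measure PXs (Ba n \<union> Bb n \<union> Bc n) \<le> measure PXs (Ba n \<union> Bb n) + measure PXs (Bc n)" by (rule measure_Un_le) auto
      also have "measure PXs (Ba n \<union> Bb n) \<le> measure PXs (Ba n) + measure PXs (Bb n)" by (rule measure_Un_le) auto
      finally show ?thesis by simp
    qed
    then show "\<forall>\<^sub>F n in sequentially. measure PXs (space PXs - G n) \<le> measure PXs (Ba n) + measure PXs (Bb n) + measure PXs (Bc n) + measure PXs (Bd n) + measure PXs (Be n)"
      by simp
  qed auto
  show ?thesis
  \<comment> \<open>Of the factor 1/4, one half is lost to the deviation and one half to replacing
    \<open>n - 1\<close> by \<open>n\<close>. The 2 in \<open>2 * C\<close> adds a deviation as
    large as the mean.\<close>
  proof (rule that[of "c / 4" "2 * C" \<zeta> G])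
    show "0 < c / 4" "0 < 2 * C" "\<zeta> \<longlonglongrightarrow> 0" using c C \<zeta>lim by auto
    show "G n \<in> sets PXs" for n by (rule Gsets)
    show "(\<lambda>n. measure PXs (space PXs - G n)) \<longlonglongrightarrow> 0" by (rule prob)
    show "\<forall>\<^sub>F n in sequentially. \<forall>w\<in>G n. good_design (c / 4) (2 * C) (\<zeta> n) n w"
      using ev
    proof eventually_elim
      case (elim n)
      have n1: "real n \<le> 2 * real (n - 1)" "real (n - 1) \<le> real n" using elim by auto
      show ?case
      proof
        fix w assume w: "w \<in> G n"
        have T_bound: "abs_denom n w i \<le> 2 * C * eff n" if i: "i \<in> {1..n}" and wi: "w i \<in> T" for i
        proof -
          have "\<not> real (n - 1) * (C * ?\<beta> n) + real (n - 1) * (C * ?\<beta> n) \<le> abs_denom n w i"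
            using w i wi by (auto simp: G_def Bb_def abs_denom_def)
          moreover have "real (n - 1) * (C * ?\<beta> n) \<le> real n * (C * ?\<beta> n)" using n1 C \<beta>[of n] by (intro mult_right_mono) auto
          ultimately show ?thesis by (simp add: mult_ac eff_def)
        qed
        show "good_design (c / 4) (2 * C) (\<zeta> n) n w" unfolding good_design_def
        proof (intro conjI ballI)
          fix i assume "i \<in> inner_ix n w"
          then have i: "i \<in> {1..n}" "w i \<in> S0" by (auto simp: inner_ix_def)
          show "abs_denom n w i \<le> 2 * C * eff n" using T_bound i T(1) by blast
          have "\<not> - (real (n - 1) * (c * ?\<beta> n)) + real (n - 1) * (c / 2 * ?\<beta> n) \<le> - denom n w i"
            using w i by (auto simp: G_def Ba_def denom_def sum_negf)
          then have "real (n - 1) * (c / 2 * ?\<beta> n) \<le> denom n w i" by (simp add: algebra_simps)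
          moreover have "real n * (c / 4 * ?\<beta> n) \<le> 2 * real (n - 1) * (c / 4 * ?\<beta> n)"
            using n1 c \<beta>[of n] by (intro mult_right_mono) auto
          ultimately show "c / 4 * eff n \<le> denom n w i" by (simp add: mult_ac eff_def)
        next
          fix j assume j: "j \<in> {1..n}"
          \<comment> \<open>By evenness of \<open>K0\<close> the column sum at \<open>j\<close> is a
            part of the row sum at \<open>j\<close>. As \<open>w j\<close> need not lie in
            \<open>S0\<close>, the bound on \<open>T\<close> is used; if \<open>w j\<close> is
            outside \<open>T\<close>, no inner point reaches it and the sum is zero.\<close>
          have sym: "\<bar>kern n (w i) (w j)\<bar> = \<bar>kern n (w j) (w i)\<bar>" for i
            using K0_sym[of "(w j - w i) /\<^sub>R b n"] by (simp add: kern_def scaleR_minus_right[symmetric] del: scaleR_minus_right)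
          show "(\<Sum>i\<in>inner_ix n w - {j}. \<bar>kern n (w i) (w j)\<bar>) \<le> 2 * C * eff n"
          proof (cases "w j \<in> T")
            case True
            have "(\<Sum>i\<in>inner_ix n w - {j}. \<bar>kern n (w i) (w j)\<bar>) \<le> (\<Sum>i\<in>{1..n} - {j}. \<bar>kern n (w i) (w j)\<bar>)"
              by (rule sum_mono2) (auto simp: inner_ix_def)
            also have "\<dots> = abs_denom n w j" unfolding abs_denom_def by (rule sum.cong[OF refl sym])
            also have "\<dots> \<le> 2 * C * eff n" by (rule T_bound[OF j True])
            finally show ?thesis .
          next
            case False
            then have "\<bar>kern n (w i) (w j)\<bar> = 0" if "w i \<in> S0" for i using nearT that elim by auto
            then have "(\<Sum>i\<in>inner_ix n w - {j}. \<bar>kern n (w i) (w j)\<bar>) = 0" by (intro sum.neutral) (auto simp: inner_ix_def)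
            then show ?thesis using C \<beta>[of n] by (simp add: eff_def)
          qed
        next
          have \<tau>0: "0 \<le> \<tau> n" by (simp add: \<tau>_def)
          have "h n * Q n w \<le> sqrt (\<xi> n) * (eff n)\<^sup>2" using w by (auto simp: G_def Bc_def eff_def)
          also have "\<dots> \<le> \<zeta> n * (eff n)\<^sup>2" using \<tau>0 by (intro mult_right_mono) (auto simp: \<zeta>_def)
          finally show "h n * (\<Sum>i\<in>{1..n}. (bias_sum n w i)\<^sup>2) \<le> \<zeta> n * (eff n)\<^sup>2" by (simp add: Q_def)
        next
          let ?k = "real (card (inner_ix n w))"
          have s: "(\<Sum>i\<in>{1..n}. indicator S0 (w i)) = ?k"
            by (simp add: inner_ix_def indicator_def sum.If_cases Int_def)
          have "?k < real n * p0 + real n * \<tau> n" "real n * p0 - real n * \<tau> n < ?k"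
            using w s by (auto simp: G_def Bd_def Be_def sum_negf)
          then have "\<bar>?k - real n * p0\<bar> \<le> real n * \<tau> n" by linarith
          then have "\<bar>?k - real n * p0\<bar> / real n \<le> \<tau> n" using elim by (simp add: divide_le_eq mult.commute)
          also have "\<bar>?k - real n * p0\<bar> / real n = \<bar>?k / real n - p0\<bar>"
          proof -
            have "?k / real n - p0 = (?k - real n * p0) / real n" using elim by (simp add: diff_divide_distrib)
            then show ?thesis by simp
          qed
          also have "\<tau> n \<le> \<zeta> n" using \<xi>0 elim by (simp add: \<zeta>_def less_imp_le)
          finally show "\<bar>?k / real n - p0\<bar> \<le> \<zeta> n" .
        qed
      qed
    qed
  qed
qed

end

section \<open>Averaging over the design\<close>

locale residual_density =
  density_kernel_noise f f1 f2 K F F1 F2 L R B + regression_asymptotics g m K0 S S0 d b h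
  for f f1 f2 K :: "real \<Rightarrow> real" and F F1 F2 L R B :: real
    and g m K0 :: "real ^ 'd \<Rightarrow> real" and S S0 :: "(real ^ 'd) set" and d :: nat and b h :: "nat \<Rightarrow> real" +
  fixes y :: real
  assumes p0: "0 < p0"
begin

text \<open>The estimator is evaluated on the product of error and design sequences, with coordinate
  maps as random variables, so that conditioning on the design is Fubini.\<close>

definition "stat n z = sqrt (real n * h n) *
  (error_density_estimator K0 K (b n) (h n) S0 (\<lambda>i z. snd z i) (\<lambda>i z. m (snd z i) + fst z i) n y z - fbar y (h n))"

definition "limit_char t = complex_of_real (exp (- (t\<^sup>2 * (f y / p0 * (\<integral>v. (K v)\<^sup>2 \<partial>lborel)) / 2)))"

lemma stat_meas[measurable]: "stat n \<in> borel_measurable (P \<Otimes>\<^sub>M PXs)"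
proof -
  have [measurable]: "(\<lambda>z. fst z i) \<in> borel_measurable (P \<Otimes>\<^sub>M PXs)" for i
    by (rule measurable_compose[OF measurable_fst meas_coord])
  have [measurable]: "(\<lambda>z. snd z i) \<in> borel_measurable (P \<Otimes>\<^sub>M PXs)" for i
    by (rule measurable_compose[OF measurable_snd PXs_coord])
  show ?thesis
    unfolding stat_def[abs_def] error_density_estimator_def est_residual_def loo_regression_def by measurable
qed

definition "weight n w i j = (if j = i then 0 else kern n (w i) (w j) / denom n w i)"

text \<open>In the numerator \<open>m (w j) + e j\<close> is split as
  \<open>m (w j) - m (w i)\<close>, \<open>m (w i)\<close> and \<open>e j\<close>. Division by the
  denominator returns \<open>m (w i)\<close> exactly, which cancels in the residual and leaves the
  bias and a weighted sum of the other errors.\<close>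

lemma design_statistic:
  assumes den: "\<And>i. i \<in> inner_ix n w \<Longrightarrow> denom n w i \<noteq> 0"
  shows "stat n (e, w) = sqrt (real n * h n) *
    ((\<Sum>i\<in>inner_ix n w. K ((e i + - (bias_sum n w i / denom n w i + (\<Sum>j\<in>{1..n}. weight n w i j * e j)) - y) / h n))
      / (h n * real (card (inner_ix n w))) - fbar y (h n))"
proof -
  let ?res = "\<lambda>i. est_residual K0 (b n) (\<lambda>i z. snd z i) (\<lambda>i z. m (snd z i) + fst z i) n i (e, w)"
  have res: "?res i = e i + - (bias_sum n w i / denom n w i + (\<Sum>j\<in>{1..n}. weight n w i j * e j))"
    if i: "i \<in> inner_ix n w" for i
  proof -
    have "(\<Sum>j\<in>{1..n}. weight n w i j * e j) = (\<Sum>j\<in>{1..n} - {i}. weight n w i j * e j)"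
      by (rule sum.mono_neutral_right) (auto simp: weight_def)
    also have "\<dots> = (\<Sum>j\<in>{1..n} - {i}. kern n (w i) (w j) * e j) / denom n w i"
      by (simp add: weight_def sum_divide_distrib)
    finally have 1: "(\<Sum>j\<in>{1..n}. weight n w i j * e j) = (\<Sum>j\<in>{1..n} - {i}. kern n (w i) (w j) * e j) / denom n w i" .
    have "(\<Sum>j\<in>{1..n} - {i}. (m (w j) + e j) * kern n (w i) (w j)) =
       (\<Sum>j\<in>{1..n} - {i}. bias_num n (w i) (w j) + m (w i) * kern n (w i) (w j) + kern n (w i) (w j) * e j)"
      using i by (intro sum.cong) (auto simp: bias_num_def inner_ix_def algebra_simps)
    then have eq0: "(\<Sum>j\<in>{1..n} - {i}. (m (w j) + e j) * kern n (w i) (w j)) =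
        bias_sum n w i + m (w i) * denom n w i + (\<Sum>j\<in>{1..n} - {i}. kern n (w i) (w j) * e j)"
      by (simp add: sum.distrib sum_distrib_left denom_def bias_sum_def)
    have 2: "(\<Sum>j\<in>{1..n} - {i}. (m (w j) + e j) * kern n (w i) (w j)) / denom n w i
        = bias_sum n w i / denom n w i + m (w i) + (\<Sum>j\<in>{1..n}. weight n w i j * e j)"
      unfolding eq0 1 add_divide_distrib using den[OF i] by simp
    show ?thesis
      unfolding est_residual_def loo_regression_def fst_conv snd_conv kern_def[symmetric] denom_def[symmetric] 2 by simp
  qed
  have "(\<Sum>i=1..n. indicator S0 (w i) * K ((?res i - y) / h n)) = (\<Sum>i\<in>inner_ix n w. K ((?res i - y) / h n))"
    unfolding inner_ix_def by (rule sum.mono_neutral_cong_right) (auto simp: indicator_def)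
  also have "\<dots> = (\<Sum>i\<in>inner_ix n w. K ((e i + - (bias_sum n w i / denom n w i + (\<Sum>j\<in>{1..n}. weight n w i j * e j)) - y) / h n))"
    by (intro sum.cong refl) (simp add: res)
  finally have num: "(\<Sum>i=1..n. indicator S0 (w i) * K ((?res i - y) / h n)) = \<dots>" .
  have cnt: "(\<Sum>i=1..n. indicator S0 (w i)) = real (card (inner_ix n w))"
    unfolding inner_ix_def by (simp add: indicator_def sum.If_cases Int_def)
  show ?thesis
    unfolding stat_def error_density_estimator_def num snd_conv cnt ..
qed

text \<open>The sum of squared weights is of order \<open>1 / eff n\<close>: one kernel factor is
  bounded by \<open>B0\<close>, the other is summed to order \<open>eff n\<close>, and two
  denominators divide. Column sums are of order one because numerator and denominator are both of
  order \<open>eff n\<close>.\<close>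

lemma good_design_bounds:
  assumes c: "0 < c" and e: "0 < eff n" and good: "good_design c C \<zeta> n w"
  shows "i \<in> inner_ix n w \<Longrightarrow> denom n w i \<noteq> 0"
    and "i \<in> inner_ix n w \<Longrightarrow> (\<Sum>j\<in>{1..n}. (weight n w i j)\<^sup>2) \<le> B0 * C / c\<^sup>2 * (1 / eff n)"
    and "j \<in> {1..n} \<Longrightarrow> \<bar>\<Sum>i\<in>inner_ix n w. weight n w i j\<bar> \<le> C / c"
    and "h n * (\<Sum>i\<in>inner_ix n w. (bias_sum n w i / denom n w i)\<^sup>2) \<le> \<zeta> * (1 / c\<^sup>2)"
proof -
  have ce: "0 < c * eff n" using c e by simp
  have low: "c * eff n \<le> denom n w i" and up: "abs_denom n w i \<le> C * eff n" if "i \<in> inner_ix n w" for i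
    using good that by (auto simp: good_design_def)
  have pos: "0 < denom n w i" if "i \<in> inner_ix n w" for i using low[OF that] ce by linarith
  then show "i \<in> inner_ix n w \<Longrightarrow> denom n w i \<noteq> 0" by fastforce
  have fin: "finite (inner_ix n w)" "inner_ix n w \<subseteq> {1..n}" by (auto simp: inner_ix_def)
  have den_sq: "1 / (denom n w i)\<^sup>2 \<le> 1 / (c * eff n)\<^sup>2" if i: "i \<in> inner_ix n w" for i
    using power_mono[OF low[OF i], of 2] ce
    by (intro divide_left_mono[OF _ _ mult_pos_pos[OF zero_less_power[OF pos[OF i]] zero_less_power[OF ce]]]) auto
  show "(\<Sum>j\<in>{1..n}. (weight n w i j)\<^sup>2) \<le> B0 * C / c\<^sup>2 * (1 / eff n)" if i: "i \<in> inner_ix n w"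
  proof -
    have "(\<Sum>j\<in>{1..n}. (weight n w i j)\<^sup>2) = (\<Sum>j\<in>{1..n} - {i}. (weight n w i j)\<^sup>2)"
      by (rule sum.mono_neutral_right) (auto simp: weight_def)
    also have "\<dots> = (\<Sum>j\<in>{1..n} - {i}. (kern n (w i) (w j))\<^sup>2) * (1 / (denom n w i)\<^sup>2)"
      by (simp add: weight_def sum_divide_distrib power_divide)
    also have "\<dots> \<le> (B0 * (C * eff n)) * (1 / (c * eff n)\<^sup>2)"
    proof (intro mult_mono den_sq i)
      have "(\<Sum>j\<in>{1..n} - {i}. (kern n (w i) (w j))\<^sup>2) \<le> (\<Sum>j\<in>{1..n} - {i}. B0 * \<bar>kern n (w i) (w j)\<bar>)"
      proof (rule sum_mono)
        fix j show "(kern n (w i) (w j))\<^sup>2 \<le> B0 * \<bar>kern n (w i) (w j)\<bar>"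
          using mult_right_mono[OF B0(2)[of "(w j - w i) /\<^sub>R b n"] abs_ge_zero[of "kern n (w i) (w j)"]]
          by (simp add: kern_def power2_eq_square flip: abs_mult)
      qed
      also have "\<dots> = B0 * abs_denom n w i" by (simp add: sum_distrib_left abs_denom_def)
      also have "\<dots> \<le> B0 * (C * eff n)" using up[OF i] B0(1) by (intro mult_left_mono) auto
      finally show "(\<Sum>j\<in>{1..n} - {i}. (kern n (w i) (w j))\<^sup>2) \<le> B0 * (C * eff n)" .
      have "0 \<le> abs_denom n w i" unfolding abs_denom_def by (intro sum_nonneg) simp
      then have "0 \<le> C * eff n" using up[OF i] by linarith
      then show "0 \<le> B0 * (C * eff n)" by (rule mult_nonneg_nonneg[OF less_imp_le[OF B0(1)]])
    qed auto
    also have "\<dots> = B0 * C / c\<^sup>2 * (1 / eff n)" using c e by (simp add: power2_eq_square)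
    finally show ?thesis .
  qed
  show "\<bar>\<Sum>i\<in>inner_ix n w. weight n w i j\<bar> \<le> C / c" if j: "j \<in> {1..n}"
  proof -
    have "(\<Sum>i\<in>inner_ix n w. weight n w i j) = (\<Sum>i\<in>inner_ix n w - {j}. weight n w i j)"
      by (rule sum.mono_neutral_right) (use fin in \<open>auto simp: weight_def\<close>)
    also have "\<bar>\<dots>\<bar> \<le> (\<Sum>i\<in>inner_ix n w - {j}. \<bar>weight n w i j\<bar>)" by (rule sum_abs)
    also have "\<dots> \<le> (\<Sum>i\<in>inner_ix n w - {j}. \<bar>kern n (w i) (w j)\<bar> / (c * eff n))"
    proof (rule sum_mono)
      fix i assume i: "i \<in> inner_ix n w - {j}"
      then have i': "i \<in> inner_ix n w" by simp
      have "\<bar>weight n w i j\<bar> = \<bar>kern n (w i) (w j)\<bar> / denom n w i"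
        using i pos[OF i'] by (auto simp: weight_def)
      also have "\<dots> \<le> \<bar>kern n (w i) (w j)\<bar> / (c * eff n)"
        using low[OF i'] by (intro divide_left_mono[OF _ _ mult_pos_pos[OF pos[OF i'] ce]]) auto
      finally show "\<bar>weight n w i j\<bar> \<le> \<bar>kern n (w i) (w j)\<bar> / (c * eff n)" .
    qed
    also have "\<dots> = (\<Sum>i\<in>inner_ix n w - {j}. \<bar>kern n (w i) (w j)\<bar>) / (c * eff n)" by (simp only: sum_divide_distrib)
    also have "\<dots> \<le> C * eff n / (c * eff n)" using good j ce by (intro divide_right_mono) (auto simp: good_design_def)
    also have "\<dots> = C / c" using e by simp
    finally show ?thesis .
  qed
  have "(\<Sum>i\<in>inner_ix n w. (bias_sum n w i / denom n w i)\<^sup>2) \<le> (\<Sum>i\<in>inner_ix n w. (bias_sum n w i)\<^sup>2 * (1 / (c * eff n)\<^sup>2))"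
  proof (rule sum_mono)
    fix i assume i: "i \<in> inner_ix n w"
    show "(bias_sum n w i / denom n w i)\<^sup>2 \<le> (bias_sum n w i)\<^sup>2 * (1 / (c * eff n)\<^sup>2)"
      using mult_left_mono[OF den_sq[OF i], of "(bias_sum n w i)\<^sup>2"] by (simp add: power_divide)
  qed
  also have "\<dots> \<le> (\<Sum>i\<in>{1..n}. (bias_sum n w i)\<^sup>2 * (1 / (c * eff n)\<^sup>2))" using fin by (intro sum_mono2) auto
  also have "\<dots> = (\<Sum>i\<in>{1..n}. (bias_sum n w i)\<^sup>2) * (1 / (c * eff n)\<^sup>2)" by (simp only: sum_distrib_right)
  finally have "h n * (\<Sum>i\<in>inner_ix n w. (bias_sum n w i / denom n w i)\<^sup>2) \<le> (h n * (\<Sum>i\<in>{1..n}. (bias_sum n w i)\<^sup>2)) * (1 / (c * eff n)\<^sup>2)"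
    using h(1)[of n] by (simp only: mult.assoc mult_left_mono less_imp_le)
  also have "\<dots> \<le> (\<zeta> * (eff n)\<^sup>2) * (1 / (c * eff n)\<^sup>2)" using good by (intro mult_right_mono) (auto simp: good_design_def)
  also have "\<dots> = \<zeta> * (1 / c\<^sup>2)" using e by (simp add: power_mult_distrib)
  finally show "h n * (\<Sum>i\<in>inner_ix n w. (bias_sum n w i / denom n w i)\<^sup>2) \<le> \<zeta> * (1 / c\<^sup>2)" .
qed

text \<open>The limit is stated for every sequence of designs eventually in \<open>G n\<close>,
  measurable or not. Uniformity over \<open>G n\<close> is extracted from this freedom in the next
  theorem.\<close>

lemma good_design_limits:
  obtains G where "\<And>n. G n \<in> sets PXs" "(\<lambda>n. measure PXs (space PXs - G n)) \<longlonglongrightarrow> 0"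
    "\<And>x t. \<forall>\<^sub>F n in sequentially. x n \<in> G n \<Longrightarrow> (\<lambda>n. CLINT e|P. iexp (t * stat n (e, x n))) \<longlonglongrightarrow> limit_char t"
proof -
  obtain c C \<zeta> G where c: "0 < c" and C: "0 < C" and \<zeta>: "\<zeta> \<longlonglongrightarrow> 0" and G: "\<And>n. G n \<in> sets PXs"
    "(\<lambda>n. measure PXs (space PXs - G n)) \<longlonglongrightarrow> 0"
    and good: "\<forall>\<^sub>F n in sequentially. \<forall>w\<in>G n. good_design c C (\<zeta> n) n w"
    by (rule good_designs) (rule that; assumption)
  show ?thesis
  proof (rule that[of G, OF G])
    fix x :: "nat \<Rightarrow> nat \<Rightarrow> real ^ 'd" and t
    assume x: "\<forall>\<^sub>F n in sequentially. x n \<in> G n"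
    have ev: "\<forall>\<^sub>F n in sequentially. 0 < eff n \<and> good_design c C (\<zeta> n) n (x n)"
      using good x eventually_gt_at_top[of 0] by eventually_elim (use b(1) in \<open>auto simp: eff_def\<close>)
    have lim: "(\<lambda>n. CLINT e|P. iexp (t * (sqrt (real n * h n) *
        ((\<Sum>i\<in>inner_ix n (x n). K ((e i + - (bias_sum n (x n) i / denom n (x n) i + (\<Sum>j\<in>{1..n}. weight n (x n) i j * e j)) - y) / h n))
          / (h n * real (card (inner_ix n (x n)))) - fbar y (h n)))))
        \<longlonglongrightarrow> exp (- (t\<^sup>2 * (f y / p0 * (\<integral>v. (K v)\<^sup>2 \<partial>lborel)) / 2))"
    proof (rule fixed_design_limit[where V="\<lambda>n. B0 * C / c\<^sup>2 * (1 / eff n)" and C="C / c"])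
      show "0 < h n" for n by (rule h)
      show "h \<longlonglongrightarrow> 0" by (rule h)
      show "inner_ix n (x n) \<subseteq> {1..n}" for n by (auto simp: inner_ix_def)
      show "weight n (x n) i i = 0" for n i by (simp add: weight_def)
      show "0 \<le> B0 * C / c\<^sup>2 * (1 / eff n)" for n using B0(1) C b(1)[of n] by (simp add: eff_def)
      show "0 \<le> C / c" using c C by simp
      show "0 < p0" by (rule p0)
      show "\<forall>\<^sub>F n in sequentially. \<forall>i\<in>inner_ix n (x n). (\<Sum>j\<in>{1..n}. (weight n (x n) i j)\<^sup>2) \<le> B0 * C / c\<^sup>2 * (1 / eff n)"
        using ev by eventually_elim (use good_design_bounds(2)[OF c] in blast)
      show "\<forall>\<^sub>F n in sequentially. \<forall>j\<in>{1..n}. \<bar>\<Sum>i\<in>inner_ix n (x n). weight n (x n) i j\<bar> \<le> C / c"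
        using ev by eventually_elim (use good_design_bounds(3)[OF c] in blast)
      show "(\<lambda>n. real (card (inner_ix n (x n))) / real n) \<longlonglongrightarrow> p0"
      proof (rule LIM_zero_cancel, rule Lim_null_comparison[OF _ \<zeta>])
        show "\<forall>\<^sub>F n in sequentially. norm (real (card (inner_ix n (x n))) / real n - p0) \<le> \<zeta> n"
          using ev by eventually_elim (auto simp: good_design_def)
      qed
      show "(\<lambda>n. h n * (\<Sum>i\<in>inner_ix n (x n). (bias_sum n (x n) i / denom n (x n) i)\<^sup>2)) \<longlonglongrightarrow> 0"
      proof (rule Lim_null_comparison)
        show "(\<lambda>n. \<zeta> n * (1 / c\<^sup>2)) \<longlonglongrightarrow> 0" using tendsto_mult_right[OF \<zeta>, of "1 / c\<^sup>2"] by simp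
        show "\<forall>\<^sub>F n in sequentially. norm (h n * (\<Sum>i\<in>inner_ix n (x n). (bias_sum n (x n) i / denom n (x n) i)\<^sup>2)) \<le> \<zeta> n * (1 / c\<^sup>2)"
          using ev
        proof eventually_elim
          case (elim n)
          have "0 \<le> h n * (\<Sum>i\<in>inner_ix n (x n). (bias_sum n (x n) i / denom n (x n) i)\<^sup>2)"
            using h(1)[of n] by (intro mult_nonneg_nonneg sum_nonneg) auto
          then show ?case using good_design_bounds(4)[OF c, of n C "\<zeta> n" "x n"] elim by simp
        qed
      qed
      show "(\<lambda>n. 1 / sqrt (real n * h n)) \<longlonglongrightarrow> 0" by (rule rate_h)
      show "(\<lambda>n. 1 / (real n * h n ^ 3)) \<longlonglongrightarrow> 0" by (rule inverse_tendsto_0[OF rate_h3])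
      show "(\<lambda>n. sqrt (real n * h n) * (B0 * C / c\<^sup>2 * (1 / eff n))) \<longlonglongrightarrow> 0"
        unfolding eff_def using tendsto_mult_left[OF rate_sqrt, of "B0 * C / c\<^sup>2"] by (simp add: mult_ac)
      show "(\<lambda>n. B0 * C / c\<^sup>2 * (1 / eff n) / (h n)\<^sup>2) \<longlonglongrightarrow> 0"
        unfolding eff_def using tendsto_mult_left[OF rate_h2, of "B0 * C / c\<^sup>2"] by (simp add: mult_ac)
    qed
    show "(\<lambda>n. CLINT e|P. iexp (t * stat n (e, x n))) \<longlonglongrightarrow> limit_char t"
    proof (rule Lim_transform_eventually[OF lim[folded limit_char_def]])
      show "\<forall>\<^sub>F n in sequentially. (CLINT e|P. iexp (t * (sqrt (real n * h n) *
        ((\<Sum>i\<in>inner_ix n (x n). K ((e i + - (bias_sum n (x n) i / denom n (x n) i + (\<Sum>j\<in>{1..n}. weight n (x n) i j * e j)) - y) / h n))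
          / (h n * real (card (inner_ix n (x n)))) - fbar y (h n))))) = (CLINT e|P. iexp (t * stat n (e, x n)))"
        using ev
      proof eventually_elim
        case (elim n)
        then have "i \<in> inner_ix n (x n) \<Longrightarrow> denom n (x n) i \<noteq> 0" for i using good_design_bounds(1)[OF c] by blast
        note ds = design_statistic[of n "x n", OF this]
        show ?case by (simp only: ds)
      qed
    qed
  qed
qed

text \<open>The conditional characteristic function is uniformly close to its limit on good designs
  and at most 2 away elsewhere, so its average over the design has the same limit.\<close>

theorem joint_char_limit: "(\<lambda>n. CLINT z|P \<Otimes>\<^sub>M PXs. iexp (t * stat n z)) \<longlonglongrightarrow> limit_char t"
proof -
  interpret PP: pair_prob_space P PXs ..
  obtain G where Gs: "\<And>n. G n \<in> sets PXs" and Gp: "(\<lambda>n. measure PXs (space PXs - G n)) \<longlonglongrightarrow> 0"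
    and Gl: "\<And>x t. \<forall>\<^sub>F n in sequentially. x n \<in> G n \<Longrightarrow> (\<lambda>n. CLINT e|P. iexp (t * stat n (e, x n))) \<longlonglongrightarrow> limit_char t"
    by (rule good_design_limits) (rule that; assumption)
  define J where "J n w = (CLINT e|P. iexp (t * stat n (e, w)))" for n w
  define D where "D n w = cmod (J n w - limit_char t)" for n w
  have I: "integrable (P \<Otimes>\<^sub>M PXs) (\<lambda>z. iexp (t * stat n z))" for n
    by (rule PP.P.integrable_const_bound[of _ 1]) auto
  have split: "(\<lambda>(e, w). iexp (t * stat n (e, w))) = (\<lambda>z. iexp (t * stat n z))" for n by auto
  have [measurable]: "J n \<in> borel_measurable PXs" for n
    unfolding J_def[abs_def]
    by (rule borel_measurable_integrable[OF PP.integrable_snd[of "\<lambda>e w. iexp (t * stat n (e, w))", unfolded split, OF I]])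
  have J_int: "(CLINT w|PXs. J n w) = (CLINT z|P \<Otimes>\<^sub>M PXs. iexp (t * stat n z))" for n
    unfolding J_def by (rule PP.integral_snd[of "\<lambda>e w. iexp (t * stat n (e, w))", unfolded split, OF I])
  have J1: "cmod (J n w) \<le> 1" for n w
  proof -
    have "cmod (J n w) \<le> (\<integral>e. cmod (iexp (t * stat n (e, w))) \<partial>P)" unfolding J_def by (rule integral_norm_bound)
    also have "\<dots> = 1" using P.prob_space by simp
    finally show ?thesis .
  qed
  have "0 \<le> t\<^sup>2 * (f y / p0 * (\<integral>v. (K v)\<^sup>2 \<partial>lborel)) / 2"
    using f_nonneg[of y] p0 by (intro divide_nonneg_nonneg mult_nonneg_nonneg) auto
  then have L1: "cmod (limit_char t) \<le> 1" by (simp add: limit_char_def)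
  have D2: "D n w \<le> 2" for n w
    using norm_triangle_ineq4[of "J n w" "limit_char t"] J1[of n w] L1 by (simp add: D_def)
  \<comment> \<open>Convergence along every sequence of good designs is uniform over good designs: follow a
    sequence of designs that violate the bound whenever possible.\<close>
  have uniform: "\<forall>\<^sub>F n in sequentially. \<forall>w\<in>G n. D n w < \<epsilon>" if \<epsilon>: "0 < \<epsilon>" for \<epsilon>
  proof -
    define x where "x n = (if \<exists>w\<in>G n. \<epsilon> \<le> D n w then SOME w. w \<in> G n \<and> \<epsilon> \<le> D n w else SOME w. w \<in> G n)" for n
    have x1: "x n \<in> G n \<and> \<epsilon> \<le> D n (x n)" if "\<exists>w\<in>G n. \<epsilon> \<le> D n w" for n
    proof -
      have "\<exists>w. w \<in> G n \<and> \<epsilon> \<le> D n w" using that by blast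
      from someI_ex[OF this] show ?thesis using that by (simp add: x_def)
    qed
    have x2: "x n \<in> G n" if "G n \<noteq> {}" for n
    proof (cases "\<exists>w\<in>G n. \<epsilon> \<le> D n w")
      case False
      have "\<exists>w. w \<in> G n" using that by blast
      from someI_ex[OF this] show ?thesis using False by (simp add: x_def)
    qed (use x1 in blast)
    \<comment> \<open>An empty \<open>G n\<close> would have a complement of probability one; hence
      the chosen designs are eventually good.\<close>
    have "\<forall>\<^sub>F n in sequentially. measure PXs (space PXs - G n) < 1" using order_tendstoD(2)[OF Gp] by simp
    then have "\<forall>\<^sub>F n in sequentially. x n \<in> G n"
    proof eventually_elim
      case (elim n)
      then show ?case using x2[of n] PXs.prob_space by (cases "G n = {}") auto
    qed
    from Gl[OF this, of t] have "(\<lambda>n. J n (x n) - limit_char t) \<longlonglongrightarrow> 0"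
      unfolding J_def by (rule LIM_zero)
    then have "(\<lambda>n. D n (x n)) \<longlonglongrightarrow> 0" unfolding D_def by (rule tendsto_norm_zero)
    then have "\<forall>\<^sub>F n in sequentially. D n (x n) < \<epsilon>" by (rule order_tendstoD(2)) (rule \<epsilon>)
    then show ?thesis
    proof eventually_elim
      case (elim n)
      then show ?case using x1[of n] by force
    qed
  qed
  show ?thesis
  proof (rule LIM_zero_cancel, rule LIMSEQ_I)
    fix r :: real assume r: "0 < r"
    have "\<forall>\<^sub>F n in sequentially. measure PXs (space PXs - G n) < r / 4" by (rule order_tendstoD(2)[OF Gp]) (use r in simp)
    moreover have "\<forall>\<^sub>F n in sequentially. \<forall>w\<in>G n. D n w < r / 2" by (rule uniform) (use r in simp)
    ultimately have "\<forall>\<^sub>F n in sequentially. cmod ((CLINT z|P \<Otimes>\<^sub>M PXs. iexp (t * stat n z)) - limit_char t) < r"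
    proof eventually_elim
      case (elim n)
      have JI: "integrable PXs (J n)" by (rule PXs.integrable_const_bound[of _ 1]) (use J1 in auto)
      have "(CLINT z|P \<Otimes>\<^sub>M PXs. iexp (t * stat n z)) - limit_char t = (CLINT w|PXs. J n w - limit_char t)"
        unfolding J_int[symmetric] using JI PXs.prob_space by simp
      also have "cmod \<dots> \<le> (\<integral>w. D n w \<partial>PXs)" unfolding D_def by (rule integral_norm_bound)
      \<comment> \<open>The mean is below \<open>r / 2\<close> on good designs plus 2 times an
        exceptional probability below \<open>r / 4\<close>.\<close>
      also have "\<dots> \<le> (\<integral>w. r / 2 + 2 * indicator (space PXs - G n) w \<partial>PXs)"
      proof (rule integral_mono)
        show "integrable PXs (D n)"
          unfolding D_def[abs_def] using JI by (intro integrable_norm) simp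
        show "integrable PXs (\<lambda>w. r / 2 + 2 * indicator (space PXs - G n) w)"
          using Gs[of n] by (intro Bochner_Integration.integrable_add integrable_mult_right PXs.integrable_const
            PXs.integrable_const_bound[of _ 1]) (auto simp: indicator_def)
        fix w assume "w \<in> space PXs"
        then show "D n w \<le> r / 2 + 2 * indicator (space PXs - G n) w"
          using elim(2) D2[of n w] r by (cases "w \<in> G n") (auto simp: less_imp_le)
      qed
      also have "\<dots> = r / 2 + 2 * measure PXs (space PXs - G n)"
      proof -
        have "integrable PXs (indicator (space PXs - G n) :: _ \<Rightarrow> real)"
          using Gs[of n] by (intro PXs.integrable_const_bound[of _ 1]) (auto simp: indicator_def)
        moreover have "(\<integral>w. indicator (space PXs - G n) w \<partial>PXs) = measure PXs (space PXs - G n)"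
          using Gs[of n] by (simp add: Int_absorb1)
        ultimately show ?thesis using PXs.prob_space by simp
      qed
      also have "\<dots> < r" using elim(1) by simp
      finally show ?case .
    qed
    then show "\<exists>no. \<forall>n\<ge>no. norm ((CLINT z|P \<Otimes>\<^sub>M PXs. iexp (t * stat n z)) - limit_char t - 0) < r"
      by (simp add: eventually_sequentially)
  qed
qed

end

section \<open>Asymptotic normality\<close>

text \<open>Independence is the product rule on rectangles, and a sigma-finite product measure is
  determined by its values there.\<close>

lemma distr_pair_indep_rv:
  assumes "prob_space M" and "indep_rv M S U T V"
  shows "distr M (S \<Otimes>\<^sub>M T) (\<lambda>w. (U w, V w)) = distr M S U \<Otimes>\<^sub>M distr M T V"
proof -
  interpret prob_space M by fact
  have [measurable]: "U \<in> measurable M S" "V \<in> measurable M T"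
    and ind: "indep_set {U -` A \<inter> space M | A. A \<in> sets S} {V -` B \<inter> space M | B. B \<in> sets T}"
    using assms(2) by (auto simp: indep_rv_def)
  interpret DU: prob_space "distr M S U" by (rule prob_space_distr) simp
  interpret DV: prob_space "distr M T V" by (rule prob_space_distr) simp
  show ?thesis
  proof (rule pair_measure_eqI[symmetric])
    show "sigma_finite_measure (distr M S U)" "sigma_finite_measure (distr M T V)" by unfold_locales
    show "sets (distr M S U \<Otimes>\<^sub>M distr M T V) = sets (distr M (S \<Otimes>\<^sub>M T) (\<lambda>w. (U w, V w)))"
      by (simp cong: sets_pair_measure_cong)
    fix A B assume "A \<in> sets (distr M S U)" "B \<in> sets (distr M T V)"
    then have AB[measurable]: "A \<in> sets S" "B \<in> sets T" by auto
    have "emeasure (distr M (S \<Otimes>\<^sub>M T) (\<lambda>w. (U w, V w))) (A \<times> B) = emeasure M ((\<lambda>w. (U w, V w)) -` (A \<times> B) \<inter> space M)"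
      by (rule emeasure_distr) auto
    also have "(\<lambda>w. (U w, V w)) -` (A \<times> B) \<inter> space M = (U -` A \<inter> space M) \<inter> (V -` B \<inter> space M)" by auto
    also have "emeasure M \<dots> = emeasure M (U -` A \<inter> space M) * emeasure M (V -` B \<inter> space M)"
    proof -
      have "prob ((U -` A \<inter> space M) \<inter> (V -` B \<inter> space M)) = prob (U -` A \<inter> space M) * prob (V -` B \<inter> space M)"
        by (rule indep_setD[OF ind]) (use AB in blast)+
      then show ?thesis by (simp add: emeasure_eq_measure ennreal_mult)
    qed
    finally show "emeasure (distr M S U) A * emeasure (distr M T V) B = emeasure (distr M (S \<Otimes>\<^sub>M T) (\<lambda>w. (U w, V w))) (A \<times> B)"
      by (simp add: emeasure_distr)
  qed
qed

lemma (in prob_space) distr_iid_sequence: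
  assumes ind: "indep_vars (\<lambda>_. borel) Z UNIV" and D: "\<And>i. distr M borel (Z i) = D"
  shows "distr M (PiM UNIV (\<lambda>_. borel)) (\<lambda>w i. Z i w) = PiM UNIV (\<lambda>_. D)"
proof -
  have "Z i \<in> measurable M borel" for i using ind by (simp add: indep_vars_def2)
  then have "distr M (PiM UNIV (\<lambda>_. borel)) (\<lambda>w. \<lambda>i\<in>UNIV. Z i w) = PiM UNIV (\<lambda>i. distr M borel (Z i))"
    using ind by (subst (asm) indep_vars_iff_distr_eq_PiM') auto
  then show ?thesis by (simp add: D restrict_def)
qed

lemma real_distribution_normal_law:
  assumes "0 \<le> v"
  shows "real_distribution (normal_law 0 v)"
proof (cases "v = 0")
  case True
  then show ?thesis
    by (auto simp: normal_law_def real_distribution_def real_distribution_axioms_def intro: prob_space_return)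
next
  case False
  then have "prob_space (density lborel (normal_density 0 (sqrt v)))"
    using assms by (intro prob_space_normal_density) simp
  then show ?thesis using False by (simp add: normal_law_def real_distribution_def real_distribution_axioms_def)
qed

text \<open>The case \<open>v = 0\<close> arises when the error density vanishes at the estimation
  point; otherwise the law is a rescaled standard normal law.\<close>

lemma char_normal_law:
  assumes "0 \<le> v"
  shows "char (normal_law 0 v) t = complex_of_real (exp (- (t\<^sup>2 * v / 2)))"
proof (cases "v = 0")
  case True
  then show ?thesis by (simp add: normal_law_def char_def integral_return)
next
  case False
  define \<sigma> where "\<sigma> = sqrt v"
  have \<sigma>: "0 < \<sigma>" using False assms by (simp add: \<sigma>_def)
  let ?M = "density lborel (normal_density 0 \<sigma>)"
  interpret prob_space ?M using \<sigma> by (rule prob_space_normal_density)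
  have "distributed ?M lborel (\<lambda>x. x) (normal_density 0 \<sigma>)"
    by (auto simp: distributed_def distr_id2)
  then have "distributed ?M lborel (\<lambda>x. (x - 0) / \<sigma>) std_normal_density"
    using normal_standard_normal_convert[OF \<sigma>, of "\<lambda>x. x" 0] by simp
  then have D: "distr ?M lborel (\<lambda>x. x / \<sigma>) = std_normal_distribution"
    by (auto dest: distributed_distr_eq_density)
  have "char std_normal_distribution (t * \<sigma>) = (CLINT x|?M. iexp (t * \<sigma> * (x / \<sigma>)))"
    unfolding char_def D[symmetric] by (subst integral_distr) auto
  also have "\<dots> = char (normal_law 0 v) t" using False \<sigma> by (simp add: char_def normal_law_def \<sigma>_def[symmetric])
  finally have "char (normal_law 0 v) t = complex_of_real (exp (- ((t * \<sigma>)\<^sup>2) / 2))"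
    by (simp only: char_std_normal_distribution)
  moreover have "\<sigma>\<^sup>2 = v" using assms by (simp add: \<sigma>_def)
  ultimately show ?thesis by (simp add: power_mult_distrib)
qed

lemma Ck_real_deriv:
  assumes "Ck_real k h" "j < k"
  shows "((deriv ^^ j) h has_real_derivative (deriv ^^ Suc j) h x) (at x)"
  using assms by (simp add: Ck_real_def DERIV_deriv_iff_real_differentiable)

text \<open>Beyond the radius \<open>R\<close> the function vanishes on an open set, so its
  derivative vanishes there too. Being continuous, the derivative is bounded, and the mean value
  theorem gives the Lipschitz constant.\<close>

lemma compact_support_lipschitz:
  fixes K :: "real \<Rightarrow> real"
  assumes "compact (closure {v. K v \<noteq> 0})" and C1: "\<And>x. (K has_real_derivative K' x) (at x)" and K': "continuous_on UNIV K'"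
  obtains R B L where "0 < R" "\<And>u. R < \<bar>u\<bar> \<Longrightarrow> K u = 0" "\<And>u. \<bar>K u\<bar> \<le> B" "\<And>u v. \<bar>K u - K v\<bar> \<le> L * \<bar>u - v\<bar>"
proof -
  obtain R0 where R0: "\<And>v. v \<in> closure {v. K v \<noteq> 0} \<Longrightarrow> \<bar>v\<bar> \<le> R0"
    using compact_imp_bounded[OF assms(1)] by (auto simp: bounded_iff)
  define R where "R = \<bar>R0\<bar> + 1"
  have supp: "K u = 0" if "R < \<bar>u\<bar>" for u
  proof (rule ccontr)
    assume "K u \<noteq> 0"
    then have "u \<in> closure {v. K v \<noteq> 0}" using closure_subset[THEN subsetD, of u "{v. K v \<noteq> 0}"] by simp
    from R0[OF this] that show False by (simp add: R_def)
  qed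
  have supp': "K' u = 0" if "R < \<bar>u\<bar>" for u
  proof -
    have op: "open {u :: real. R < \<bar>u\<bar>}" by (intro open_Collect_less continuous_intros)
    have "(K has_real_derivative 0) (at u)"
      by (rule has_field_derivative_transform_within_open[OF DERIV_const op]) (use that supp in auto)
    then show ?thesis using C1 DERIV_unique by blast
  qed
  have bdd: "\<exists>B. \<forall>u. \<bar>G u\<bar> \<le> B" if G: "continuous_on UNIV G" and G0: "\<And>u. R < \<bar>u\<bar> \<Longrightarrow> G u = 0" for G :: "real \<Rightarrow> real"
  proof -
    have "compact (G ` {-R..R})" using G by (intro compact_continuous_image) (auto intro: continuous_on_subset)
    then obtain B where B: "\<And>u. u \<in> {-R..R} \<Longrightarrow> \<bar>G u\<bar> \<le> B" using compact_imp_bounded by (fastforce simp: bounded_iff)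
    have "\<bar>G u\<bar> \<le> \<bar>B\<bar>" for u
    proof (cases "R < \<bar>u\<bar>")
      case False
      then have "u \<in> {-R..R}" by auto
      from B[OF this] show ?thesis by linarith
    qed (use G0 in simp)
    then show ?thesis by blast
  qed
  have "continuous_on UNIV K" using C1 by (intro DERIV_continuous_on) auto
  then obtain B where B: "\<And>u. \<bar>K u\<bar> \<le> B" using bdd supp by blast
  obtain L where L: "\<And>u. \<bar>K' u\<bar> \<le> L" using bdd[OF K' supp'] by blast
  show ?thesis
  proof (rule that[of R B L])
    show "0 < R" by (simp add: R_def)
    show "\<bar>K u - K v\<bar> \<le> L * \<bar>u - v\<bar>" for u v
      using field_differentiable_bound[of UNIV K K' L u v] C1 L by simp
  qed (use supp B in auto)
qed

theorem theorem3p4: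
  fixes M :: "'a measure"
    and X :: "nat \<Rightarrow> 'a \<Rightarrow> real ^ 'd" and Y \<epsilon>s :: "nat \<Rightarrow> 'a \<Rightarrow> real"
    and m g :: "real ^ 'd \<Rightarrow> real" and f :: "real \<Rightarrow> real"
    and \<X> \<X>\<^sub>0 :: "(real ^ 'd) set"
    and K0 :: "real ^ 'd \<Rightarrow> real" and K1 :: "real \<Rightarrow> real"
    and b0 b1 :: "nat \<Rightarrow> real" and d :: nat and \<epsilon> :: real
  assumes "prob_space M"
    and d: "d = CARD('d)"
    and iid_indep: "prob_space.indep_vars M (\<lambda>_. borel) (\<lambda>i \<omega>. (X i \<omega>, Y i \<omega>)) UNIV"
    and iid_distr: "\<And>i. distr M borel (\<lambda>\<omega>. (X i \<omega>, Y i \<omega>)) = distr M borel (\<lambda>\<omega>. (X 0 \<omega>, Y 0 \<omega>))"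
    and regression: "regression_function M (X 0) (Y 0) m"
    and model: "\<And>i \<omega>. \<omega> \<in> space M \<Longrightarrow> Y i \<omega> = m (X i \<omega>) + \<epsilon>s i \<omega>"
    and X_supp: "\<X> = rv_support M (X 0)" "compact \<X>"
    and X0: "closed \<X>\<^sub>0" "\<X>\<^sub>0 \<subseteq> interior \<X>" "interior \<X>\<^sub>0 \<noteq> {}"
    and g: "\<And>x. 0 \<le> g x" "distributed M lborel (X 0) (\<lambda>x. ennreal (g x))"
    and g_reg: "\<And>x. x \<in> \<X>\<^sub>0 \<Longrightarrow> 0 < g x" "C2_over \<X> g"
    and m_reg: "C2_over \<X> m"
    and err_indep: "prob_space.indep_vars M (\<lambda>_. borel) \<epsilon>s UNIV"
    and err_distr: "\<And>i. distr M borel (\<epsilon>s i) = distr M borel (\<epsilon>s 0)"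
    and err_mean: "\<And>i. (LINT \<omega>|M. \<epsilon>s i \<omega>) = 0"
    and err_moment: "\<And>i. integrable M (\<lambda>\<omega>. (\<epsilon>s i \<omega>) ^ 6)"
    and err_X_indep: "indep_rv M
          (PiM UNIV (\<lambda>_. borel)) (\<lambda>\<omega> i. \<epsilon>s i \<omega>) (PiM UNIV (\<lambda>_. borel)) (\<lambda>\<omega> i. X i \<omega>)"
    and f: "\<And>e. 0 \<le> f e" "distributed M lborel (\<epsilon>s 0) (\<lambda>e. ennreal (f e))"
    and f_reg: "Ck_real 2 f" "bounded (range ((deriv ^^ 2) f))"
    and h_bounded: "\<And>p k :: nat. p \<le> 2 \<Longrightarrow> k \<le> 2 \<Longrightarrow>
          bounded (range ((deriv ^^ k) (\<lambda>e. e ^ p * f e)))"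
    and K0: "\<And>z. K0 (- z) = K0 z" "continuous_on UNIV K0"
      "closure {z. K0 z \<noteq> 0} \<subseteq> cbox (\<chi> i. - 1/2) (\<chi> i. 1/2)" "(LINT z|lborel. K0 z) = 1"
    and K1: "compact (closure {v. K1 v \<noteq> 0})" "Ck_real 3 K1"
      "(LINT v|lborel. K1 v) = 1" "(LINT v|lborel. v * K1 v) = 0"
    and b0: "\<And>n. 0 < b0 n" "decseq b0" "b0 \<longlonglongrightarrow> 0"
      "filterlim (\<lambda>n. real n * b0 n ^ max (d + 2) (2 * d) / ln (real n)) at_top sequentially"
      "filterlim (\<lambda>n. ln (1 / b0 n) / ln (ln (real n))) at_top sequentially"
    and b1: "\<And>n. 0 < b1 n" "decseq b1" "b1 \<longlonglongrightarrow> 0"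
      "filterlim (\<lambda>n. real n ^ (d + 8) * b1 n ^ (7 * (d + 4))) at_top sequentially"
    and b01: "(\<lambda>n. real n * b0 n ^ (d + 4)) \<in> O[sequentially](\<lambda>_. 1 :: real)"
      "(\<lambda>n. real n * b0 n ^ 4 * b1 n) \<in> o[sequentially](\<lambda>_. 1 :: real)"
      "filterlim (\<lambda>n. real n * b0 n ^ d * b1 n ^ 3) at_top sequentially"
  shows "\<exists>f_bar :: nat \<Rightarrow> real.
     (\<lambda>n. f_bar n - (f \<epsilon> + (b1 n)\<^sup>2 / 2 * (deriv ^^ 2) f \<epsilon> * (LINT v|lborel. v\<^sup>2 * K1 v)))
       \<in> o[sequentially](\<lambda>n. (b1 n)\<^sup>2) \<and>
     weak_conv_m
       (\<lambda>n. distr M borel (\<lambda>\<omega>. sqrt (real n * b1 n) *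
          (error_density_estimator K0 K1 (b0 n) (b1 n) \<X>\<^sub>0 X Y n \<epsilon> \<omega> - f_bar n)))
       (normal_law 0 (f \<epsilon> / \<P>(\<omega> in M. X 0 \<omega> \<in> \<X>\<^sub>0) * (LINT v|lborel. (K1 v)\<^sup>2)))"
proof -

  \<comment> \<open>Laws of the covariates and of the errors\<close>
  interpret prob_space M by fact
  have Xm[measurable]: "X i \<in> borel_measurable M" for i
  proof -
    have "(\<lambda>w. (X i w, Y i w)) \<in> borel_measurable M" using iid_indep by (simp add: indep_vars_def2)
    then have "(\<lambda>w. (X i w, Y i w)) \<in> measurable M (borel \<Otimes>\<^sub>M borel)" by (simp add: borel_prod)
    from measurable_compose[OF this measurable_fst] show ?thesis by simp
  qed
  have em[measurable]: "\<epsilon>s i \<in> borel_measurable M" for i using err_indep by (simp add: indep_vars_def2)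
  have X_indep: "indep_vars (\<lambda>_. borel) X UNIV"
  proof -
    have fm: "fst \<in> measurable (borel :: ((real ^ 'd) \<times> real) measure) borel"
      using measurable_fst[of "borel :: (real ^ 'd) measure" "borel :: real measure"] by (simp add: borel_prod)
    show ?thesis using indep_vars_compose2[OF iid_indep, of "\<lambda>_. fst" "\<lambda>_. borel"] fm by simp
  qed
  have X_distr: "distr M borel (X i) = distr M borel (X 0)" for i
  proof -
    have fm: "fst \<in> measurable (borel :: ((real ^ 'd) \<times> real) measure) borel"
      using measurable_fst[of "borel :: (real ^ 'd) measure" "borel :: real measure"] by (simp add: borel_prod)
    have pm: "(\<lambda>w. (X j w, Y j w)) \<in> measurable M borel" for j using iid_indep by (simp add: indep_vars_def2)
    have "distr M borel (X j) = distr (distr M borel (\<lambda>w. (X j w, Y j w))) borel fst" for j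
      using distr_distr[OF fm pm[of j]] by (simp add: comp_def)
    then show ?thesis using iid_distr[of i] by simp
  qed
  have X_law: "distr M borel (X 0) = density lborel (\<lambda>x. ennreal (g x))"
    using distributed_distr_eq_density[OF g(2)] distr_cong[OF refl sets_lborel refl, of M "X 0"] by simp
  have e_law: "distr M borel (\<epsilon>s i) = density lborel (\<lambda>x. ennreal (f x))" for i
    using distributed_distr_eq_density[OF f(2)] distr_cong[OF refl sets_lborel refl, of M "\<epsilon>s 0"] err_distr[of i] by simp
  define f1 where "f1 = deriv f"
  define f2 where "f2 = (deriv ^^ 2) f"
  have f_der: "(f has_real_derivative f1 x) (at x)" "(f1 has_real_derivative f2 x) (at x)" for x
    using Ck_real_deriv[OF f_reg(1), of 0 x] Ck_real_deriv[OF f_reg(1), of 1 x] by (simp_all add: f1_def f2_def numeral_2_eq_2)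
  \<comment> \<open>The case \<open>p = 0\<close> of the assumption on the functions
    \<open>e ^ p * f e\<close>.\<close>
  have bd: "\<exists>B. \<forall>x. \<bar>(deriv ^^ k) f x\<bar> \<le> B" if "k \<le> 2" for k
    using h_bounded[of 0 k] that by (auto simp: bounded_iff)
  obtain F where F: "\<And>x. \<bar>f x\<bar> \<le> F" using bd[of 0] by auto
  obtain F1 where F1: "\<And>x. \<bar>f1 x\<bar> \<le> F1" using bd[of 1] by (auto simp: f1_def)
  obtain F2 where F2: "\<And>x. \<bar>f2 x\<bar> \<le> F2" using bd[of 2] by (auto simp: f2_def)
  have K1_der: "(K1 has_real_derivative deriv K1 x) (at x)" "(deriv K1 has_real_derivative (deriv ^^ 2) K1 x) (at x)" for x
    using Ck_real_deriv[OF K1(2), of 0 x] Ck_real_deriv[OF K1(2), of 1 x] by (simp_all add: numeral_2_eq_2)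
  have K1_c: "continuous_on UNIV (deriv K1)" using K1_der(2) by (intro DERIV_continuous_on) auto
  obtain R B L where R: "0 < R" "\<And>u. R < \<bar>u\<bar> \<Longrightarrow> K1 u = 0" "\<And>u. \<bar>K1 u\<bar> \<le> B" "\<And>u v. \<bar>K1 u - K1 v\<bar> \<le> L * \<bar>u - v\<bar>"
    by (rule compact_support_lipschitz[OF K1(1) K1_der(1) K1_c]) (rule that; assumption)
  have prob_e: "prob_space (density lborel (\<lambda>x. ennreal (f x)))" using prob_space_distr[OF em[of 0]] by (simp add: e_law)
  have prob_X: "prob_space (density lborel (\<lambda>x. ennreal (g x)))" using prob_space_distr[OF Xm[of 0]] by (simp add: X_law)
  have "integrable M (\<lambda>w. (\<epsilon>s 0 w)\<^sup>2)"
  proof (rule Bochner_Integration.integrable_bound)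
    show "integrable M (\<lambda>w. 1 + (\<epsilon>s 0 w) ^ 6)" using err_moment by simp
    \<comment> \<open>The sixth moment dominates the second: \<open>u\<^sup>2 \<le> 1\<close> near
      zero and \<open>u\<^sup>2 \<le> u ^ 6\<close> elsewhere.\<close>
    have "u\<^sup>2 \<le> 1 + u ^ 6" for u :: real
    proof (cases "\<bar>u\<bar> \<le> 1")
      case True
      then have "u\<^sup>2 \<le> 1" by (simp add: abs_square_le_1)
      then show ?thesis by (simp add: add_increasing2)
    next
      case False
      have "\<bar>u\<bar> ^ 2 \<le> \<bar>u\<bar> ^ 6" using False by (intro power_increasing) auto
      then show ?thesis by simp
    qed
    then show "AE w in M. norm ((\<epsilon>s 0 w)\<^sup>2) \<le> norm (1 + (\<epsilon>s 0 w) ^ 6)"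
      by (intro AE_I2) simp
  qed simp
  then have e_sq: "integrable (density lborel (\<lambda>x. ennreal (f x))) (\<lambda>u. u\<^sup>2)"
    unfolding e_law[of 0, symmetric] by (subst integrable_distr_eq) auto
  have e_mean: "(\<integral>u. u \<partial>density lborel (\<lambda>x. ennreal (f x))) = 0"
    unfolding e_law[of 0, symmetric] using err_mean[of 0] by (subst integral_distr) auto
  have gm: "g \<in> borel_measurable borel" using distributed_real_measurable[OF _ g(2)] g(1) by simp
  have S0ne: "\<X>\<^sub>0 \<noteq> {}" using X0(3) interior_subset by blast
  have p0: "\<P>(\<omega> in M. X 0 \<omega> \<in> \<X>\<^sub>0) = measure (density lborel (\<lambda>x. ennreal (g x))) \<X>\<^sub>0"
    unfolding X_law[symmetric] using X0(1) by (subst measure_distr) (auto intro!: arg_cong[where f="measure M"])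
  have p0_pos: "0 < \<P>(\<omega> in M. X 0 \<omega> \<in> \<X>\<^sub>0)"
  proof -
    \<comment> \<open>An interior point of \<open>\<X>\<^sub>0\<close> lies in the support of
      \<open>X 0\<close>, so its open neighbourhood \<open>interior \<X>\<^sub>0\<close> has
      positive probability.\<close>
    obtain x0 where x0: "x0 \<in> interior \<X>\<^sub>0" using X0(3) by blast
    then have "x0 \<in> rv_support M (X 0)" using X0(2) interior_subset X_supp(1) by blast
    then have "0 < \<P>(\<omega> in M. X 0 \<omega> \<in> interior \<X>\<^sub>0)" using x0 unfolding rv_support_def by auto
    also have "\<dots> \<le> \<P>(\<omega> in M. X 0 \<omega> \<in> \<X>\<^sub>0)"
    proof (rule finite_measure_mono)
      have [measurable]: "\<X>\<^sub>0 \<in> sets borel" using X0(1) by simp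
      show "{\<omega> \<in> space M. X 0 \<omega> \<in> \<X>\<^sub>0} \<in> events" by measurable
    qed (use interior_subset[of \<X>\<^sub>0] in auto)
    finally show ?thesis .
  qed
  interpret RD: regression_design g m K0 \<X> \<X>\<^sub>0 d
  proof (rule regression_design.intro)
    show "m \<in> borel_measurable borel" using regression by (simp add: regression_function_def)
  qed (fact d g gm prob_X X_supp X0 S0ne g_reg m_reg K0)+
  interpret RA: regression_asymptotics g m K0 \<X> \<X>\<^sub>0 d b0 b1
  proof (intro regression_asymptotics.intro[OF RD.regression_design_axioms] regression_asymptotics_axioms.intro)
    show "(\<lambda>n. real n * b0 n ^ 4 * b1 n) \<longlonglongrightarrow> 0" using smalloD_tendsto[OF b01(2)] by simp
  qed (use b0 b1 b01 in simp_all)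
  have PX: "RD.PX = density lborel (\<lambda>x. ennreal (g x))" by (rule RD.PX_def)
  interpret D: residual_density f f1 f2 K1 F F1 F2 L R B g m K0 \<X> \<X>\<^sub>0 d b0 b1 \<epsilon>
  proof (intro residual_density.intro density_kernel_noise.intro density_kernel.intro
      density_kernel_noise_axioms.intro residual_density_axioms.intro RA.regression_asymptotics_axioms)
    show "f x \<le> F" for x using F[of x] by simp
    show "continuous_on UNIV f2" using f_reg(1) by (simp add: Ck_real_def f2_def)
    show "0 < RA.p0" using p0_pos unfolding p0 RA.p0_def PX .
  qed (fact f prob_e F1 F2 f_der R e_sq e_mean)+

  \<comment> \<open>Transfer from the product space and passage to the limit\<close>
  let ?v = "f \<epsilon> / \<P>(\<omega> in M. X 0 \<omega> \<in> \<X>\<^sub>0) * (LINT v|lborel. (K1 v)\<^sup>2)"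
  have v: "0 \<le> ?v" using f(1)[of \<epsilon>] by (intro mult_nonneg_nonneg divide_nonneg_nonneg) auto
  define \<Phi> where "\<Phi> w = ((\<lambda>i. \<epsilon>s i w), (\<lambda>i. X i w))" for w
  let ?S = "PiM UNIV (\<lambda>_::nat. borel :: real measure)" and ?T = "PiM UNIV (\<lambda>_::nat. borel :: (real ^ 'd) measure)"
  have \<Phi>m: "\<Phi> \<in> measurable M (?S \<Otimes>\<^sub>M ?T)"
    using err_X_indep unfolding \<Phi>_def[abs_def] indep_rv_def by (intro measurable_Pair) auto
  \<comment> \<open>Independence of the two sequences gives a product of two laws, and each factor
    is itself an infinite product because the errors and the covariates are independent and
    identically distributed.\<close>
  have joint: "distr M (?S \<Otimes>\<^sub>M ?T) \<Phi> = D.P \<Otimes>\<^sub>M RA.PXs"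
    unfolding \<Phi>_def[abs_def] distr_pair_indep_rv[OF \<open>prob_space M\<close> err_X_indep]
    using distr_iid_sequence[OF err_indep e_law] distr_iid_sequence[OF X_indep, of RD.PX] X_distr X_law PX by simp
  have sets_joint: "sets (D.P \<Otimes>\<^sub>M RA.PXs) = sets (?S \<Otimes>\<^sub>M ?T)" unfolding joint[symmetric] by simp
  have stm: "D.stat n \<in> borel_measurable (?S \<Otimes>\<^sub>M ?T)" for n
    using D.stat_meas[of n] measurable_cong_sets[OF sets_joint refl, of borel] by simp
  let ?stat = "\<lambda>n \<omega>. sqrt (real n * b1 n) * (error_density_estimator K0 K1 (b0 n) (b1 n) \<X>\<^sub>0 X Y n \<epsilon> \<omega> - D.fbar \<epsilon> (b1 n))"
  \<comment> \<open>The model equation holds pointwise on \<open>space M\<close>, so the responses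
    can be rewritten in terms of covariates and errors before passing to laws.\<close>
  have stat_eq: "?stat n w = D.stat n (\<Phi> w)" if "w \<in> space M" for n w
    using that by (simp add: D.stat_def \<Phi>_def error_density_estimator_def est_residual_def loo_regression_def model)
  have stat_distr: "distr M borel (?stat n) = distr M borel (\<lambda>w. D.stat n (\<Phi> w))" for n
    by (rule distr_cong) (use stat_eq in auto)
  have comp_m: "(\<lambda>w. D.stat n (\<Phi> w)) \<in> borel_measurable M" for n
    by (rule measurable_compose[OF \<Phi>m stm])
  have conv: "weak_conv_m (\<lambda>n. distr M borel (?stat n)) (normal_law 0 ?v)"
  proof (rule levy_continuity)
    show "real_distribution (distr M borel (?stat n))" for n
      unfolding stat_distr by (rule real_distribution_distr[OF comp_m])
    show "real_distribution (normal_law 0 ?v)" by (rule real_distribution_normal_law[OF v])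
    fix t
    have "char (distr M borel (?stat n)) t = (CLINT z|D.P \<Otimes>\<^sub>M RA.PXs. iexp (t * D.stat n z))" for n
    proof -
      have "char (distr M borel (?stat n)) t = (CLINT w|M. iexp (t * D.stat n (\<Phi> w)))"
        unfolding stat_distr char_def by (rule integral_distr[OF comp_m]) simp
      also have "\<dots> = (CLINT z|distr M (?S \<Otimes>\<^sub>M ?T) \<Phi>. iexp (t * D.stat n z))"
        by (rule integral_distr[OF \<Phi>m, symmetric]) (use stm[of n] in measurable)
      finally show ?thesis unfolding joint .
    qed
    moreover have "char (normal_law 0 ?v) t = D.limit_char t"
      using char_normal_law[OF v, of t] unfolding D.limit_char_def RA.p0_def PX p0 .
    ultimately show "(\<lambda>n. char (distr M borel (?stat n)) t) \<longlonglongrightarrow> char (normal_law 0 ?v) t"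
      using D.joint_char_limit[of t] by simp
  qed
  have expansion: "(\<lambda>n. D.fbar \<epsilon> (b1 n) - (f \<epsilon> + (b1 n)\<^sup>2 / 2 * (deriv ^^ 2) f \<epsilon> * (LINT v|lborel. v\<^sup>2 * K1 v)))
      \<in> o[sequentially](\<lambda>n. (b1 n)\<^sup>2)"
  proof (rule landau_o.smallI)
    fix c :: real assume c: "0 < c"
    obtain h0 where h0: "0 < h0" "\<And>h. 0 < h \<Longrightarrow> h < h0 \<Longrightarrow>
        \<bar>D.fbar \<epsilon> h - (f \<epsilon> + h\<^sup>2 / 2 * f2 \<epsilon> * (\<integral>v. v\<^sup>2 * K1 v \<partial>lborel))\<bar> \<le> c * h\<^sup>2"
      using D.fbar_expansion[OF K1(3,4) c, of \<epsilon>] by blast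
    have "\<forall>\<^sub>F n in sequentially. b1 n < h0" by (rule order_tendstoD(2)[OF b1(3) h0(1)])
    then show "\<forall>\<^sub>F n in sequentially. norm (D.fbar \<epsilon> (b1 n) - (f \<epsilon> + (b1 n)\<^sup>2 / 2 * (deriv ^^ 2) f \<epsilon> * (LINT v|lborel. v\<^sup>2 * K1 v)))
        \<le> c * norm ((b1 n)\<^sup>2)"
      by eventually_elim (use h0(2) b1(1) in \<open>simp add: f2_def\<close>)
  qed
  \<comment> \<open>One sequence serves both claims: the exact mean of the estimate from true errors
    centres the statistic, and its Taylor expansion is the required one.\<close>
  show ?thesis by (intro exI[of _ "\<lambda>n. D.fbar \<epsilon> (b1 n)"] conjI expansion conv)
qed

end
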